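(* Let $\beta>0$ be fixed. Let $m\ge1$ be an integer and $a_1,a_2>\frac{\beta}{2}(m-1)$, where $m$ and $a_1$ depend on $a_2$. Let $\mu=(\mu_1,\dots,\mu_m)$ be a beta-Laguerre ensemble with density $f_{\beta,a_1}$, put $r:=1+\frac{\beta}{2}(m-1)$ and $$U_m:=\frac{r}{2a_2}\sum_{i=1}^m(\mu_i-2a_1)-\frac{a_2-r}{8a_2^2}\sum_{i=1}^m(\mu_i-2a_1)^2 .$$ Assume, as $a_2\to\infty$, one of the following: (A2) $m\to\infty$, $\frac{m}{a_1}\to0$ and $\frac{ma_1}{a_2}\to\sigma>0$; or (A3) $m\to\infty$, $\frac{a_1}{\sqrt{a_2}}\to x>0$ and $\frac{m}{\sqrt{a_2}}\to y>0$, in which case set $\sigma:=xy$. Then $$U_m+\frac{(a_2-r)a_1mr}{2a_2^2}\to N\Big(0,\frac{\beta\sigma^2}{4}\Big)$$ weakly as $a_2\to\infty$. Here $\frac{(a_2-r)a_1mr}{2a_2^2}=-\mathbb{E}U_m$.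
   Context: The beta-Laguerre density with parameter $a_1>\frac{\beta}{2}(m-1)$ is, on $[0,\infty)^m$, with $r=1+\frac{\beta}{2}(m-1)$, $$f_{\beta,a_1}(x_1,\dots,x_m)=C_{\rm L}^{\beta,a_1}\prod_{1\le i<j\le m}|x_i-x_j|^{\beta}\prod_{i=1}^m x_i^{a_1-r}\,e^{-\frac12\sum_{i=1}^m x_i},$$ $$C_{\rm L}^{\beta,a_1}=2^{-ma_1}\prod_{j=1}^m\frac{\Gamma(1+\beta/2)}{\Gamma(1+\beta j/2)\,\Gamma(a_1-\beta(m-j)/2)}.$$ $N(\theta,s^2)$ denotes the normal distribution with mean $\theta$ and variance $s^2$. *)

theory Defs
  imports "HOL-Probability.Probability"
begin

definition laguerre_r :: "real \<Rightarrow> nat \<Rightarrow> real" where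
  "laguerre_r \<beta> m = 1 + \<beta> / 2 * (real m - 1)"

definition laguerre_const :: "real \<Rightarrow> nat \<Rightarrow> real \<Rightarrow> real" where
  "laguerre_const \<beta> m a1 =
     2 powr (- (real m * a1)) *
     (\<Prod>j = 1..m. Gamma (1 + \<beta> / 2) /
        (Gamma (1 + \<beta> * real j / 2) * Gamma (a1 - \<beta> * (real m - real j) / 2)))"

(* Vectors of length m are functions on the index set {1..m}. The density is extended
   by 0 from [0,\<infinity>)^m to all of R^m. On the null set where some x i = 0, the convention
   0 powr a = 0 applies. *)
definition laguerre_density :: "real \<Rightarrow> nat \<Rightarrow> real \<Rightarrow> (nat \<Rightarrow> real) \<Rightarrow> real" where
  "laguerre_density \<beta> m a1 x =
     (if \<forall>i\<in>{1..m}. 0 \<le> x i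
      then laguerre_const \<beta> m a1 *
           (\<Prod>j = 1..m. \<Prod>i = 1..<j. \<bar>x i - x j\<bar> powr \<beta>) *
           (\<Prod>i = 1..m. x i powr (a1 - laguerre_r \<beta> m)) *
           exp (- (1 / 2) * (\<Sum>i = 1..m. x i))
      else 0)"

definition laguerre_ensemble ::
  "real \<Rightarrow> nat \<Rightarrow> real \<Rightarrow> 'w measure \<Rightarrow> ('w \<Rightarrow> nat \<Rightarrow> real) \<Rightarrow> bool" where
  "laguerre_ensemble \<beta> m a1 M \<mu> \<longleftrightarrow>
     prob_space M \<and>
     distributed M (PiM {1..m} (\<lambda>_. lborel)) \<mu> (\<lambda>x. ennreal (laguerre_density \<beta> m a1 x))"

definition U_stat :: "real \<Rightarrow> nat \<Rightarrow> real \<Rightarrow> real \<Rightarrow> (nat \<Rightarrow> real) \<Rightarrow> real" where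
  "U_stat \<beta> m a1 a2 x =
     laguerre_r \<beta> m / (2 * a2) * (\<Sum>i = 1..m. (x i - 2 * a1))
     - (a2 - laguerre_r \<beta> m) / (8 * a2\<^sup>2) * (\<Sum>i = 1..m. (x i - 2 * a1)\<^sup>2)"

definition U_centering :: "real \<Rightarrow> nat \<Rightarrow> real \<Rightarrow> real \<Rightarrow> real" where
  "U_centering \<beta> m a1 a2 =
     (a2 - laguerre_r \<beta> m) * a1 * real m * laguerre_r \<beta> m / (2 * a2\<^sup>2)"

definition normal_distribution :: "real \<Rightarrow> real \<Rightarrow> real measure" where
  "normal_distribution \<theta> s2 = density lborel (\<lambda>x. ennreal (normal_density \<theta> (sqrt s2) x))"

(* The library's weak_conv_m is restricted to sequences; here the parameter is real. *)
definition weak_conv_along ::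
  "('i \<Rightarrow> real measure) \<Rightarrow> real measure \<Rightarrow> 'i filter \<Rightarrow> bool" where
  "weak_conv_along P Q F \<longleftrightarrow>
     (\<forall>x. isCont (cdf Q) x \<longrightarrow> ((\<lambda>i. cdf (P i) x) \<longlongrightarrow> cdf Q x) F)"

lemma weak_conv_along_sequentially:
  "weak_conv_along P Q sequentially \<longleftrightarrow> weak_conv_m P Q"
  by (simp add: weak_conv_along_def weak_conv_m_def weak_conv_def)

end

(* Integration by parts in a single coordinate is legitimate for every beta > 0, because the singularity
   |x i - x j| powr (beta - 1) is integrable; summed over the coordinates it yields the loop equations.
   Write p_n for the n-th power sum, k = 2 (a1 + r) and s = m a1.  Then Z = p_2 - 2 k p_1 + 2 k s is an
   eigenfunction, with eigenvalue -1, of the generator of the Laguerre diffusion, and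
     U + centering = r^2 / (2 a2^2) (p_1 - 2 s) - (a2 - r) / (8 a2^2) Z.
   The first summand tends to 0 in mean.  For the second, the eigenfunction property gives the Stein
   identity E[Z phi(Z)] = 4 E[H phi'(Z)] with H the sum of the x i (x i - k)^2; a further loop
   equation expresses E[H phi(Z)] as 4 beta s^2 E[phi(Z)] plus terms of smaller order.  For phi a
   cosine this is an approximate Gaussian differential equation for the characteristic function, and
   Levy's continuity theorem concludes. *)

theory Submission
  imports Defs "HOL-Real_Asymp.Real_Asymp"
begin

section \<open>One-dimensional and combinatorial preliminaries\<close>

text \<open>The obstacle is that the loop equations do not close: each brings in the next power sum,
  and from n = 2 on also the product p_1^2. Combining them along the generator confines the damage.
  On H the generator again acts almost as a scalar, -3/2; it leaves behind 6 beta s^2, a multiple of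
  Z, and terms governed by the exactly known fluctuation of p_1. Hence H may be traded for 4 beta
  s^2 against any smooth bounded function of Z, at the price of mean absolute values only. The
  scales decide what survives. In both regimes s is about sigma a2 while k = o(a2), so that E|R| =
  o(a2^2) for the remainder R of H and E|J| = o(a2^3) for the mixed term J. The coefficient of Z is
  about 1 / (8 a2), and the variance of Z is about 16 beta s^2; this is the origin of 16 beta
  sigma^2 / 64 = beta sigma^2 / 4. Integrability needs care: for a1 < r the density is unbounded at
  the faces x i = 0, and for beta < 1 its derivative is unbounded at the diagonals.\<close>

definition gamma_weight :: "real \<Rightarrow> real \<Rightarrow> real" where
  "gamma_weight a u = indicator {0<..} u * (u powr a * exp (- u / 4))"

lemma gamma_weight_nonneg: "0 \<le> gamma_weight a u"
  by (simp add: gamma_weight_def)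

lemma gamma_weight_measurable [measurable]: "gamma_weight a \<in> borel_measurable borel"
  unfolding gamma_weight_def by measurable

text \<open>This is the integrand of \<open>Gamma (a + 1)\<close> at rate 1/4, obtained from the
  complex Gamma integral by passing to norms.\<close>

lemma integrable_gamma_weight:
  assumes "a > -1"
  shows "integrable lborel (gamma_weight a)"
proof -
  have "(\<lambda>t. complex_of_real t powr (complex_of_real (a + 1) - 1) / of_real (exp (1/4 * t)))
          absolutely_integrable_on {0<..}"
    using assms by (intro absolutely_integrable_Gamma_integral) auto
  then have "set_integrable lebesgue {0<..}
      (\<lambda>t. norm (complex_of_real t powr (complex_of_real (a + 1) - 1) / of_real (exp (1/4 * t))))"
    by (rule set_integrable_norm)
  also have "?this \<longleftrightarrow> set_integrable lebesgue {0<..} (\<lambda>t. t powr a * exp (- t / 4))"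
    by (intro set_integrable_cong)
       (auto simp: norm_divide norm_powr_real_powr exp_minus field_simps simp flip: exp_of_real)
  finally have "integrable lebesgue (gamma_weight a)"
    by (simp add: set_integrable_def gamma_weight_def[abs_def])
  then show ?thesis
    by (simp add: integrable_completion)
qed

text \<open>The inequality v \<le> exp v at v = u / (4 * a), raised to the power \<open>a\<close>,
  gives the (not sharp) constant \<open>(4 * a) powr a\<close>.\<close>

lemma gamma_weight_bounded:
  assumes "a > 0"
  shows "\<exists>C>0. \<forall>u. gamma_weight a u \<le> C"
proof -
  define C where "C = (4 * a) powr a"
  have "gamma_weight a u \<le> C" for u
  proof (cases "u > 0")
    case True
    have "u / (4 * a) \<le> exp (u / (4 * a))"
      using exp_ge_add_one_self[of "u / (4 * a)"] by linarith
    then have "(u / (4 * a)) powr a \<le> exp (u / (4 * a)) powr a"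
      using assms True by (intro powr_mono2) auto
    also have "\<dots> = exp (u / 4)"
      using assms by (simp add: powr_def)
    finally have "u powr a \<le> C * exp (u / 4)"
      using assms True by (simp add: C_def powr_divide field_simps)
    then show ?thesis
      using True by (simp add: gamma_weight_def exp_minus field_simps)
  next
    case False
    then show ?thesis by (simp add: gamma_weight_def C_def)
  qed
  moreover have "C > 0" using assms by (simp add: C_def)
  ultimately show ?thesis by blast
qed

text \<open>The density decays like \<open>exp (- S / 2)\<close> in the coordinate sum S. Half of
  the exponent is spent here on absorbing polynomial factors; the other half,
  \<open>exp (- S / 4)\<close>, is the rate built into \<open>gamma_weight\<close>.\<close>

lemma power_le_exp_quarter: "\<exists>C>0. \<forall>S\<ge>0. (1 + S) ^ N \<le> C * exp (S / 4 :: real)"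
proof -
  \<comment> \<open>Large enough that N / K \<le> 1/4, as the N-th power of
    \<open>exp (S / K)\<close> demands.\<close>
  define K where "K = 4 * (real N + 1)"
  have K: "K \<ge> 1" by (simp add: K_def)
  have "(1 + S) ^ N \<le> K ^ N * exp (S / 4)" if "S \<ge> 0" for S
  proof -
    have "1 + S \<le> K * (1 + S / K)"
      using K by (simp add: field_simps)
    also have "\<dots> \<le> K * exp (S / K)"
      using K by (intro mult_left_mono exp_ge_add_one_self) auto
    finally have "(1 + S) ^ N \<le> (K * exp (S / K)) ^ N"
      using that by (intro power_mono) auto
    also have "\<dots> = K ^ N * exp (real N * (S / K))"
      by (simp only: power_mult_distrib exp_of_nat_mult)
    also have "\<dots> \<le> K ^ N * exp (S / 4)"
      using that K by (intro mult_left_mono) (auto simp: K_def field_simps)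
    finally show ?thesis .
  qed
  moreover have "K ^ N > 0" using K by simp
  ultimately show ?thesis by blast
qed

text \<open>The part of |d|^(b - 1) close to d = 0: unbounded for b < 1, yet integrable over the
  line for b > 0. Away from 0 the power is dominated by \<open>\<bar>d\<bar> powr b\<close>.\<close>

definition near_diag :: "real \<Rightarrow> real \<Rightarrow> real" where
  "near_diag b d = indicator {0<..<1} \<bar>d\<bar> * \<bar>d\<bar> powr (b - 1)"

lemma near_diag_nonneg: "0 \<le> near_diag b d"
  by (simp add: near_diag_def)

lemma near_diag_measurable [measurable]: "near_diag b \<in> borel_measurable borel"
  unfolding near_diag_def by measurable

lemma abs_powr_minus_one_le: "\<bar>d\<bar> powr (b - 1) \<le> \<bar>d\<bar> powr b + near_diag b d"
proof -
  consider "d = 0" | "0 < \<bar>d\<bar>" "\<bar>d\<bar> < 1" | "\<bar>d\<bar> \<ge> 1" by linarith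
  then show ?thesis
    by cases (auto simp: near_diag_def intro: powr_mono)
qed

lemma integrable_near_diag:
  assumes "b > 0"
  shows "integrable lborel (near_diag b)"
proof -
  have "integrable lebesgue (\<lambda>x. indicator {0<..1} x *\<^sub>R x powr (b - 1))"
    using assms
    by (intro nonnegative_absolutely_integrable_1 [unfolded set_integrable_def] integrable_on_powr_from_0') auto
  then have *: "integrable lborel (\<lambda>x. indicator {0<..1} x *\<^sub>R x powr (b - 1))"
    by (simp add: integrable_completion)
  \<comment> \<open>The mirror image of the one-sided power, written in the form of an affine
    substitution. The two copies together dominate the even function
    \<open>near_diag\<close>.\<close>
  have "integrable lborel (\<lambda>x. indicator {0<..1} (0 + -1 * x) *\<^sub>R (0 + -1 * x) powr (b - 1))"
    using * by (subst lborel_integrable_real_affine_iff) auto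
  from Bochner_Integration.integrable_add[OF * this] show ?thesis
    by (rule Bochner_Integration.integrable_bound)
       (auto intro!: AE_I2 simp: near_diag_def indicator_def)
qed

text \<open>Fundamental theorem of calculus on [0, b], then b to infinity. The finite set
  \<open>S\<close> makes room for collisions with the other coordinates, where the primitive is
  continuous but possibly not differentiable.\<close>

lemma integral_derivative_half_line:
  fixes g g' :: "real \<Rightarrow> real"
  assumes S: "finite S"
    and deriv: "\<And>u. u > 0 \<Longrightarrow> u \<notin> S \<Longrightarrow> (g has_real_derivative g' u) (at u)"
    and cont: "continuous_on {0..} g" and g0: "g 0 = 0" and lim: "(g \<longlongrightarrow> 0) at_top"
    and neg: "\<And>u. u < 0 \<Longrightarrow> g' u = 0"
  shows "(\<integral>u. g' u \<partial>lborel) = 0"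
proof (cases "integrable lborel g'")
  \<comment> \<open>The Bochner integral of a non-integrable function is 0 by convention, so the
    identity can be asserted on every line.\<close>
  case False
  then show ?thesis by (rule not_integrable_integral_eq)
next
  case True
  have lim1: "((\<lambda>b. \<integral>u. indicator {..b} u *\<^sub>R g' u \<partial>lborel) \<longlongrightarrow> (\<integral>u. g' u \<partial>lborel)) at_top"
    by (rule tendsto_integral_at_top) (use True in auto)
  have "(\<integral>u. indicator {..b} u *\<^sub>R g' u \<partial>lborel) = g b" if "b \<ge> 0" for b
  proof -
    have hi: "(g' has_integral (g b - g 0)) {0..b}"
    proof (rule fundamental_theorem_of_calculus_interior_strong[OF S that])
      show "(g has_vector_derivative g' x) (at x)" if "x \<in> {0<..<b} - S" for x
        using deriv[of x] that by (auto simp: has_real_derivative_iff_has_vector_derivative)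
      show "continuous_on {0..b} g"
        by (rule continuous_on_subset[OF cont]) auto
    qed
    have si: "set_integrable lborel {0..b} g'"
      unfolding set_integrable_def using True by (intro integrable_mult_indicator) auto
    have "(\<integral>u. indicator {..b} u *\<^sub>R g' u \<partial>lborel) = (LINT u:{0..b}|lborel. g' u)"
      unfolding set_lebesgue_integral_def
      by (intro Bochner_Integration.integral_cong) (auto simp: indicator_def neg)
    also have "\<dots> = integral {0..b} g'"
      by (rule set_borel_integral_eq_integral(2)[OF si])
    also have "\<dots> = g b"
      using hi g0 by (simp add: integral_unique)
    finally show ?thesis .
  qed
  then have "((\<lambda>b. \<integral>u. indicator {..b} u *\<^sub>R g' u \<partial>lborel) \<longlongrightarrow> 0) at_top"
    by (intro Lim_transform_eventually[OF lim]) (auto intro: eventually_at_top_linorderI[of 0])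
  from tendsto_unique[OF _ lim1 this] show ?thesis by simp
qed

text \<open>In the pairs i < j the index \<open>k\<close> occurs as the larger or as the smaller
  member; symmetry merges both kinds into one product. For the pair factors of the density this
  isolates a single coordinate.\<close>

lemma prod_pairs_extract:
  fixes g :: "nat \<Rightarrow> nat \<Rightarrow> real"
  assumes sym: "\<And>i j. g i j = g j i" and k: "k \<in> {1..m}"
  shows "(\<Prod>j = 1..m. \<Prod>i = 1..<j. g i j) =
    (\<Prod>j\<in>{1..m} - {k}. g k j) * (\<Prod>j\<in>{1..m} - {k}. \<Prod>i\<in>{1..<j} - {k}. g i j)"
proof -
  have inner: "(\<Prod>i = 1..<j. g i j) = (if k < j then g k j else 1) * (\<Prod>i\<in>{1..<j} - {k}. g i j)" for j
  proof (cases "k < j")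
    case True
    then show ?thesis
      using k by (subst prod.remove[of "{1..<j}" k]) auto
  next
    case False
    then have "{1..<j} - {k} = {1..<j}" by auto
    with False show ?thesis by simp
  qed
  have split: "{1..m} - {k} = {1..<k} \<union> {k<..m}" using k by auto
  have upper: "(\<Prod>j\<in>{1..m} - {k}. if k < j then g k j else 1) = (\<Prod>j\<in>{k<..m}. g k j)"
    unfolding split by (subst prod.union_disjoint) (auto intro!: prod.neutral)
  have "(\<Prod>j = 1..m. \<Prod>i = 1..<j. g i j) =
      (\<Prod>i = 1..<k. g i k) * (\<Prod>j\<in>{1..m} - {k}. \<Prod>i = 1..<j. g i j)"
    using k by (subst prod.remove[of _ k]) auto
  also have "(\<Prod>j\<in>{1..m} - {k}. \<Prod>i = 1..<j. g i j) =
      (\<Prod>j\<in>{k<..m}. g k j) * (\<Prod>j\<in>{1..m} - {k}. \<Prod>i\<in>{1..<j} - {k}. g i j)"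
    unfolding inner prod.distrib upper ..
  also have "(\<Prod>i = 1..<k. g i k) = (\<Prod>j = 1..<k. g k j)"
    using sym by auto
  also have "(\<Prod>j = 1..<k. g k j) * ((\<Prod>j\<in>{k<..m}. g k j) * (\<Prod>j\<in>{1..m} - {k}. \<Prod>i\<in>{1..<j} - {k}. g i j))
     = (\<Prod>j\<in>{1..m} - {k}. g k j) * (\<Prod>j\<in>{1..m} - {k}. \<Prod>i\<in>{1..<j} - {k}. g i j)"
    unfolding split by (subst prod.union_disjoint) auto
  finally show ?thesis .
qed

lemma prod_le_power:
  fixes g :: "'a \<Rightarrow> real"
  assumes "\<And>i. i \<in> A \<Longrightarrow> 0 \<le> g i" "\<And>i. i \<in> A \<Longrightarrow> g i \<le> D" "1 \<le> D" "card A \<le> n"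
  shows "(\<Prod>i\<in>A. g i) \<le> D ^ n"
proof -
  have "(\<Prod>i\<in>A. g i) \<le> (\<Prod>i\<in>A. D)"
    using assms by (intro prod_mono) auto
  also have "\<dots> \<le> D ^ n"
    using assms by (auto intro: power_increasing)
  finally show ?thesis .
qed

definition power_sum :: "nat \<Rightarrow> nat \<Rightarrow> (nat \<Rightarrow> real) \<Rightarrow> real" where
  "power_sum m n x = (\<Sum>i = 1..m. x i ^ n)"

text \<open>Symmetrising in i and j produces difference quotients of t^(n+1), which expand into the
  sums of x_i^k x_j^(n-k). The subtracted term is the diagonal i = j: absent on the left, present in
  the products of power sums.\<close>

lemma sum_div_differences:
  fixes x :: "nat \<Rightarrow> real"
  assumes "inj_on x {1..m}"
  shows "(\<Sum>i = 1..m. \<Sum>j\<in>{1..m} - {i}. x i ^ Suc n / (x i - x j)) =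
    ((\<Sum>k\<le>n. power_sum m k x * power_sum m (n - k) x) - real (Suc n) * power_sum m n x) / 2"
proof -
  define D where "D = (\<Sum>i = 1..m. \<Sum>j\<in>{1..m} - {i}. x i ^ Suc n / (x i - x j))"
  have D_if: "D = (\<Sum>i = 1..m. \<Sum>j = 1..m. if i = j then 0 else x i ^ Suc n / (x i - x j))"
    unfolding D_def
  proof (rule sum.cong[OF refl])
    fix i assume "i \<in> {1..m}"
    then show "(\<Sum>j\<in>{1..m} - {i}. x i ^ Suc n / (x i - x j)) =
        (\<Sum>j = 1..m. if i = j then 0 else x i ^ Suc n / (x i - x j))"
      by (subst (2) sum.remove[of _ i]) (auto intro!: sum.cong)
  qed
  have D_swap: "D = (\<Sum>i = 1..m. \<Sum>j = 1..m. if i = j then 0 else x j ^ Suc n / (x j - x i))"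
    unfolding D_if by (subst sum.swap) (auto intro!: sum.cong)
  have "D + D = (\<Sum>i = 1..m. \<Sum>j = 1..m.
      (\<Sum>k\<le>n. x i ^ k * x j ^ (n - k)) - (if i = j then real (Suc n) * x i ^ n else 0))"
  proof -
    have "(if i = j then 0 else x i ^ Suc n / (x i - x j)) +
        (if i = j then 0 else x j ^ Suc n / (x j - x i)) =
        (\<Sum>k\<le>n. x i ^ k * x j ^ (n - k)) - (if i = j then real (Suc n) * x i ^ n else 0)"
      if ij: "i \<in> {1..m}" "j \<in> {1..m}" for i j
    proof (cases "i = j")
      case True
      have "(\<Sum>k\<le>n. x j ^ k * x j ^ (n - k)) = (\<Sum>k\<le>n. x j ^ n)"
        by (intro sum.cong) (auto simp flip: power_add)
      then show ?thesis using True by simp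
    next
      case False
      then have ne: "x i - x j \<noteq> 0"
        using assms ij by (auto dest: inj_onD)
      have "x i ^ Suc n - x j ^ Suc n = (x i - x j) * (\<Sum>k\<le>n. x i ^ k * x j ^ (n - k))"
        by (subst diff_power_eq_sum) (simp add: lessThan_Suc_atMost)
      moreover have "x i ^ Suc n / (x i - x j) + x j ^ Suc n / (x j - x i) =
          (x i ^ Suc n - x j ^ Suc n) / (x i - x j)"
        using ne by (simp add: divide_simps) (simp add: algebra_simps)
      ultimately show ?thesis using False ne by simp
    qed
    then show ?thesis
      by (subst (1) D_if, subst D_swap) (auto simp flip: sum.distrib intro!: sum.cong)
  qed
  also have "\<dots> = (\<Sum>k\<le>n. power_sum m k x * power_sum m (n - k) x) - real (Suc n) * power_sum m n x"
  proof -
    have "(\<Sum>i = 1..m. \<Sum>j = 1..m. \<Sum>k\<le>n. x i ^ k * x j ^ (n - k)) =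
        (\<Sum>i = 1..m. \<Sum>k\<le>n. \<Sum>j = 1..m. x i ^ k * x j ^ (n - k))"
      by (intro sum.cong refl sum.swap)
    also have "\<dots> = (\<Sum>k\<le>n. \<Sum>i = 1..m. \<Sum>j = 1..m. x i ^ k * x j ^ (n - k))"
      by (rule sum.swap)
    also have "\<dots> = (\<Sum>k\<le>n. power_sum m k x * power_sum m (n - k) x)"
      by (simp add: power_sum_def sum_product)
    finally show ?thesis
      by (simp add: sum_subtractf power_sum_def sum_distrib_left del: of_nat_Suc)
  qed
  finally show ?thesis unfolding D_def by simp
qed

section \<open>Integrability with respect to the Laguerre density\<close>

text \<open>The bound is asked for on the nonnegative orthant, which carries the density; there the
  coordinate sum serves as a norm.\<close>

definition poly_bounded :: "nat \<Rightarrow> ((nat \<Rightarrow> real) \<Rightarrow> real) \<Rightarrow> bool" where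
  "poly_bounded m g \<longleftrightarrow>
     (\<exists>C N. \<forall>x. (\<forall>i\<in>{1..m}. 0 \<le> x i) \<longrightarrow> \<bar>g x\<bar> \<le> C * (1 + (\<Sum>i = 1..m. x i)) ^ N)"

lemma poly_boundedE:
  assumes "poly_bounded m g"
  obtains C N where "C \<ge> 0"
    "\<And>x. (\<And>i. i \<in> {1..m} \<Longrightarrow> 0 \<le> x i) \<Longrightarrow> \<bar>g x\<bar> \<le> C * (1 + (\<Sum>i = 1..m. x i)) ^ N"
proof -
  obtain C N where CN: "\<And>x. (\<forall>i\<in>{1..m}. 0 \<le> x i) \<Longrightarrow> \<bar>g x\<bar> \<le> C * (1 + (\<Sum>i = 1..m. x i)) ^ N"
    using assms unfolding poly_bounded_def by blast
  have "0 \<le> C" using CN[of "\<lambda>_. 0"] by simp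
  with CN show ?thesis by (intro that[of C N]) auto
qed

lemma poly_bounded_bounded:
  assumes "\<And>x. \<bar>g x\<bar> \<le> C"
  shows "poly_bounded m g"
  unfolding poly_bounded_def using assms by (intro exI[of _ C] exI[of _ 0]) auto

lemma poly_bounded_const: "poly_bounded m (\<lambda>_. c)"
  by (rule poly_bounded_bounded[of _ "\<bar>c\<bar>"]) simp

lemma poly_bounded_component:
  assumes "i \<in> {1..m}"
  shows "poly_bounded m (\<lambda>x. x i)"
proof -
  have "\<bar>x i\<bar> \<le> 1 * (1 + (\<Sum>i = 1..m. x i)) ^ 1" if "\<forall>i\<in>{1..m}. 0 \<le> x i" for x :: "nat \<Rightarrow> real"
    using member_le_sum[of i "{1..m}" x] assms that by fastforce
  then show ?thesis unfolding poly_bounded_def by blast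
qed

lemma poly_bounded_mult:
  assumes "poly_bounded m f" "poly_bounded m g"
  shows "poly_bounded m (\<lambda>x. f x * g x)"
proof -
  obtain C N where C: "C \<ge> 0"
    "\<And>x. (\<And>i. i \<in> {1..m} \<Longrightarrow> 0 \<le> x i) \<Longrightarrow> \<bar>f x\<bar> \<le> C * (1 + (\<Sum>i = 1..m. x i)) ^ N"
    using poly_boundedE[OF assms(1)] by blast
  obtain D M where D: "D \<ge> 0"
    "\<And>x. (\<And>i. i \<in> {1..m} \<Longrightarrow> 0 \<le> x i) \<Longrightarrow> \<bar>g x\<bar> \<le> D * (1 + (\<Sum>i = 1..m. x i)) ^ M"
    using poly_boundedE[OF assms(2)] by blast
  have "\<bar>f x * g x\<bar> \<le> C * D * (1 + (\<Sum>i = 1..m. x i)) ^ (N + M)"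
    if "\<forall>i\<in>{1..m}. 0 \<le> x i" for x
  proof -
    have "\<bar>f x * g x\<bar> \<le> (C * (1 + (\<Sum>i = 1..m. x i)) ^ N) * (D * (1 + (\<Sum>i = 1..m. x i)) ^ M)"
      unfolding abs_mult using that C D
      by (intro mult_mono mult_nonneg_nonneg zero_le_power add_nonneg_nonneg sum_nonneg) auto
    then show ?thesis by (simp add: power_add algebra_simps)
  qed
  then show ?thesis unfolding poly_bounded_def by blast
qed

lemma poly_bounded_add:
  assumes "poly_bounded m f" "poly_bounded m g"
  shows "poly_bounded m (\<lambda>x. f x + g x)"
proof -
  obtain C N where C: "C \<ge> 0"
    "\<And>x. (\<And>i. i \<in> {1..m} \<Longrightarrow> 0 \<le> x i) \<Longrightarrow> \<bar>f x\<bar> \<le> C * (1 + (\<Sum>i = 1..m. x i)) ^ N"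
    using poly_boundedE[OF assms(1)] by blast
  obtain D M where D: "D \<ge> 0"
    "\<And>x. (\<And>i. i \<in> {1..m} \<Longrightarrow> 0 \<le> x i) \<Longrightarrow> \<bar>g x\<bar> \<le> D * (1 + (\<Sum>i = 1..m. x i)) ^ M"
    using poly_boundedE[OF assms(2)] by blast
  have "\<bar>f x + g x\<bar> \<le> (C + D) * (1 + (\<Sum>i = 1..m. x i)) ^ (N + M)"
    if x: "\<forall>i\<in>{1..m}. 0 \<le> x i" for x
  proof -
    have S: "1 \<le> 1 + (\<Sum>i = 1..m. x i)" using x by (auto intro!: sum_nonneg)
    have "\<bar>f x + g x\<bar> \<le> C * (1 + (\<Sum>i = 1..m. x i)) ^ N + D * (1 + (\<Sum>i = 1..m. x i)) ^ M"
      using C(2)[of x] D(2)[of x] x by fastforce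
    also have "\<dots> \<le> C * (1 + (\<Sum>i = 1..m. x i)) ^ (N + M) + D * (1 + (\<Sum>i = 1..m. x i)) ^ (N + M)"
      using C D S by (intro add_mono mult_left_mono power_increasing) auto
    finally show ?thesis by (simp add: algebra_simps)
  qed
  then show ?thesis unfolding poly_bounded_def by blast
qed

lemma poly_bounded_cmult: "poly_bounded m f \<Longrightarrow> poly_bounded m (\<lambda>x. c * f x)"
  by (intro poly_bounded_mult poly_bounded_const)

lemma poly_bounded_uminus: "poly_bounded m f \<Longrightarrow> poly_bounded m (\<lambda>x. - f x)"
  using poly_bounded_cmult[of m f "-1"] by simp

lemma poly_bounded_diff:
  "poly_bounded m f \<Longrightarrow> poly_bounded m g \<Longrightarrow> poly_bounded m (\<lambda>x. f x - g x)"
  using poly_bounded_add[OF _ poly_bounded_uminus, of m f g] by simp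

lemma poly_bounded_power: "poly_bounded m f \<Longrightarrow> poly_bounded m (\<lambda>x. f x ^ n)"
  by (induction n) (auto intro: poly_bounded_mult poly_bounded_const)

lemma poly_bounded_sum:
  "(\<And>i. i \<in> A \<Longrightarrow> poly_bounded m (f i)) \<Longrightarrow> poly_bounded m (\<lambda>x. \<Sum>i\<in>A. f i x)"
  by (induction A rule: infinite_finite_induct) (auto intro: poly_bounded_add poly_bounded_const)

lemma poly_bounded_divide: "poly_bounded m f \<Longrightarrow> poly_bounded m (\<lambda>x. f x / c)"
  using poly_bounded_cmult[of m f "1 / c"] by simp

lemma poly_bounded_power_sum: "poly_bounded m (power_sum m n)"
  unfolding power_sum_def[abs_def]
  by (intro poly_bounded_sum poly_bounded_power poly_bounded_component)

lemmas poly_bounded_intros =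
  poly_bounded_const poly_bounded_component poly_bounded_mult poly_bounded_add poly_bounded_diff
  poly_bounded_uminus poly_bounded_power poly_bounded_sum poly_bounded_divide poly_bounded_power_sum

abbreviation lborel_prod :: "nat \<Rightarrow> (nat \<Rightarrow> real) measure" where
  "lborel_prod m \<equiv> PiM {1..m} (\<lambda>_. lborel)"

lemma component_measurable:
  "i \<in> {1..m} \<Longrightarrow> (\<lambda>x. x i) \<in> borel_measurable (lborel_prod m)"
  by simp

lemma power_sum_measurable [measurable]: "power_sum m n \<in> borel_measurable (lborel_prod m)"
  unfolding power_sum_def[abs_def] by measurable

lemma laguerre_density_measurable [measurable]:
  "laguerre_density \<beta> m a1 \<in> borel_measurable (lborel_prod m)"
proof -
  have "(\<lambda>x. \<Prod>j = 1..m. \<Prod>i = 1..<j. \<bar>x i - x j\<bar> powr \<beta>) \<in> borel_measurable (lborel_prod m)"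
    by (intro borel_measurable_prod powr_real_measurable borel_measurable_abs
      borel_measurable_diff component_measurable measurable_const) auto
  note [measurable] = this
  have "Measurable.pred (lborel_prod m) (\<lambda>x. \<forall>i\<in>{1..m}. 0 \<le> x i)"
    by measurable
  note [measurable] = this
  show ?thesis
    unfolding laguerre_density_def[abs_def] by measurable
qed

lemma prod_gamma_weight_measurable:
  "finite J \<Longrightarrow> (\<lambda>x. \<Prod>i\<in>J. ennreal (gamma_weight a (x i))) \<in> borel_measurable (PiM J (\<lambda>_. lborel))"
  by measurable

lemma component_diff_le:
  fixes x :: "nat \<Rightarrow> real"
  assumes "\<And>i. i \<in> {1..m} \<Longrightarrow> 0 \<le> x i" "i \<in> {1..m}" "j \<in> {1..m}"
  shows "\<bar>x i - x j\<bar> \<le> (\<Sum>i = 1..m. x i :: real)"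
proof -
  have "x i \<le> sum x {1..m}" "x j \<le> sum x {1..m}"
    using assms by (auto intro!: member_le_sum finite_atLeastAtMost)
  with assms(1)[OF assms(2)] assms(1)[OF assms(3)] show ?thesis by linarith
qed

text \<open>Rounding the real exponent up expresses all growth by natural powers of one base,
  \<open>1 + S\<close>, which is at least 1.\<close>

lemma powr_component_diff_le:
  fixes x :: "nat \<Rightarrow> real"
  assumes "\<And>i. i \<in> {1..m} \<Longrightarrow> 0 \<le> x i" "i \<in> {1..m}" "j \<in> {1..m}" "b \<ge> 0"
  shows "\<bar>x i - x j\<bar> powr b \<le> (1 + (\<Sum>i = 1..m. x i :: real)) ^ nat \<lceil>b\<rceil>"
proof -
  have S: "0 \<le> (\<Sum>i = 1..m. x i)" using assms by (auto intro: sum_nonneg)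
  have "\<bar>x i - x j\<bar> powr b \<le> (1 + (\<Sum>i = 1..m. x i)) powr b"
    using component_diff_le[of m x i j] assms by (intro powr_mono2) auto
  also have "\<dots> \<le> (1 + (\<Sum>i = 1..m. x i)) powr real (nat \<lceil>b\<rceil>)"
    using S by (intro powr_mono) (auto simp: real_nat_ceiling_ge)
  also have "\<dots> = (1 + (\<Sum>i = 1..m. x i)) ^ nat \<lceil>b\<rceil>"
    using S by (subst powr_realpow) auto
  finally show ?thesis .
qed

text \<open>One fixed triple of parameters. Total mass one is an assumption here; it is discharged
  from a given ensemble, whose law is a probability measure with this density.\<close>

locale laguerre_law =
  fixes \<beta> :: real and m :: nat and a1 :: real
  assumes \<beta>_pos: "\<beta> > 0"
    and m_pos: "m \<ge> 1"
    and a1_gt: "a1 > \<beta> / 2 * (real m - 1)"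
    and prob: "prob_space (density (lborel_prod m) (\<lambda>x. ennreal (laguerre_density \<beta> m a1 x)))"
begin

abbreviation f :: "(nat \<Rightarrow> real) \<Rightarrow> real" where
  "f \<equiv> laguerre_density \<beta> m a1"

definition \<alpha> :: real where "\<alpha> = a1 - laguerre_r \<beta> m"

lemma \<alpha>_gt: "\<alpha> > -1"
  using a1_gt by (simp add: \<alpha>_def laguerre_r_def)

lemma a1_pos: "a1 > 0"
proof -
  have "0 \<le> \<beta> / 2 * (real m - 1)"
    using \<beta>_pos m_pos by (intro mult_nonneg_nonneg) auto
  with a1_gt show ?thesis by linarith
qed

text \<open>The condition on \<open>a1\<close> says exactly that the smallest Gamma argument in the
  denominator product, the one involving a1 at j = 1, is positive.\<close>

lemma laguerre_const_nonneg: "0 \<le> laguerre_const \<beta> m a1"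
proof -
  have "0 < Gamma (1 + \<beta> / 2) / (Gamma (1 + \<beta> * real j / 2) * Gamma (a1 - \<beta> * (real m - real j) / 2))"
    if "j \<in> {1..m}" for j
  proof -
    have "\<beta> * (real m - real j) / 2 \<le> \<beta> / 2 * (real m - 1)"
      using \<beta>_pos that by (simp add: field_simps)
    then have "0 < a1 - \<beta> * (real m - real j) / 2"
      using a1_gt by linarith
    then show ?thesis
      using \<beta>_pos by (intro divide_pos_pos mult_pos_pos Gamma_real_pos add_pos_nonneg) auto
  qed
  then show ?thesis
    unfolding laguerre_const_def by (intro mult_nonneg_nonneg prod_nonneg) (auto intro: less_imp_le)
qed

lemma f_nonneg: "0 \<le> f x"
  unfolding laguerre_density_def using laguerre_const_nonneg
  by (auto intro!: mult_nonneg_nonneg prod_nonneg)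

text \<open>The face x i = 0 is included, by the convention 0 powr a = 0. With
  \<open>f_eq_0'\<close> this leaves pointwise identities to be checked only at positive, pairwise
  distinct coordinates.\<close>

lemma f_eq_0:
  assumes "i \<in> {1..m}" "x i \<le> 0"
  shows "f x = 0"
proof (cases "x i = 0")
  case True
  then have "(\<Prod>i = 1..m. x i powr (a1 - laguerre_r \<beta> m)) = 0"
    using assms by (intro prod_zero) auto
  then show ?thesis by (simp add: laguerre_density_def)
next
  case False
  with assms have "\<not> (\<forall>i\<in>{1..m}. 0 \<le> x i)" by fastforce
  then show ?thesis unfolding laguerre_density_def by (rule if_not_P)
qed

lemma f_eq_0':
  assumes "i \<in> {1..m}" "j \<in> {1..m}" "i \<noteq> j" "x i = x j"
  shows "f x = 0"
proof -
  have *: "f x = 0" if "i \<in> {1..m}" "j \<in> {1..m}" "i < j" "x i = x j" for i j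
  proof -
    have "(\<Prod>i = 1..<j. \<bar>x i - x j\<bar> powr \<beta>) = 0"
      using that by (intro prod_zero) auto
    then have "(\<Prod>j = 1..m. \<Prod>i = 1..<j. \<bar>x i - x j\<bar> powr \<beta>) = 0"
      using that by (intro prod_zero) auto
    then show ?thesis by (simp add: laguerre_density_def)
  qed
  show ?thesis
    using assms *[of i j] *[of j i] by (cases "i < j") auto
qed

text \<open>The factor of the density free of coordinate \<open>k\<close>: along a line in direction
  \<open>k\<close> it is a constant, and powers and an exponential remain.\<close>

definition rest :: "nat \<Rightarrow> (nat \<Rightarrow> real) \<Rightarrow> real" where
  "rest k x =
     (if \<forall>i\<in>{1..m} - {k}. 0 \<le> x i
      then laguerre_const \<beta> m a1 *
           (\<Prod>j\<in>{1..m} - {k}. \<Prod>i\<in>{1..<j} - {k}. \<bar>x i - x j\<bar> powr \<beta>) *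
           (\<Prod>i\<in>{1..m} - {k}. x i powr \<alpha>) * exp (- (1 / 2) * (\<Sum>i\<in>{1..m} - {k}. x i))
      else 0)"

lemma f_upd:
  assumes k: "k \<in> {1..m}"
  shows "f (x(k := u)) =
    (if 0 \<le> u then rest k x * (\<Prod>j\<in>{1..m} - {k}. \<bar>u - x j\<bar> powr \<beta>) * u powr \<alpha> * exp (- u / 2) else 0)"
proof (cases "0 \<le> u \<and> (\<forall>i\<in>{1..m} - {k}. 0 \<le> x i)")
  case True
  define y where "y = x(k := u)"
  have y: "\<forall>i\<in>{1..m}. 0 \<le> y i" using True by (auto simp: y_def)
  have "(\<Prod>j = 1..m. \<Prod>i = 1..<j. \<bar>y i - y j\<bar> powr \<beta>) =
      (\<Prod>j\<in>{1..m} - {k}. \<bar>y k - y j\<bar> powr \<beta>) *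
      (\<Prod>j\<in>{1..m} - {k}. \<Prod>i\<in>{1..<j} - {k}. \<bar>y i - y j\<bar> powr \<beta>)"
    by (rule prod_pairs_extract[OF _ k]) (simp add: abs_minus_commute)
  also have "\<dots> = (\<Prod>j\<in>{1..m} - {k}. \<bar>u - x j\<bar> powr \<beta>) *
      (\<Prod>j\<in>{1..m} - {k}. \<Prod>i\<in>{1..<j} - {k}. \<bar>x i - x j\<bar> powr \<beta>)"
    by (intro arg_cong2[where f = "(*)"] prod.cong) (auto simp: y_def)
  finally have 1: "(\<Prod>j = 1..m. \<Prod>i = 1..<j. \<bar>y i - y j\<bar> powr \<beta>) = \<dots>" .
  have 2: "(\<Prod>i = 1..m. y i powr (a1 - laguerre_r \<beta> m)) = u powr \<alpha> * (\<Prod>i\<in>{1..m} - {k}. x i powr \<alpha>)"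
    using k by (subst prod.remove[of _ k]) (auto simp: y_def \<alpha>_def)
  have 3: "(\<Sum>i = 1..m. y i) = u + (\<Sum>i\<in>{1..m} - {k}. x i)"
    using k by (subst sum.remove[of _ k]) (auto simp: y_def)
  have 4: "exp (- (1 / 2) * (\<Sum>i = 1..m. y i)) = exp (- u / 2) * exp (- (1 / 2) * (\<Sum>i\<in>{1..m} - {k}. x i))"
    unfolding 3 by (simp flip: exp_add add: field_simps)
  have "f y = rest k x * (\<Prod>j\<in>{1..m} - {k}. \<bar>u - x j\<bar> powr \<beta>) * u powr \<alpha> * exp (- u / 2)"
    unfolding laguerre_density_def rest_def if_P[OF y] if_P[OF conjunct2[OF True]] 1 2 4
    by (simp only: ac_simps)
  then show ?thesis using True by (simp add: y_def)
next
  case False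
  then consider "\<not> 0 \<le> u" | "\<not> (\<forall>i\<in>{1..m} - {k}. 0 \<le> x i)" by blast
  then show ?thesis
  proof cases
    case 1
    then show ?thesis using f_eq_0[of k "x(k := u)"] k by simp
  next
    case *: 2
    from * obtain i where "i \<in> {1..m} - {k}" "x i < 0" by fastforce
    moreover have "rest k x = 0" unfolding rest_def using * by (rule if_not_P)
    ultimately show ?thesis using f_eq_0[of i "x(k := u)"] by simp
  qed
qed

lemma rest_nonneg: "0 \<le> rest k x"
  unfolding rest_def using laguerre_const_nonneg
  by (auto intro!: mult_nonneg_nonneg prod_nonneg)

lemma prod_gamma_weight:
  assumes "finite A" "\<And>i. i \<in> A \<Longrightarrow> 0 \<le> x i"
  shows "(\<Prod>i\<in>A. x i powr a) * exp (- (1 / 4) * (\<Sum>i\<in>A. x i)) = (\<Prod>i\<in>A. gamma_weight a (x i))"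
proof -
  have "gamma_weight a (x i) = x i powr a * exp (- (1/4) * x i)" if "i \<in> A" for i
    using assms(2)[OF that] by (cases "x i = 0") (auto simp: gamma_weight_def)
  then have "(\<Prod>i\<in>A. gamma_weight a (x i)) = (\<Prod>i\<in>A. x i powr a * exp (- (1/4) * x i))"
    by (intro prod.cong) auto
  then show ?thesis
    by (simp only: prod.distrib exp_sum[OF assms(1)] sum_distrib_left)
qed

lemma rest_le:
  assumes x: "\<And>i. i \<in> {1..m} \<Longrightarrow> 0 \<le> x i"
  shows "rest k x \<le> laguerre_const \<beta> m a1 * (1 + (\<Sum>i = 1..m. x i)) ^ (nat \<lceil>\<beta>\<rceil> * m * m) *
     ((\<Prod>i\<in>{1..m} - {k}. x i powr \<alpha>) * exp (- (1 / 2) * (\<Sum>i\<in>{1..m} - {k}. x i)))"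
proof -
  define D where "D = (1 + (\<Sum>i = 1..m. x i))"
  have D: "1 \<le> D" using x by (auto simp: D_def intro: sum_nonneg)
  have "(\<Prod>j\<in>{1..m} - {k}. \<Prod>i\<in>{1..<j} - {k}. \<bar>x i - x j\<bar> powr \<beta>) \<le> ((D ^ nat \<lceil>\<beta>\<rceil>) ^ m) ^ m"
  proof (intro prod_le_power)
    fix j i assume "j \<in> {1..m} - {k}" "i \<in> {1..<j} - {k}"
    then show "\<bar>x i - x j\<bar> powr \<beta> \<le> D ^ nat \<lceil>\<beta>\<rceil>"
      unfolding D_def using x \<beta>_pos by (intro powr_component_diff_le) auto
  next
    fix j assume "j \<in> {1..m} - {k}"
    then have "card ({1..<j} - {k}) \<le> card {1..m}"
      by (intro card_mono) auto
    then show "card ({1..<j} - {k}) \<le> m" by simp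
  next
    have "card ({1..m} - {k}) \<le> card {1..m}"
      by (intro card_mono) auto
    then show "card ({1..m} - {k}) \<le> m" by simp
  qed (use D in \<open>auto intro!: prod_nonneg one_le_power\<close>)
  also have "\<dots> = D ^ (nat \<lceil>\<beta>\<rceil> * m * m)"
    by (simp add: power_mult)
  finally have "laguerre_const \<beta> m a1 *
      (\<Prod>j\<in>{1..m} - {k}. \<Prod>i\<in>{1..<j} - {k}. \<bar>x i - x j\<bar> powr \<beta>) *
      ((\<Prod>i\<in>{1..m} - {k}. x i powr \<alpha>) * exp (- (1 / 2) * (\<Sum>i\<in>{1..m} - {k}. x i)))
    \<le> laguerre_const \<beta> m a1 * D ^ (nat \<lceil>\<beta>\<rceil> * m * m) *
     ((\<Prod>i\<in>{1..m} - {k}. x i powr \<alpha>) * exp (- (1 / 2) * (\<Sum>i\<in>{1..m} - {k}. x i)))"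
    using laguerre_const_nonneg
    by (intro mult_right_mono mult_left_mono mult_nonneg_nonneg prod_nonneg) auto
  then show ?thesis
    using x by (simp add: rest_def D_def mult.assoc)
qed

text \<open>The pair factors are bounded by powers of \<open>1 + S\<close>, and a quarter of S in
  the exponent pays for them and for the given weight. Coordinate 1 is split off so that the bound
  on \<open>rest\<close> can be reused.\<close>

lemma f_poly_le:
  "\<exists>C\<ge>0. \<forall>x. f x * (1 + (\<Sum>i = 1..m. x i)) ^ N \<le> C * (\<Prod>i = 1..m. gamma_weight \<alpha> (x i))"
proof -
  \<comment> \<open>Degree count: at most m * m pair factors inside \<open>rest\<close>, at most m
    containing coordinate 1, and the weight of degree N.\<close>
  define M where "M = nat \<lceil>\<beta>\<rceil> * m * m + nat \<lceil>\<beta>\<rceil> * m + N"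
  obtain C where C: "C > 0" "\<And>S::real. S \<ge> 0 \<Longrightarrow> (1 + S) ^ M \<le> C * exp (S / 4)"
    using power_le_exp_quarter[of M] by auto
  have "f x * (1 + (\<Sum>i = 1..m. x i)) ^ N \<le> laguerre_const \<beta> m a1 * C * (\<Prod>i = 1..m. gamma_weight \<alpha> (x i))"
    if x: "\<And>i. i \<in> {1..m} \<Longrightarrow> 0 \<le> x i" for x
  proof -
    define S where "S = (\<Sum>i = 1..m. x i)"
    have S: "0 \<le> S" using x by (auto simp: S_def intro: sum_nonneg)
    have one: "1 \<in> {1..m}" using m_pos by simp
    define P where "P = (\<Prod>j\<in>{1..m} - {1}. \<bar>x 1 - x j\<bar> powr \<beta>)"
    have P0: "0 \<le> P" by (auto simp: P_def intro: prod_nonneg)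
    have "P \<le> ((1 + S) ^ nat \<lceil>\<beta>\<rceil>) ^ m"
      unfolding P_def S_def using x one S \<beta>_pos
      by (intro prod_le_power powr_component_diff_le one_le_power) (auto simp: S_def)
    then have P: "P \<le> (1 + S) ^ (nat \<lceil>\<beta>\<rceil> * m)" by (simp add: power_mult)
    have eqs: "(\<Prod>i\<in>{1..m} - {1}. x i powr \<alpha>) * x 1 powr \<alpha> = (\<Prod>i = 1..m. x i powr \<alpha>)"
      "exp (- (1 / 2) * (\<Sum>i\<in>{1..m} - {1}. x i)) * exp (- x 1 / 2) = exp (- (1/2) * S)"
      using one by (auto simp: prod.remove[of _ 1] S_def sum.remove[of _ 1] field_simps simp flip: exp_add)
    have "f x = rest 1 x * P * x 1 powr \<alpha> * exp (- x 1 / 2)"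
      using f_upd[OF one, of x "x 1"] x[OF one] by (simp add: P_def)
    also have "\<dots> \<le> (laguerre_const \<beta> m a1 * (1 + S) ^ (nat \<lceil>\<beta>\<rceil> * m * m) *
        ((\<Prod>i\<in>{1..m} - {1}. x i powr \<alpha>) * exp (- (1 / 2) * (\<Sum>i\<in>{1..m} - {1}. x i))))
        * (1 + S) ^ (nat \<lceil>\<beta>\<rceil> * m) * x 1 powr \<alpha> * exp (- x 1 / 2)"
      using P P0 rest_nonneg S laguerre_const_nonneg rest_le[of x 1] x unfolding S_def
      by (intro mult_right_mono mult_mono mult_nonneg_nonneg prod_nonneg) auto
    also have "\<dots> = laguerre_const \<beta> m a1 * (1 + S) ^ (nat \<lceil>\<beta>\<rceil> * m * m + nat \<lceil>\<beta>\<rceil> * m) *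
        (((\<Prod>i\<in>{1..m} - {1}. x i powr \<alpha>) * x 1 powr \<alpha>) *
         (exp (- (1 / 2) * (\<Sum>i\<in>{1..m} - {1}. x i)) * exp (- x 1 / 2)))"
      by (simp only: power_add ac_simps)
    also have "\<dots> = laguerre_const \<beta> m a1 * (1 + S) ^ (nat \<lceil>\<beta>\<rceil> * m * m + nat \<lceil>\<beta>\<rceil> * m) *
        ((\<Prod>i = 1..m. x i powr \<alpha>) * exp (- (1/2) * S))"
      by (simp only: eqs)
    finally have "f x * (1 + S) ^ N \<le> \<dots> * (1 + S) ^ N"
      using S by (intro mult_right_mono) auto
    also have "\<dots> = laguerre_const \<beta> m a1 * (1 + S) ^ M * ((\<Prod>i = 1..m. x i powr \<alpha>) * exp (- (1/2) * S))"
      by (simp add: M_def power_add)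
    also have "\<dots> \<le> laguerre_const \<beta> m a1 * (C * exp (S / 4)) * ((\<Prod>i = 1..m. x i powr \<alpha>) * exp (- (1/2) * S))"
      using C(2)[OF S] laguerre_const_nonneg by (intro mult_right_mono mult_left_mono mult_nonneg_nonneg prod_nonneg) auto
    also have "\<dots> = laguerre_const \<beta> m a1 * C * ((\<Prod>i = 1..m. x i powr \<alpha>) * (exp (S / 4) * exp (- (1/2) * S)))"
      by (simp only: ac_simps)
    also have "exp (S / 4) * exp (- (1/2) * S) = exp (- (1 / 4) * S)"
      by (simp flip: exp_add)
    also have "(\<Prod>i = 1..m. x i powr \<alpha>) * \<dots> = (\<Prod>i = 1..m. gamma_weight \<alpha> (x i))"
      unfolding S_def using x by (intro prod_gamma_weight) auto
    finally show ?thesis by (simp add: S_def)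
  qed
  moreover have "f x * (1 + (\<Sum>i = 1..m. x i)) ^ N \<le> laguerre_const \<beta> m a1 * C * (\<Prod>i = 1..m. gamma_weight \<alpha> (x i))"
    if "\<not> (\<forall>i \<in> {1..m}. 0 \<le> x i)" for x
  proof -
    have "f x = 0" using that f_eq_0[of _ x] by fastforce
    then show ?thesis
      using laguerre_const_nonneg C(1) by (auto intro!: mult_nonneg_nonneg prod_nonneg gamma_weight_nonneg)
  qed
  moreover have "0 \<le> laguerre_const \<beta> m a1 * C" using laguerre_const_nonneg C(1) by simp
  ultimately show ?thesis by blast
qed

text \<open>The pair factor and the quotient combine to |x_k - x_j|^(\<beta> - 1), while the
  numerator raises the exponent at the origin to \<alpha> + 1 > 0. The weight in \<open>x k\<close>
  is therefore bounded, and near the diagonal a constant may replace it. The two singularities no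
  longer multiply each other, only add.\<close>

lemma f_singular_le:
  assumes kj: "k \<in> {1..m}" "j \<in> {1..m}" "j \<noteq> k"
  shows "\<exists>C\<ge>0. \<forall>x. f x * \<bar>x k / (x k - x j)\<bar> * (1 + (\<Sum>i = 1..m. x i)) ^ N \<le>
    C * ((gamma_weight (\<alpha> + 1) (x k) + near_diag \<beta> (x k - x j)) * (\<Prod>i\<in>{1..m} - {k}. gamma_weight \<alpha> (x i)))"
proof -
  define M where "M = nat \<lceil>\<beta>\<rceil> * m * m + nat \<lceil>\<beta>\<rceil> * m + nat \<lceil>\<beta>\<rceil> + N"
  obtain C where C: "C > 0" "\<And>S::real. S \<ge> 0 \<Longrightarrow> (1 + S) ^ M \<le> C * exp (S / 4)"
    using power_le_exp_quarter[of M] by auto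
  obtain C1 where C1: "C1 > 0" "\<And>u. gamma_weight (\<alpha> + 1) u \<le> C1"
    using gamma_weight_bounded[of "\<alpha> + 1"] \<alpha>_gt by auto
  define L where "L = laguerre_const \<beta> m a1"
  have L: "0 \<le> L" using laguerre_const_nonneg by (simp add: L_def)
  define G where "G x = (gamma_weight (\<alpha> + 1) (x k) + near_diag \<beta> (x k - x j)) *
    (\<Prod>i\<in>{1..m} - {k}. gamma_weight \<alpha> (x i))" for x :: "nat \<Rightarrow> real"
  have G: "0 \<le> G x" for x
    by (auto simp: G_def intro!: mult_nonneg_nonneg add_nonneg_nonneg prod_nonneg gamma_weight_nonneg near_diag_nonneg)
  have "f x * \<bar>x k / (x k - x j)\<bar> * (1 + (\<Sum>i = 1..m. x i)) ^ N \<le> L * C * (1 + C1) * G x"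
    if x: "\<And>i. i \<in> {1..m} \<Longrightarrow> 0 \<le> x i" and xk: "x k > 0" and xkj: "x k \<noteq> x j" for x
  proof -
    define S where "S = (\<Sum>i = 1..m. x i)"
    have S: "0 \<le> S" using x by (auto simp: S_def intro: sum_nonneg)
    define d where "d = x k - x j"
    have d: "\<bar>d\<bar> > 0" using xkj by (simp add: d_def)
    define P where "P = (\<Prod>l\<in>{1..m} - {k} - {j}. \<bar>x k - x l\<bar> powr \<beta>)"
    define Q where "Q = (\<Prod>i\<in>{1..m} - {k}. x i powr \<alpha>)"
    define T where "T = (\<Sum>i\<in>{1..m} - {k}. x i)"
    define R where "R = x k powr (\<alpha> + 1) * exp (- x k / 2)"
    have ST: "S = x k + T" unfolding S_def T_def using kj by (subst sum.remove[of _ k]) auto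
    have nonneg: "0 \<le> P" "0 \<le> Q" "0 \<le> R"
      by (auto simp: P_def Q_def R_def intro: prod_nonneg)
    have "card ({1..m} - {k} - {j}) \<le> card {1..m}"
      by (intro card_mono) auto
    then have "P \<le> ((1 + S) ^ nat \<lceil>\<beta>\<rceil>) ^ m"
      unfolding P_def S_def using x kj S \<beta>_pos
      by (intro prod_le_power powr_component_diff_le one_le_power) (auto simp: S_def)
    then have P: "P \<le> (1 + S) ^ (nat \<lceil>\<beta>\<rceil> * m)" by (simp add: power_mult)
    have "\<bar>d\<bar> powr (\<beta> - 1) \<le> \<bar>d\<bar> powr \<beta> + near_diag \<beta> d"
      by (rule abs_powr_minus_one_le)
    also have "\<dots> \<le> (1 + S) ^ nat \<lceil>\<beta>\<rceil> + near_diag \<beta> d"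
      unfolding d_def S_def using x kj \<beta>_pos by (intro add_right_mono powr_component_diff_le) auto
    also have "\<dots> \<le> (1 + S) ^ nat \<lceil>\<beta>\<rceil> * (1 + near_diag \<beta> d)"
      using mult_right_mono[of 1 "(1 + S) ^ nat \<lceil>\<beta>\<rceil>" "near_diag \<beta> d"] S near_diag_nonneg[of \<beta> d]
      by (simp add: algebra_simps one_le_power)
    finally have d_le: "\<bar>d\<bar> powr (\<beta> - 1) \<le> (1 + S) ^ nat \<lceil>\<beta>\<rceil> * (1 + near_diag \<beta> d)" .
    have "f x = rest k x * (\<bar>d\<bar> powr \<beta> * P) * x k powr \<alpha> * exp (- x k / 2)"
    proof -
      have "(\<Prod>l\<in>{1..m} - {k}. \<bar>x k - x l\<bar> powr \<beta>) = \<bar>d\<bar> powr \<beta> * P"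
        using kj unfolding P_def d_def by (subst prod.remove[of _ j]) auto
      then show ?thesis
        using f_upd[OF kj(1), of x "x k"] xk by simp
    qed
    then have "f x * \<bar>x k / (x k - x j)\<bar> =
        rest k x * P * (\<bar>d\<bar> powr \<beta> / \<bar>d\<bar>) * ((x k powr \<alpha> * x k) * exp (- x k / 2))"
      using xk by (simp add: d_def)
    also have "\<dots> = rest k x * P * \<bar>d\<bar> powr (\<beta> - 1) * R"
      using xk d by (simp add: R_def powr_diff powr_add)
    also have "\<dots> \<le> (L * (1 + S) ^ (nat \<lceil>\<beta>\<rceil> * m * m) * (Q * exp (- (1/2) * T))) * (1 + S) ^ (nat \<lceil>\<beta>\<rceil> * m)
        * ((1 + S) ^ nat \<lceil>\<beta>\<rceil> * (1 + near_diag \<beta> d)) * R"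
      using rest_le[of x k] x nonneg P d_le rest_nonneg S L unfolding L_def Q_def T_def S_def
      by (intro mult_right_mono mult_mono mult_nonneg_nonneg) auto
    finally have "f x * \<bar>x k / (x k - x j)\<bar> * (1 + S) ^ N \<le> \<dots> * (1 + S) ^ N"
      using S by (intro mult_right_mono) auto
    also have "\<dots> = (1 + S) ^ M * (L * (Q * exp (- (1/2) * T)) * (1 + near_diag \<beta> d) * R)"
      by (simp add: M_def power_add)
    also have "\<dots> \<le> (C * exp (S / 4)) * (L * (Q * exp (- (1/2) * T)) * (1 + near_diag \<beta> d) * R)"
      using C(2)[OF S] L nonneg near_diag_nonneg[of \<beta> d]
      by (intro mult_right_mono mult_nonneg_nonneg) auto
    also have "\<dots> = L * C * (Q * (exp (T / 4) * exp (- (1/2) * T))) * (1 + near_diag \<beta> d) *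
        (x k powr (\<alpha> + 1) * (exp (x k / 4) * exp (- x k / 2)))"
      unfolding ST R_def add_divide_distrib exp_add by (simp only: ac_simps)
    also have "exp (T / 4) * exp (- (1/2) * T) = exp (- (1/4) * T)"
      by (simp flip: exp_add)
    also have "exp (x k / 4) * exp (- x k / 2) = exp (- x k / 4)"
      by (simp flip: exp_add)
    also have "Q * exp (- (1/4) * T) = (\<Prod>i\<in>{1..m} - {k}. gamma_weight \<alpha> (x i))"
      unfolding Q_def T_def using x by (intro prod_gamma_weight) auto
    also have "x k powr (\<alpha> + 1) * exp (- x k / 4) = gamma_weight (\<alpha> + 1) (x k)"
      using xk by (simp add: gamma_weight_def)
    also have "L * C * (\<Prod>i\<in>{1..m} - {k}. gamma_weight \<alpha> (x i)) * (1 + near_diag \<beta> d) * gamma_weight (\<alpha> + 1) (x k)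
        = L * C * (\<Prod>i\<in>{1..m} - {k}. gamma_weight \<alpha> (x i)) *
          (gamma_weight (\<alpha> + 1) (x k) + near_diag \<beta> d * gamma_weight (\<alpha> + 1) (x k))"
      by (simp add: algebra_simps)
    also have "\<dots> \<le> L * C * (\<Prod>i\<in>{1..m} - {k}. gamma_weight \<alpha> (x i)) *
          ((1 + C1) * gamma_weight (\<alpha> + 1) (x k) + near_diag \<beta> d * (1 + C1))"
      using L C C1(1) C1(2)[of "x k"] mult_nonneg_nonneg[of C1 "gamma_weight (\<alpha> + 1) (x k)"]
      by (intro mult_left_mono add_mono mult_nonneg_nonneg prod_nonneg gamma_weight_nonneg near_diag_nonneg)
         (auto simp: algebra_simps gamma_weight_nonneg intro: add_increasing)
    also have "\<dots> = L * C * (1 + C1) * G x"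
      by (simp add: G_def d_def algebra_simps)
    finally show ?thesis by (simp add: S_def)
  qed
  moreover have "f x * \<bar>x k / (x k - x j)\<bar> * (1 + (\<Sum>i = 1..m. x i)) ^ N \<le> L * C * (1 + C1) * G x"
    if "\<not> ((\<forall>i \<in> {1..m}. 0 \<le> x i) \<and> x k > 0 \<and> x k \<noteq> x j)" for x
  proof -
    have "f x = 0"
      using that f_eq_0[of _ x] f_eq_0'[of k j x] kj by fastforce
    then show ?thesis using L C(1) C1(1) G[of x] by simp
  qed
  moreover have "0 \<le> L * C * (1 + C1)" using L C(1) C1(1) by simp
  ultimately show ?thesis unfolding G_def by blast
qed

lemma integrable_f_mult:
  assumes [measurable]: "g \<in> borel_measurable (lborel_prod m)" and "poly_bounded m g"
  shows "integrable (lborel_prod m) (\<lambda>x. f x * g x)"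
proof -
  interpret product_sigma_finite "\<lambda>_::nat. lborel" by standard
  obtain C N where C: "C \<ge> 0"
    "\<And>x. (\<And>i. i \<in> {1..m} \<Longrightarrow> 0 \<le> x i) \<Longrightarrow> \<bar>g x\<bar> \<le> C * (1 + (\<Sum>i = 1..m. x i)) ^ N"
    using poly_boundedE[OF assms(2)] by blast
  obtain D where D: "D \<ge> 0"
    "\<And>x. f x * (1 + (\<Sum>i = 1..m. x i)) ^ N \<le> D * (\<Prod>i = 1..m. gamma_weight \<alpha> (x i))"
    using f_poly_le[of N] by auto
  have "integrable (lborel_prod m) (\<lambda>x. C * D * (\<Prod>i = 1..m. gamma_weight \<alpha> (x i)))"
    using \<alpha>_gt by (intro integrable_mult_right product_integrable_prod integrable_gamma_weight) auto
  then show ?thesis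
  proof (rule Bochner_Integration.integrable_bound)
    have "norm (f x * g x) \<le> norm (C * D * (\<Prod>i = 1..m. gamma_weight \<alpha> (x i)))" for x
    proof (cases "\<forall>i\<in>{1..m}. 0 \<le> x i")
      case True
      have "\<bar>f x * g x\<bar> \<le> f x * (C * (1 + (\<Sum>i = 1..m. x i)) ^ N)"
        unfolding abs_mult using C(2)[of x] True f_nonneg[of x] by (auto intro!: mult_left_mono)
      also have "\<dots> \<le> C * (D * (\<Prod>i = 1..m. gamma_weight \<alpha> (x i)))"
        using mult_left_mono[OF D(2)[of x] C(1)] by (simp add: mult_ac)
      finally show ?thesis by simp
    next
      case False
      then have "f x = 0" using f_eq_0[of _ x] by fastforce
      then show ?thesis by simp
    qed
    then show "AE x in lborel_prod m. norm (f x * g x) \<le> norm (C * D * (\<Prod>i = 1..m. gamma_weight \<alpha> (x i)))"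
      by simp
  qed measurable
qed

text \<open>Tonelli with coordinate \<open>k\<close> innermost: by translation invariance the
  integral of \<open>near_diag\<close> over \<open>x k\<close> is the same for every
  \<open>x j\<close>, so the inner integral is a constant times the product over the other
  coordinates.\<close>

lemma integrable_singular_majorant:
  assumes kj: "k \<in> {1..m}" "j \<in> {1..m}" "j \<noteq> k"
  shows "integrable (lborel_prod m) (\<lambda>x. (gamma_weight (\<alpha> + 1) (x k) + near_diag \<beta> (x k - x j)) *
     (\<Prod>i\<in>{1..m} - {k}. gamma_weight \<alpha> (x i)))" (is "integrable _ ?G")
proof -
  interpret product_sigma_finite "\<lambda>_::nat. lborel" by standard
  have I: "insert k ({1..m} - {k}) = {1..m}" using kj by auto
  have k_I[measurable]: "(\<lambda>x. x k) \<in> borel_measurable (lborel_prod m)"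
    "(\<lambda>x. x j) \<in> borel_measurable (lborel_prod m)" using kj by auto
  have [measurable]: "(\<lambda>x. \<Prod>i\<in>{1..m} - {k}. gamma_weight \<alpha> (x i)) \<in> borel_measurable (lborel_prod m)"
    by (intro borel_measurable_prod measurable_compose[OF component_measurable gamma_weight_measurable]) auto
  have meas: "?G \<in> borel_measurable (lborel_prod m)" by measurable
  define c where "c = (\<integral>\<^sup>+u. gamma_weight (\<alpha> + 1) u \<partial>lborel) + (\<integral>\<^sup>+u. near_diag \<beta> u \<partial>lborel)"
  have c: "c < \<infinity>"
    unfolding c_def using integrableD(2)[OF integrable_gamma_weight[of "\<alpha> + 1"]]
      integrableD(2)[OF integrable_near_diag[OF \<beta>_pos]] \<alpha>_gt
    by (auto simp: gamma_weight_nonneg near_diag_nonneg less_top)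
  have inner: "(\<integral>\<^sup>+u. ennreal (?G (x(k := u))) \<partial>lborel) = c * (\<Prod>i\<in>{1..m} - {k}. ennreal (gamma_weight \<alpha> (x i)))"
    for x :: "nat \<Rightarrow> real"
  proof -
    have "(\<integral>\<^sup>+u. ennreal (?G (x(k := u))) \<partial>lborel) =
        (\<integral>\<^sup>+u. (ennreal (gamma_weight (\<alpha> + 1) u) + ennreal (near_diag \<beta> (u - x j))) *
           (\<Prod>i\<in>{1..m} - {k}. ennreal (gamma_weight \<alpha> (x i))) \<partial>lborel)"
      using kj by (intro nn_integral_cong)
        (auto simp: ennreal_mult' ennreal_plus prod_ennreal gamma_weight_nonneg near_diag_nonneg prod_nonneg
          simp del: fun_upd_apply simp add: fun_upd_def intro!: arg_cong2[where f = "(*)"] prod.cong)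
    also have "\<dots> = ((\<integral>\<^sup>+u. gamma_weight (\<alpha> + 1) u \<partial>lborel) + (\<integral>\<^sup>+u. near_diag \<beta> (u - x j) \<partial>lborel)) *
        (\<Prod>i\<in>{1..m} - {k}. ennreal (gamma_weight \<alpha> (x i)))"
      by (simp add: nn_integral_multc nn_integral_add)
    also have "(\<integral>\<^sup>+u. near_diag \<beta> (u - x j) \<partial>lborel) = (\<integral>\<^sup>+u. near_diag \<beta> u \<partial>lborel)"
      using nn_integral_real_affine[of "\<lambda>u. ennreal (near_diag \<beta> u)" 1 "- x j"] by simp
    finally show ?thesis by (simp add: c_def)
  qed
  have "(\<integral>\<^sup>+x. ennreal (?G x) \<partial>lborel_prod m) = (\<integral>\<^sup>+x. ennreal (?G x) \<partial>PiM (insert k ({1..m} - {k})) (\<lambda>_. lborel))"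
    by (simp only: I)
  also have "\<dots> = (\<integral>\<^sup>+x. (\<integral>\<^sup>+u. ennreal (?G (x(k := u))) \<partial>lborel) \<partial>PiM ({1..m} - {k}) (\<lambda>_. lborel))"
    by (rule product_nn_integral_insert) (use meas in \<open>auto simp only: I finite_Diff finite_atLeastAtMost intro: measurable_compose[OF meas measurable_ennreal]\<close>)
  also have "\<dots> = (\<integral>\<^sup>+x. c * (\<Prod>i\<in>{1..m} - {k}. ennreal (gamma_weight \<alpha> (x i))) \<partial>PiM ({1..m} - {k}) (\<lambda>_. lborel))"
    by (simp only: inner)
  also have "\<dots> = c * (\<integral>\<^sup>+x. (\<Prod>i\<in>{1..m} - {k}. ennreal (gamma_weight \<alpha> (x i))) \<partial>PiM ({1..m} - {k}) (\<lambda>_. lborel))"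
    by (intro nn_integral_cmult prod_gamma_weight_measurable) simp
  also have "(\<integral>\<^sup>+x. (\<Prod>i\<in>{1..m} - {k}. ennreal (gamma_weight \<alpha> (x i))) \<partial>PiM ({1..m} - {k}) (\<lambda>_. lborel)) =
      (\<Prod>i\<in>{1..m} - {k}. (\<integral>\<^sup>+u. ennreal (gamma_weight \<alpha> u) \<partial>lborel))"
    by (intro product_nn_integral_prod) auto
  also have "c * \<dots> < \<infinity>"
    using c integrableD(2)[OF integrable_gamma_weight[OF \<alpha>_gt]]
    by (auto simp: ennreal_mult_less_top gamma_weight_nonneg power_less_top_ennreal less_top)
  finally have "(\<integral>\<^sup>+x. ennreal (?G x) \<partial>lborel_prod m) < \<infinity>" .
  moreover have "0 \<le> ?G x" for x
    by (auto intro!: mult_nonneg_nonneg add_nonneg_nonneg prod_nonneg gamma_weight_nonneg near_diag_nonneg)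
  ultimately show ?thesis
    by (intro integrableI_nonneg meas) auto
qed

lemma integrable_f_singular:
  assumes kj: "k \<in> {1..m}" "j \<in> {1..m}" "j \<noteq> k"
    and [measurable]: "g \<in> borel_measurable (lborel_prod m)" and "poly_bounded m g"
  shows "integrable (lborel_prod m) (\<lambda>x. f x * (x k / (x k - x j) * g x))"
proof -
  have [measurable]: "(\<lambda>x. x k) \<in> borel_measurable (lborel_prod m)"
    "(\<lambda>x. x j) \<in> borel_measurable (lborel_prod m)" using kj by auto
  obtain C N where C: "C \<ge> 0"
    "\<And>x. (\<And>i. i \<in> {1..m} \<Longrightarrow> 0 \<le> x i) \<Longrightarrow> \<bar>g x\<bar> \<le> C * (1 + (\<Sum>i = 1..m. x i)) ^ N"
    using poly_boundedE[OF assms(5)] by blast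
  define G where "G x = (gamma_weight (\<alpha> + 1) (x k) + near_diag \<beta> (x k - x j)) *
     (\<Prod>i\<in>{1..m} - {k}. gamma_weight \<alpha> (x i))" for x :: "nat \<Rightarrow> real"
  obtain D where D: "D \<ge> 0"
    "\<And>x. f x * \<bar>x k / (x k - x j)\<bar> * (1 + (\<Sum>i = 1..m. x i)) ^ N \<le> D * G x"
    using f_singular_le[OF kj, of N] unfolding G_def by blast
  have "integrable (lborel_prod m) (\<lambda>x. C * D * G x)"
    unfolding G_def by (intro integrable_mult_right integrable_singular_majorant kj)
  then show ?thesis
  proof (rule Bochner_Integration.integrable_bound)
    have "norm (f x * (x k / (x k - x j) * g x)) \<le> norm (C * D * G x)" for x
    proof (cases "\<forall>i\<in>{1..m}. 0 \<le> x i")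
      case True
      have "\<bar>f x * (x k / (x k - x j) * g x)\<bar> = f x * \<bar>x k / (x k - x j)\<bar> * \<bar>g x\<bar>"
        using f_nonneg[of x] by (simp add: abs_mult)
      also have "\<dots> \<le> f x * \<bar>x k / (x k - x j)\<bar> * (C * (1 + (\<Sum>i = 1..m. x i)) ^ N)"
        using C(2)[of x] True f_nonneg[of x] by (intro mult_left_mono) auto
      also have "\<dots> \<le> C * (D * G x)"
        using mult_left_mono[OF D(2)[of x] C(1)] by (simp only: mult_ac)
      finally show ?thesis by simp
    next
      case False
      then have "f x = 0" using f_eq_0[of _ x] by fastforce
      then show ?thesis by simp
    qed
    then show "AE x in lborel_prod m. norm (f x * (x k / (x k - x j) * g x)) \<le> norm (C * D * G x)"
      by simp
  qed measurable
qed

end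

section \<open>Integration by parts and the loop equations\<close>

lemma gamma_weight_tendsto_0: "(gamma_weight a \<longlongrightarrow> 0) at_top"
proof -
  have "((\<lambda>u::real. u powr a * exp (- u / 4)) \<longlongrightarrow> 0) at_top"
    by real_asymp
  then show ?thesis
    by (rule Lim_transform_eventually)
      (auto intro!: eventually_at_top_linorderI[of 1] simp: gamma_weight_def)
qed

text \<open>Logarithmic differentiation; with the signed quotient b / (u - c) one formula is valid
  on both sides of c.\<close>

lemma has_derivative_prod_abs_powr:
  assumes "finite A" "\<And>j. j \<in> A \<Longrightarrow> u \<noteq> c j"
  shows "((\<lambda>u::real. \<Prod>j\<in>A. \<bar>u - c j\<bar> powr b) has_real_derivative
    (\<Prod>j\<in>A. \<bar>u - c j\<bar> powr b) * (\<Sum>j\<in>A. b / (u - c j))) (at u)"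
  using assms
proof (induction A rule: finite_induct)
  case (insert i A)
  have one: "((\<lambda>u. \<bar>u - c i\<bar> powr b) has_real_derivative \<bar>u - c i\<bar> powr b * (b / (u - c i))) (at u)"
  proof (cases "u > c i")
    case True
    have "((\<lambda>u. (u - c i) powr b) has_real_derivative b * (u - c i) powr (b - 1) * 1) (at u)"
      using True by (auto intro!: derivative_eq_intros has_real_derivative_powr[THEN DERIV_chain2])
    then have "((\<lambda>u. \<bar>u - c i\<bar> powr b) has_real_derivative b * (u - c i) powr (b - 1) * 1) (at u)"
      by (rule has_field_derivative_transform_within_open[where S = "{c i<..}"]) (use True in auto)
    then show ?thesis using True by (simp add: powr_diff mult.commute)
  next
    case False
    then have lt: "u < c i" using insert.prems[of i] by auto
    have "((\<lambda>u. (c i - u) powr b) has_real_derivative b * (c i - u) powr (b - 1) * (-1)) (at u)"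
      using lt by (auto intro!: derivative_eq_intros has_real_derivative_powr[THEN DERIV_chain2])
    then have "((\<lambda>u. \<bar>u - c i\<bar> powr b) has_real_derivative b * (c i - u) powr (b - 1) * (-1)) (at u)"
      by (rule has_field_derivative_transform_within_open[where S = "{..<c i}"]) (use lt in auto)
    moreover have "b * (c i - u) powr (b - 1) * (-1) = \<bar>u - c i\<bar> powr b * (b / (u - c i))"
      using lt by (simp add: powr_diff field_simps)
    ultimately show ?thesis by simp
  qed
  show ?case
    using DERIV_mult[OF one insert.IH] insert by (simp add: algebra_simps)
qed simp

context laguerre_law
begin

text \<open>At positive, distinct coordinates and with \<Phi>' the k-th partial derivative of
  \<Phi>, \<open>f x * ibp_term n k \<Phi> \<Phi>' x\<close> is the k-th partial derivative of f *
  x_k^(n+1) * \<Phi>.\<close>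

definition ibp_term :: "nat \<Rightarrow> nat \<Rightarrow> ((nat \<Rightarrow> real) \<Rightarrow> real) \<Rightarrow> ((nat \<Rightarrow> real) \<Rightarrow> real) \<Rightarrow> (nat \<Rightarrow> real) \<Rightarrow> real" where
  "ibp_term n k \<Phi> \<Phi>' x =
     (\<alpha> + 1 + real n) * x k ^ n * \<Phi> x - x k ^ Suc n * \<Phi> x / 2
     + \<beta> * (\<Sum>j\<in>{1..m} - {k}. x k ^ Suc n / (x k - x j)) * \<Phi> x + x k ^ Suc n * \<Phi>' x"

text \<open>In each quotient one factor \<open>x k / (x k - x j)\<close> goes with the density to
  the singular bound; what is left, including x_k^n, is polynomially bounded.\<close>

lemma integrable_ibp_term:
  assumes k: "k \<in> {1..m}"
    and [measurable]: "\<Phi> \<in> borel_measurable (lborel_prod m)" "\<Phi>' \<in> borel_measurable (lborel_prod m)"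
    and pb: "poly_bounded m \<Phi>" "poly_bounded m \<Phi>'"
  shows "integrable (lborel_prod m) (\<lambda>x. f x * ibp_term n k \<Phi> \<Phi>' x)"
proof -
  have [measurable]: "(\<lambda>x. x k) \<in> borel_measurable (lborel_prod m)" using k by simp
  have 1: "integrable (lborel_prod m) (\<lambda>x. f x *
      ((\<alpha> + 1 + real n) * x k ^ n * \<Phi> x - x k ^ Suc n * \<Phi> x / 2 + x k ^ Suc n * \<Phi>' x))"
    using k pb by (intro integrable_f_mult poly_bounded_intros) measurable
  have 2: "integrable (lborel_prod m) (\<lambda>x. f x * (x k / (x k - x j) * (\<beta> * x k ^ n * \<Phi> x)))"
    if "j \<in> {1..m} - {k}" for j
    using k pb that by (intro integrable_f_singular poly_bounded_intros) (simp, measurable)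
  have "integrable (lborel_prod m) (\<lambda>x. f x *
      ((\<alpha> + 1 + real n) * x k ^ n * \<Phi> x - x k ^ Suc n * \<Phi> x / 2 + x k ^ Suc n * \<Phi>' x)
      + (\<Sum>j\<in>{1..m} - {k}. f x * (x k / (x k - x j) * (\<beta> * x k ^ n * \<Phi> x))))"
    by (intro Bochner_Integration.integrable_add 1 Bochner_Integration.integrable_sum 2)
  also have "(\<lambda>x. f x *
      ((\<alpha> + 1 + real n) * x k ^ n * \<Phi> x - x k ^ Suc n * \<Phi> x / 2 + x k ^ Suc n * \<Phi>' x)
      + (\<Sum>j\<in>{1..m} - {k}. f x * (x k / (x k - x j) * (\<beta> * x k ^ n * \<Phi> x))))
    = (\<lambda>x. f x * ibp_term n k \<Phi> \<Phi>' x)"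
  proof
    fix x :: "nat \<Rightarrow> real"
    have "(\<Sum>j\<in>{1..m} - {k}. f x * (x k / (x k - x j) * (\<beta> * x k ^ n * \<Phi> x)))
        = f x * (\<beta> * (\<Sum>j\<in>{1..m} - {k}. x k ^ Suc n / (x k - x j)) * \<Phi> x)"
      by (simp add: sum_distrib_left sum_distrib_right mult_ac)
    then show "f x *
      ((\<alpha> + 1 + real n) * x k ^ n * \<Phi> x - x k ^ Suc n * \<Phi> x / 2 + x k ^ Suc n * \<Phi>' x)
      + (\<Sum>j\<in>{1..m} - {k}. f x * (x k / (x k - x j) * (\<beta> * x k ^ n * \<Phi> x)))
      = f x * ibp_term n k \<Phi> \<Phi>' x"
      unfolding ibp_term_def by (simp only: distrib_left add_ac)
  qed
  finally show ?thesis .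
qed

text \<open>No boundary terms: the primitive vanishes at 0 because \<alpha> + 1 + n > 0, and at
  infinity by exponential decay.\<close>

lemma line_integral_ibp_term:
  assumes k: "k \<in> {1..m}"
    and deriv: "\<And>u. ((\<lambda>v. \<Phi> (x(k := v))) has_real_derivative \<Phi>' (x(k := u))) (at u)"
    and pb: "poly_bounded m \<Phi>"
  shows "(\<integral>u. f (x(k := u)) * ibp_term n k \<Phi> \<Phi>' (x(k := u)) \<partial>lborel) = 0"
proof -
  define c where "c = \<alpha> + 1 + real n"
  have c: "c > 0" using \<alpha>_gt by (simp add: c_def)
  define w where "w u = (\<Prod>j\<in>{1..m} - {k}. \<bar>u - x j\<bar> powr \<beta>)" for u
  \<comment> \<open>For u > 0 this is f * x_k^(n+1) * \<Phi> along the line. Merging the powers of u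
    into the single exponent c > 0 gives continuity up to u = 0 even for negative \<alpha>.\<close>
  define g where "g u = rest k x * w u * (u powr c * exp (- u / 2) * \<Phi> (x(k := u)))" for u
  have powr_c: "u powr c = u powr \<alpha> * u ^ Suc n" if "u > 0" for u
    using that by (simp add: c_def powr_add powr_realpow)
  have g_eq: "g u = f (x(k := u)) * (u ^ Suc n * \<Phi> (x(k := u)))" if "u > 0" for u
    unfolding f_upd[OF k] g_def w_def powr_c[OF that] using that by (simp only: if_True less_imp_le) (simp add: mult_ac)
  show ?thesis
  proof (rule integral_derivative_half_line[where S = "x ` ({1..m} - {k})" and g = g])
    fix u :: real assume u: "u > 0" "u \<notin> x ` ({1..m} - {k})"
    define s where "s = (\<Sum>j\<in>{1..m} - {k}. \<beta> / (u - x j))"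
    have dw: "(w has_real_derivative w u * s) (at u)"
      unfolding w_def s_def by (rule has_derivative_prod_abs_powr) (use u in auto)
    have "(g has_real_derivative
        rest k x * (w u * s) * (u powr c * exp (- u / 2) * \<Phi> (x(k := u))) +
        rest k x * w u * (c * u powr (c - 1) * exp (- u / 2) * \<Phi> (x(k := u)) +
          u powr c * (exp (- u / 2) * (- 1 / 2)) * \<Phi> (x(k := u)) +
          u powr c * exp (- u / 2) * \<Phi>' (x(k := u)))) (at u)"
      unfolding g_def
      by (rule derivative_eq_intros refl dw deriv has_real_derivative_powr u | simp only: )+
         (simp add: algebra_simps)
    also have "u powr (c - 1) = u powr \<alpha> * u ^ n"
      using u by (simp add: c_def powr_add powr_realpow)
    also have "rest k x * (w u * s) * (u powr c * exp (- u / 2) * \<Phi> (x(k := u))) +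
        rest k x * w u * (c * (u powr \<alpha> * u ^ n) * exp (- u / 2) * \<Phi> (x(k := u)) +
          u powr c * (exp (- u / 2) * (- 1 / 2)) * \<Phi> (x(k := u)) +
          u powr c * exp (- u / 2) * \<Phi>' (x(k := u))) =
        (rest k x * w u * u powr \<alpha> * exp (- u / 2)) * (c * u ^ n * \<Phi> (x(k := u)) - u ^ Suc n * \<Phi> (x(k := u)) / 2
          + s * u ^ Suc n * \<Phi> (x(k := u)) + u ^ Suc n * \<Phi>' (x(k := u)))"
      unfolding powr_c[OF u(1)] by (simp add: algebra_simps)
    also have "rest k x * w u * u powr \<alpha> * exp (- u / 2) = f (x(k := u))"
      unfolding f_upd[OF k] w_def using u by simp
    also have "s * u ^ Suc n = \<beta> * (\<Sum>j\<in>{1..m} - {k}. u ^ Suc n / (u - x j))"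
      by (simp add: s_def sum_distrib_left sum_distrib_right mult_ac)
    also have "(\<Sum>j\<in>{1..m} - {k}. u ^ Suc n / (u - x j)) =
        (\<Sum>j\<in>{1..m} - {k}. (x(k := u)) k ^ Suc n / ((x(k := u)) k - (x(k := u)) j))"
      by (intro sum.cong) auto
    finally show "(g has_real_derivative f (x(k := u)) * ibp_term n k \<Phi> \<Phi>' (x(k := u))) (at u)"
      by (simp only: ibp_term_def c_def fun_upd_same)
  next
    have "continuous_on {0..} (\<lambda>u. \<Phi> (x(k := u)))"
      using deriv by (intro continuous_at_imp_continuous_on ballI DERIV_isCont)
    then show "continuous_on {0..} g"
      unfolding g_def w_def using c \<beta>_pos
      by (intro continuous_intros continuous_on_powr') auto
  next
    show "g 0 = 0" by (simp add: g_def)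
  next
    obtain C N where C: "C \<ge> 0"
      "\<And>x. (\<And>i. i \<in> {1..m} \<Longrightarrow> 0 \<le> x i) \<Longrightarrow> \<bar>\<Phi> x\<bar> \<le> C * (1 + (\<Sum>i = 1..m. x i)) ^ N"
      using poly_boundedE[OF pb] by blast
    \<comment> \<open>Degree \<open>Suc n\<close> accounts for u^(n+1), through u \<le> S, and
      degree \<open>N\<close> for \<Phi>.\<close>
    obtain D where D: "D \<ge> 0"
      "\<And>x. f x * (1 + (\<Sum>i = 1..m. x i)) ^ (Suc n + N) \<le> D * (\<Prod>i = 1..m. gamma_weight \<alpha> (x i))"
      using f_poly_le[of "Suc n + N"] by auto
    define E where "E = C * D * (\<Prod>i\<in>{1..m} - {k}. gamma_weight \<alpha> (x i))"
    have "\<bar>g u\<bar> \<le> E * gamma_weight \<alpha> u" if u: "u > 0" for u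
    proof (cases "\<forall>i\<in>{1..m}. 0 \<le> (x(k := u)) i")
      case True
      define S where "S = (\<Sum>i = 1..m. (x(k := u)) i)"
      have "(x(k := u)) k \<le> S"
        unfolding S_def by (rule member_le_sum) (use True k in \<open>auto simp del: fun_upd_apply\<close>)
      then have "u \<le> S" by simp
      have "\<bar>g u\<bar> = f (x(k := u)) * (u ^ Suc n * \<bar>\<Phi> (x(k := u))\<bar>)"
        unfolding g_eq[OF u] using f_nonneg u by (simp add: abs_mult)
      also have "\<dots> \<le> f (x(k := u)) * ((1 + S) ^ Suc n * (C * (1 + S) ^ N))"
        using True C(2)[of "x(k := u)"] f_nonneg u \<open>u \<le> S\<close> unfolding S_def
        by (intro mult_left_mono mult_mono power_mono zero_le_power) auto
      also have "\<dots> = C * (f (x(k := u)) * (1 + S) ^ (Suc n + N))"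
        by (simp only: power_add mult_ac)
      also have "\<dots> \<le> C * (D * (\<Prod>i = 1..m. gamma_weight \<alpha> ((x(k := u)) i)))"
        unfolding S_def by (intro mult_left_mono D C)
      also have "(\<Prod>i = 1..m. gamma_weight \<alpha> ((x(k := u)) i)) =
          gamma_weight \<alpha> u * (\<Prod>i\<in>{1..m} - {k}. gamma_weight \<alpha> (x i))"
        using k by (subst prod.remove[of _ k]) auto
      finally show ?thesis by (simp add: E_def mult_ac)
    next
      case False
      then have "f (x(k := u)) = 0" using f_eq_0[of _ "x(k := u)"] by fastforce
      then show ?thesis
        unfolding g_eq[OF u] E_def using C(1) D(1)
        by (auto intro!: mult_nonneg_nonneg prod_nonneg gamma_weight_nonneg)
    qed
    then have "\<forall>\<^sub>F u in at_top. norm (g u) \<le> E * gamma_weight \<alpha> u"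
      by (auto intro!: eventually_at_top_linorderI[of 1])
    moreover have "((\<lambda>u. E * gamma_weight \<alpha> u) \<longlongrightarrow> 0) at_top"
      using tendsto_mult_right_zero[OF gamma_weight_tendsto_0] .
    ultimately show "(g \<longlongrightarrow> 0) at_top"
      by (rule Lim_null_comparison)
  next
    fix u :: real assume "u < 0"
    then show "f (x(k := u)) * ibp_term n k \<Phi> \<Phi>' (x(k := u)) = 0"
      using f_eq_0[of k "x(k := u)"] k by simp
  qed simp
qed

lemma integral_ibp_term:
  assumes k: "k \<in> {1..m}"
    and deriv: "\<And>x u. ((\<lambda>v. \<Phi> (x(k := v))) has_real_derivative \<Phi>' (x(k := u))) (at u)"
    and "\<Phi> \<in> borel_measurable (lborel_prod m)" "\<Phi>' \<in> borel_measurable (lborel_prod m)"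
    and pb: "poly_bounded m \<Phi>" "poly_bounded m \<Phi>'"
  shows "(\<integral>x. f x * ibp_term n k \<Phi> \<Phi>' x \<partial>lborel_prod m) = 0"
proof -
  interpret product_sigma_finite "\<lambda>_::nat. lborel" by standard
  have I: "insert k ({1..m} - {k}) = {1..m}" using k by auto
  have int: "integrable (PiM (insert k ({1..m} - {k})) (\<lambda>_. lborel)) (\<lambda>x. f x * ibp_term n k \<Phi> \<Phi>' x)"
    unfolding I by (rule integrable_ibp_term[OF k assms(3-6)])
  have "(\<integral>x. f x * ibp_term n k \<Phi> \<Phi>' x \<partial>lborel_prod m) =
      (\<integral>x. f x * ibp_term n k \<Phi> \<Phi>' x \<partial>PiM (insert k ({1..m} - {k})) (\<lambda>_. lborel))"
    by (simp only: I)
  also have "\<dots> = (\<integral>x. (\<integral>u. f (x(k := u)) * ibp_term n k \<Phi> \<Phi>' (x(k := u)) \<partial>lborel)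
      \<partial>PiM ({1..m} - {k}) (\<lambda>_. lborel))"
    by (rule product_integral_insert[OF _ _ int]) auto
  also have "\<dots> = 0"
    by (simp only: line_integral_ibp_term[OF k deriv pb(1)] Bochner_Integration.integral_zero)
  finally show ?thesis .
qed

definition law :: "(nat \<Rightarrow> real) measure" where
  "law = density (lborel_prod m) (\<lambda>x. ennreal (f x))"

lemma prob_space_law: "prob_space law"
  using prob by (simp add: law_def)

lemma integral_law:
  "g \<in> borel_measurable (lborel_prod m) \<Longrightarrow> (\<integral>x. g x \<partial>law) = (\<integral>x. f x * g x \<partial>lborel_prod m)"
  for g :: "(nat \<Rightarrow> real) \<Rightarrow> real"
  unfolding law_def by (rule integral_real_density) (auto simp: f_nonneg simp del: One_nat_def)

lemma integrable_law:
  assumes "g \<in> borel_measurable (lborel_prod m)" "poly_bounded m g"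
  shows "integrable law g"
  unfolding law_def using integrable_f_mult[OF assms] assms
  by (subst integrable_real_density) (auto simp: f_nonneg simp del: One_nat_def)

text \<open>The divergence of the vector field with components x_k^(n+1) relative to the density:
  the sum over k of the k-th partial derivatives of x_k^(n+1) f, divided by f. Symmetrisation has
  turned the interaction into power sums, where \<open>power_sum m 0\<close> is m.\<close>

definition loop_op :: "nat \<Rightarrow> (nat \<Rightarrow> real) \<Rightarrow> real" where
  "loop_op n x = (\<alpha> + 1 + real n) * power_sum m n x - power_sum m (Suc n) x / 2
     + \<beta> / 2 * ((\<Sum>k\<le>n. power_sum m k x * power_sum m (n - k) x) - real (Suc n) * power_sum m n x)"

text \<open>Summing the coordinate identities removes the singular quotients; from here on all
  integrands are polynomially bounded.\<close>

theorem loop_equation: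
  assumes deriv: "\<And>k x u. k \<in> {1..m} \<Longrightarrow>
      ((\<lambda>v. \<Phi> (x(k := v))) has_real_derivative \<Phi>' k (x(k := u))) (at u)"
    and meas: "\<Phi> \<in> borel_measurable (lborel_prod m)"
      "\<And>k. k \<in> {1..m} \<Longrightarrow> \<Phi>' k \<in> borel_measurable (lborel_prod m)"
    and pb: "poly_bounded m \<Phi>" "\<And>k. k \<in> {1..m} \<Longrightarrow> poly_bounded m (\<Phi>' k)"
  shows "(\<integral>x. loop_op n x * \<Phi> x + (\<Sum>k = 1..m. x k ^ Suc n * \<Phi>' k x) \<partial>law) = 0"
proof -
  note [measurable] = meas
  have [measurable]: "loop_op n \<in> borel_measurable (lborel_prod m)"
    unfolding loop_op_def[abs_def] by measurable
  have [measurable]: "(\<lambda>x. \<Sum>k = 1..m. x k ^ Suc n * \<Phi>' k x) \<in> borel_measurable (lborel_prod m)"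
    by (intro borel_measurable_sum borel_measurable_times borel_measurable_power component_measurable meas)
  \<comment> \<open>Symmetrisation needs distinct coordinates; at a collision \<open>f\<close>
    vanishes and so do both sides.\<close>
  have eq: "f x * (\<Sum>k = 1..m. ibp_term n k \<Phi> (\<Phi>' k) x) =
      f x * (loop_op n x * \<Phi> x + (\<Sum>k = 1..m. x k ^ Suc n * \<Phi>' k x))" for x
  proof (cases "inj_on x {1..m}")
    case True
    have "(\<Sum>k = 1..m. ibp_term n k \<Phi> (\<Phi>' k) x) =
        (\<alpha> + 1 + real n) * power_sum m n x * \<Phi> x - power_sum m (Suc n) x * \<Phi> x / 2
        + \<beta> * (\<Sum>i = 1..m. \<Sum>j\<in>{1..m} - {i}. x i ^ Suc n / (x i - x j)) * \<Phi> x
        + (\<Sum>k = 1..m. x k ^ Suc n * \<Phi>' k x)"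
      unfolding ibp_term_def power_sum_def
      by (simp only: sum.distrib sum_subtractf sum_distrib_left sum_distrib_right sum_divide_distrib)
    also have "\<dots> = loop_op n x * \<Phi> x + (\<Sum>k = 1..m. x k ^ Suc n * \<Phi>' k x)"
      unfolding sum_div_differences[OF True] loop_op_def by (simp add: field_simps)
    finally show ?thesis by simp
  next
    case False
    then have "f x = 0" unfolding inj_on_def using f_eq_0' by blast
    then show ?thesis by simp
  qed
  have meas': "(\<lambda>x. loop_op n x * \<Phi> x + (\<Sum>k = 1..m. x k ^ Suc n * \<Phi>' k x)) \<in> borel_measurable (lborel_prod m)"
    by measurable
  have "(\<integral>x. loop_op n x * \<Phi> x + (\<Sum>k = 1..m. x k ^ Suc n * \<Phi>' k x) \<partial>law) =
      (\<integral>x. (\<Sum>k = 1..m. f x * ibp_term n k \<Phi> (\<Phi>' k) x) \<partial>lborel_prod m)"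
    unfolding integral_law[OF meas'] by (simp only: sum_distrib_left[symmetric] eq)
  also have "\<dots> = (\<Sum>k = 1..m. \<integral>x. f x * ibp_term n k \<Phi> (\<Phi>' k) x \<partial>lborel_prod m)"
    by (intro Bochner_Integration.integral_sum integrable_ibp_term meas pb)
  also have "\<dots> = 0"
    by (intro sum.neutral ballI integral_ibp_term deriv meas pb)
  finally show ?thesis .
qed

end

section \<open>Moments and the approximate differential equation\<close>

lemma has_derivative_power_sum_upd:
  assumes "k \<in> {1..m}"
  shows "((\<lambda>v. power_sum m n (x(k := v))) has_real_derivative real n * u ^ (n - 1)) (at u)"
proof -
  have "power_sum m n (x(k := v)) = v ^ n + (\<Sum>i\<in>{1..m} - {k}. x i ^ n)" for v
    unfolding power_sum_def using assms by (subst sum.remove[of _ k]) auto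
  then show ?thesis
    by (auto intro!: derivative_eq_intros)
qed

text \<open>Both remainders are parts of the second-order estimate for exp(iB). A quadratic
  remainder makes a finite second moment suffice for differentiating under the integral.\<close>

lemma cos_shift_approx: "\<bar>cos (A + B) - cos A + B * sin A\<bar> \<le> B\<^sup>2" for A B :: real
proof -
  have n: "cmod (iexp B - (1 + \<i> * B)) \<le> B\<^sup>2 / 2"
    using iexp_approx1[of B 1] by (simp add: power2_eq_square)
  have "\<bar>cos B - 1\<bar> \<le> B\<^sup>2 / 2"
    using order.trans[OF abs_Re_le_cmod n] by (simp add: Re_exp)
  moreover have "\<bar>sin B - B\<bar> \<le> B\<^sup>2 / 2"
    using order.trans[OF abs_Im_le_cmod n] by (simp add: Im_exp)
  ultimately have "\<bar>cos A\<bar> * \<bar>cos B - 1\<bar> + \<bar>sin A\<bar> * \<bar>sin B - B\<bar> \<le> 1 * (B\<^sup>2 / 2) + 1 * (B\<^sup>2 / 2)"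
    by (intro add_mono mult_mono) auto
  moreover have "cos (A + B) - cos A + B * sin A = cos A * (cos B - 1) - sin A * (sin B - B)"
    by (simp add: cos_add algebra_simps)
  then have "\<bar>cos (A + B) - cos A + B * sin A\<bar> \<le> \<bar>cos A\<bar> * \<bar>cos B - 1\<bar> + \<bar>sin A\<bar> * \<bar>sin B - B\<bar>"
    by (simp only: abs_mult[symmetric] abs_triangle_ineq4)
  ultimately show ?thesis by linarith
qed

lemma integral_linear_combination:
  fixes A B C :: "'a \<Rightarrow> real"
  assumes "integrable M A" "integrable M B" "integrable M C"
  shows "(\<integral>x. a * A x + b * B x + c * C x \<partial>M) = a * (\<integral>x. A x \<partial>M) + b * (\<integral>x. B x \<partial>M) + c * (\<integral>x. C x \<partial>M)"
  using assms by simp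

lemma norm_integral_le:
  fixes u :: "'a \<Rightarrow> 'b :: {banach, second_countable_topology}" and v :: "'a \<Rightarrow> real"
  assumes u: "integrable M u" and v: "integrable M v" and le: "\<And>x. norm (u x) \<le> v x"
  shows "norm (\<integral>x. u x \<partial>M) \<le> (\<integral>x. v x \<partial>M)"
proof -
  have "norm (\<integral>x. u x \<partial>M) \<le> (\<integral>x. norm (u x) \<partial>M)"
    by (rule Bochner_Integration.integral_norm_bound)
  also have "\<dots> \<le> (\<integral>x. v x \<partial>M)"
    using u v le by (intro integral_mono) auto
  finally show ?thesis .
qed

lemmas abs_integral_le = norm_integral_le[where 'b = real, unfolded real_norm_def]

lemma borel_measurable_cos_sin [measurable]:
  "(cos :: real \<Rightarrow> real) \<in> borel_measurable borel" "(sin :: real \<Rightarrow> real) \<in> borel_measurable borel"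
  by (intro borel_measurable_continuous_onI continuous_intros)+

text \<open>The variance of |X| is nonnegative.\<close>

lemma (in prob_space) expectation_abs_le_sqrt:
  fixes X :: "'a \<Rightarrow> real"
  assumes "integrable M X" "integrable M (\<lambda>x. (X x)\<^sup>2)"
  shows "(\<integral>x. \<bar>X x\<bar> \<partial>M) \<le> sqrt (\<integral>x. (X x)\<^sup>2 \<partial>M)"
proof (rule real_le_rsqrt)
  have "variance (\<lambda>x. \<bar>X x\<bar>) = (\<integral>x. (X x)\<^sup>2 \<partial>M) - (\<integral>x. \<bar>X x\<bar> \<partial>M)\<^sup>2"
    using assms by (subst variance_eq) auto
  moreover have "0 \<le> variance (\<lambda>x. \<bar>X x\<bar>)" by (rule variance_positive)
  ultimately show "(\<integral>x. \<bar>X x\<bar> \<partial>M)\<^sup>2 \<le> (\<integral>x. (X x)\<^sup>2 \<partial>M)" by simp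
qed

section \<open>Generator calculus and Stein identities for the quadratic statistic\<close>

context laguerre_law
begin

sublocale law: prob_space law
  by (rule prob_space_law)

definition \<kappa> :: real where "\<kappa> = 2 * (a1 + laguerre_r \<beta> m)"
definition s :: real where "s = real m * a1"
definition Y :: "(nat \<Rightarrow> real) \<Rightarrow> real" where "Y x = power_sum m 1 x - 2 * s"
definition Z :: "(nat \<Rightarrow> real) \<Rightarrow> real" where
  "Z x = power_sum m 2 x - 2 * \<kappa> * power_sum m 1 x + 2 * \<kappa> * s"
definition H :: "(nat \<Rightarrow> real) \<Rightarrow> real" where
  "H x = power_sum m 3 x - 2 * \<kappa> * power_sum m 2 x + \<kappa>\<^sup>2 * power_sum m 1 x"
text \<open>The sum of x_i^2 (x_i - \<kappa>)^2, which together with \<open>H\<close> dominates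
  \<open>J\<close>.\<close>

definition K :: "(nat \<Rightarrow> real) \<Rightarrow> real" where
  "K x = power_sum m 4 x - 2 * \<kappa> * power_sum m 3 x + \<kappa>\<^sup>2 * power_sum m 2 x"
text \<open>Half the carre du champ of \<open>H\<close> and \<open>Z\<close>: the sum of x_i (x_i -
  \<kappa>)^2 (3 x_i - \<kappa>).\<close>

definition J :: "(nat \<Rightarrow> real) \<Rightarrow> real" where
  "J x = 3 * power_sum m 4 x - 7 * \<kappa> * power_sum m 3 x + 5 * \<kappa>\<^sup>2 * power_sum m 2 x - \<kappa> ^ 3 * power_sum m 1 x"
text \<open>The generator maps \<open>H\<close> to R + 6 \<beta> s^2 - 3/2 H. Centring p_1^2 at 4
  s^2 is what splits off the constant that becomes the limiting variance.\<close>

definition R :: "(nat \<Rightarrow> real) \<Rightarrow> real" where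
  "R x = \<kappa> / 2 * Z x + 3 * (1 - \<beta> / 2) * power_sum m 2 x + 3 * \<beta> / 2 * ((power_sum m 1 x)\<^sup>2 - 4 * s\<^sup>2)"

lemma s_pos: "s > 0"
  using m_pos a1_pos by (simp add: s_def)

lemma \<kappa>_pos: "\<kappa> > 0"
proof -
  have "1 \<le> laguerre_r \<beta> m"
    using \<beta>_pos m_pos by (simp add: laguerre_r_def)
  then show ?thesis
    using a1_pos by (simp add: \<kappa>_def)
qed

lemma measurable_stats [measurable]:
  "Y \<in> borel_measurable (lborel_prod m)" "Z \<in> borel_measurable (lborel_prod m)"
  "H \<in> borel_measurable (lborel_prod m)" "K \<in> borel_measurable (lborel_prod m)"
  "J \<in> borel_measurable (lborel_prod m)" "R \<in> borel_measurable (lborel_prod m)"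
proof -
  show [measurable]: "Z \<in> borel_measurable (lborel_prod m)" unfolding Z_def[abs_def] by measurable
  show "Y \<in> borel_measurable (lborel_prod m)" unfolding Y_def[abs_def] by measurable
  show "H \<in> borel_measurable (lborel_prod m)" unfolding H_def[abs_def] by measurable
  show "K \<in> borel_measurable (lborel_prod m)" unfolding K_def[abs_def] by measurable
  show "J \<in> borel_measurable (lborel_prod m)" unfolding J_def[abs_def] by measurable
  show "R \<in> borel_measurable (lborel_prod m)" unfolding R_def[abs_def] by measurable
qed

lemma poly_bounded_stats:
  "poly_bounded m Y" "poly_bounded m Z" "poly_bounded m H" "poly_bounded m K" "poly_bounded m J" "poly_bounded m R"
proof -
  show Z: "poly_bounded m Z" unfolding Z_def[abs_def] by (intro poly_bounded_intros)
  show "poly_bounded m Y" unfolding Y_def[abs_def] by (intro poly_bounded_intros)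
  show "poly_bounded m H" unfolding H_def[abs_def] by (intro poly_bounded_intros)
  show "poly_bounded m K" unfolding K_def[abs_def] by (intro poly_bounded_intros)
  show "poly_bounded m J" unfolding J_def[abs_def] by (intro poly_bounded_intros)
  show "poly_bounded m R" unfolding R_def[abs_def] by (intro poly_bounded_intros Z)
qed

lemma measurable_law_iff: "g \<in> borel_measurable law \<longleftrightarrow> g \<in> borel_measurable (lborel_prod m)"
  by (simp add: law_def)

text \<open>The value of \<open>laguerre_r\<close> makes the coefficients collapse, here to m a1 and
  for n = 1 to a1 + r. Since \<open>loop_op 0\<close> is -Y / 2, the Euler field (n = 0) yields the
  exact formulas for moments involving p_1.\<close>

lemma loop_op_0: "loop_op 0 x = s - power_sum m 1 x / 2"
  by (simp add: loop_op_def \<alpha>_def laguerre_r_def s_def power_sum_def field_simps)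

lemma loop_op_1: "loop_op 1 x = \<kappa> / 2 * power_sum m 1 x - power_sum m 2 x / 2"
  by (simp add: loop_op_def \<alpha>_def laguerre_r_def \<kappa>_def numeral_2_eq_2 power_sum_def[of _ 0] field_simps)

lemma loop_op_2:
  "loop_op 2 x = (\<kappa> / 2 + 1 - \<beta> / 2) * power_sum m 2 x + \<beta> / 2 * (power_sum m 1 x)\<^sup>2 - power_sum m 3 x / 2"
  by (simp add: loop_op_def \<alpha>_def laguerre_r_def \<kappa>_def numeral_2_eq_2 numeral_3_eq_3
      power_sum_def[of _ 0] field_simps)

lemma loop_op_3:
  "loop_op 3 x = (\<kappa> / 2 + 2 - \<beta>) * power_sum m 3 x + \<beta> * (power_sum m 1 x * power_sum m 2 x) - power_sum m 4 x / 2"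
  by (simp add: loop_op_def \<alpha>_def laguerre_r_def \<kappa>_def eval_nat_numeral
      power_sum_def[of _ 0] field_simps)

text \<open>Functions of one combination of p_1 and p_2 cover every use: \<open>Z\<close> for the
  Stein identities, and p_1, p_2 or a constant for the moments.\<close>

lemma loop_equation_quadratic:
  fixes \<phi> \<phi>' :: "real \<Rightarrow> real" and a b c :: real
  defines "q \<equiv> \<lambda>x. a * power_sum m 2 x + b * power_sum m 1 x + c"
  assumes deriv: "\<And>t. (\<phi> has_real_derivative \<phi>' t) (at t)"
    and [measurable]: "\<phi> \<in> borel_measurable borel" "\<phi>' \<in> borel_measurable borel"
    and pb: "poly_bounded m (\<lambda>x. \<phi> (q x))" "poly_bounded m (\<lambda>x. \<phi>' (q x))"
  shows "(\<integral>x. loop_op n x * \<phi> (q x) + (2 * a * power_sum m (n + 2) x + b * power_sum m (n + 1) x) * \<phi>' (q x) \<partial>law) = 0"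
proof -
  define \<Phi>' where "\<Phi>' k x = \<phi>' (q x) * (2 * a * x k + b)" for k x
  have [measurable]: "q \<in> borel_measurable (lborel_prod m)" unfolding q_def by measurable
  have "(\<integral>x. loop_op n x * \<phi> (q x) + (\<Sum>k = 1..m. x k ^ Suc n * \<Phi>' k x) \<partial>law) = 0"
  proof (rule loop_equation)
    fix k x u assume k: "k \<in> {1..m}"
    have "((\<lambda>v. q (x(k := v))) has_real_derivative (2 * a * u + b)) (at u)"
      unfolding q_def
      by (rule derivative_eq_intros has_derivative_power_sum_upd[OF k] refl)+ simp
    from DERIV_chain2[OF deriv this]
    show "((\<lambda>v. \<phi> (q (x(k := v)))) has_real_derivative \<Phi>' k (x(k := u))) (at u)"
      by (simp add: \<Phi>'_def)
  next
    fix k assume k: "k \<in> {1..m}"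
    then have [measurable]: "(\<lambda>x. x k) \<in> borel_measurable (lborel_prod m)" by simp
    show "\<Phi>' k \<in> borel_measurable (lborel_prod m)" unfolding \<Phi>'_def by measurable
    show "poly_bounded m (\<Phi>' k)" unfolding \<Phi>'_def[abs_def] by (intro poly_bounded_intros pb k)
  qed (use pb in measurable)
  also have "(\<lambda>x. \<Sum>k = 1..m. x k ^ Suc n * \<Phi>' k x) =
      (\<lambda>x. (2 * a * power_sum m (n + 2) x + b * power_sum m (n + 1) x) * \<phi>' (q x))"
    by (simp add: \<Phi>'_def power_sum_def sum_distrib_left sum_distrib_right sum.distrib algebra_simps)
  finally show ?thesis .
qed

lemma loop_equation_Z:
  assumes deriv: "\<And>t. (\<phi> has_real_derivative \<phi>' t) (at t)"
    and "\<phi> \<in> borel_measurable borel" "\<phi>' \<in> borel_measurable borel"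
    and "poly_bounded m (\<lambda>x. \<phi> (Z x))" "poly_bounded m (\<lambda>x. \<phi>' (Z x))"
  shows "(\<integral>x. loop_op n x * \<phi> (Z x) + (2 * power_sum m (n + 2) x - 2 * \<kappa> * power_sum m (n + 1) x) * \<phi>' (Z x) \<partial>law) = 0"
proof -
  have Z: "Z = (\<lambda>x. 1 * power_sum m 2 x + (- 2 * \<kappa>) * power_sum m 1 x + 2 * \<kappa> * s)"
    by (simp add: Z_def fun_eq_iff)
  show ?thesis
    using loop_equation_quadratic[OF assms(1-3), of 1 "- 2 * \<kappa>" "2 * \<kappa> * s" n] assms(4,5)
    unfolding Z by simp
qed

lemma integrable_loop_Z:
  assumes [measurable]: "\<phi> \<in> borel_measurable borel" "\<phi>' \<in> borel_measurable borel"
    and "poly_bounded m (\<lambda>x. \<phi> (Z x))" "poly_bounded m (\<lambda>x. \<phi>' (Z x))"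
  shows "integrable law (\<lambda>x. loop_op n x * \<phi> (Z x) + (2 * power_sum m (n + 2) x - 2 * \<kappa> * power_sum m (n + 1) x) * \<phi>' (Z x))"
proof (rule integrable_law)
  have [measurable]: "loop_op n \<in> borel_measurable (lborel_prod m)"
    unfolding loop_op_def[abs_def] by measurable
  show "(\<lambda>x. loop_op n x * \<phi> (Z x) + (2 * power_sum m (n + 2) x - 2 * \<kappa> * power_sum m (n + 1) x) * \<phi>' (Z x))
      \<in> borel_measurable (lborel_prod m)" by measurable
  show "poly_bounded m (\<lambda>x. loop_op n x * \<phi> (Z x) + (2 * power_sum m (n + 2) x - 2 * \<kappa> * power_sum m (n + 1) x) * \<phi>' (Z x))"
    unfolding loop_op_def by (intro poly_bounded_intros assms)
qed

text \<open>\<open>Z\<close> and \<open>H\<close> come from the infinitesimal generator of the Laguerre diffusion, which acts on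
  \<open>power_sum m (Suc n)\<close> as \<open>Suc n * loop_op n\<close>: \<open>Z\<close> is an eigenfunction with eigenvalue \<open>-1\<close>,
  and \<open>4 * H\<close> is its carre du champ.\<close>

lemma stein_Z:
  assumes "\<And>t. (\<phi> has_real_derivative \<phi>' t) (at t)"
    and [measurable]: "\<phi> \<in> borel_measurable borel" "\<phi>' \<in> borel_measurable borel"
    and pb: "poly_bounded m (\<lambda>x. \<phi> (Z x))" "poly_bounded m (\<lambda>x. \<phi>' (Z x))"
  shows "(\<integral>x. Z x * \<phi> (Z x) \<partial>law) = 4 * (\<integral>x. H x * \<phi>' (Z x) \<partial>law)"
proof -
  let ?L = "\<lambda>n x. loop_op n x * \<phi> (Z x) + (2 * power_sum m (n + 2) x - 2 * \<kappa> * power_sum m (n + 1) x) * \<phi>' (Z x)"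
  have i: "integrable law (\<lambda>x. Z x * \<phi> (Z x))" "integrable law (\<lambda>x. H x * \<phi>' (Z x))"
    by (intro integrable_law poly_bounded_mult poly_bounded_stats pb, measurable)+
  \<comment> \<open>The weights 2 and -2 \<kappa> turn the loop operators into the generator applied
    to \<open>Z\<close>. The summand with coefficient 0 fills the third slot of the linear
    combination rule.\<close>
  have "(\<integral>x. 2 * ?L 1 x + (- 2 * \<kappa>) * ?L 0 x + 0 * ?L 0 x \<partial>law) = 0"
    by (simp only: integral_linear_combination[OF integrable_loop_Z[OF assms(2-5)]
      integrable_loop_Z[OF assms(2-5)] integrable_loop_Z[OF assms(2-5)]] loop_equation_Z[OF assms]
      mult_zero_right add_0_right)
  also have "(\<lambda>x. 2 * ?L 1 x + (- 2 * \<kappa>) * ?L 0 x + 0 * ?L 0 x) = (\<lambda>x. 4 * (H x * \<phi>' (Z x)) - Z x * \<phi> (Z x))"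
    unfolding loop_op_0 loop_op_1 H_def Z_def
    by (simp add: fun_eq_iff algebra_simps power2_eq_square numeral_3_eq_3 numeral_2_eq_2)
  finally show ?thesis using i by simp
qed

text \<open>Integrating the generator of \<open>H\<close> against \<phi>(Z) gives 3/2 E[H \<phi>] =
  6 \<beta> s^2 E[\<phi>] + E[R \<phi>] + 2 E[J \<phi>']. This is the step that replaces
  \<open>H\<close> by a constant without an estimate of its variance.\<close>

lemma stein_H:
  assumes "\<And>t. (\<phi> has_real_derivative \<phi>' t) (at t)"
    and [measurable]: "\<phi> \<in> borel_measurable borel" "\<phi>' \<in> borel_measurable borel"
    and pb: "poly_bounded m (\<lambda>x. \<phi> (Z x))" "poly_bounded m (\<lambda>x. \<phi>' (Z x))"
  shows "(\<integral>x. H x * \<phi> (Z x) \<partial>law) =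
    4 * \<beta> * s\<^sup>2 * (\<integral>x. \<phi> (Z x) \<partial>law) + 2 / 3 * (\<integral>x. R x * \<phi> (Z x) \<partial>law) + 4 / 3 * (\<integral>x. J x * \<phi>' (Z x) \<partial>law)"
proof -
  let ?L = "\<lambda>n x. loop_op n x * \<phi> (Z x) + (2 * power_sum m (n + 2) x - 2 * \<kappa> * power_sum m (n + 1) x) * \<phi>' (Z x)"
  have i: "integrable law (\<lambda>x. H x * \<phi> (Z x))" "integrable law (\<lambda>x. R x * \<phi> (Z x))"
    "integrable law (\<lambda>x. J x * \<phi>' (Z x))"
    by (intro integrable_law poly_bounded_mult poly_bounded_stats pb, measurable)+
  have i': "integrable law (\<lambda>x. \<phi> (Z x))"
    by (intro integrable_law pb, measurable)
  \<comment> \<open>The weights are the coefficients of the derivative 3 x^2 - 4 \<kappa> x +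
    \<kappa>^2 of x (x - \<kappa>)^2.\<close>
  have "(\<integral>x. 3 * ?L 2 x + (- 4 * \<kappa>) * ?L 1 x + \<kappa>\<^sup>2 * ?L 0 x \<partial>law) = 0"
    by (simp only: integral_linear_combination[OF integrable_loop_Z[OF assms(2-5)]
      integrable_loop_Z[OF assms(2-5)] integrable_loop_Z[OF assms(2-5)]] loop_equation_Z[OF assms]
      mult_zero_right add_0_right)
  also have "(\<lambda>x. 3 * ?L 2 x + (- 4 * \<kappa>) * ?L 1 x + \<kappa>\<^sup>2 * ?L 0 x) =
     (\<lambda>x. R x * \<phi> (Z x) + 6 * \<beta> * s\<^sup>2 * \<phi> (Z x) - 3 / 2 * (H x * \<phi> (Z x)) + 2 * (J x * \<phi>' (Z x)))"
  proof
    fix x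
    \<comment> \<open>After removal of -3/2 H, the leftover \<kappa>/2 p_2 - \<kappa>^2 p_1 +
      \<kappa>^2 s is exactly \<kappa>/2 Z, so the large terms in \<kappa> stay centred.\<close>
    have 1: "3 * loop_op 2 x - 4 * \<kappa> * loop_op 1 x + \<kappa>\<^sup>2 * loop_op 0 x = R x + 6 * \<beta> * s\<^sup>2 - 3 / 2 * H x"
      unfolding loop_op_0 loop_op_1 loop_op_2 R_def H_def Z_def
      by (simp add: field_simps power2_eq_square)
    \<comment> \<open>Here 3 x^2 - 4 \<kappa> x + \<kappa>^2 = (3 x - \<kappa>) (x - \<kappa>),
      multiplied by x and by the derivative 2 (x - \<kappa>) of \<open>Z\<close>.\<close>
    have 2: "3 * (2 * power_sum m (2 + 2) x - 2 * \<kappa> * power_sum m (2 + 1) x)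
        - 4 * \<kappa> * (2 * power_sum m (1 + 2) x - 2 * \<kappa> * power_sum m (1 + 1) x)
        + \<kappa>\<^sup>2 * (2 * power_sum m (0 + 2) x - 2 * \<kappa> * power_sum m (0 + 1) x) = 2 * J x"
      unfolding J_def by (simp add: algebra_simps eval_nat_numeral)
    have "3 * ?L 2 x + (- 4 * \<kappa>) * ?L 1 x + \<kappa>\<^sup>2 * ?L 0 x =
        (3 * loop_op 2 x - 4 * \<kappa> * loop_op 1 x + \<kappa>\<^sup>2 * loop_op 0 x) * \<phi> (Z x) +
        (3 * (2 * power_sum m (2 + 2) x - 2 * \<kappa> * power_sum m (2 + 1) x)
        - 4 * \<kappa> * (2 * power_sum m (1 + 2) x - 2 * \<kappa> * power_sum m (1 + 1) x)
        + \<kappa>\<^sup>2 * (2 * power_sum m (0 + 2) x - 2 * \<kappa> * power_sum m (0 + 1) x)) * \<phi>' (Z x)"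
      by (simp only: distrib_left distrib_right left_diff_distrib right_diff_distrib mult_ac add_ac)
    also have "\<dots> = R x * \<phi> (Z x) + 6 * \<beta> * s\<^sup>2 * \<phi> (Z x) - 3 / 2 * (H x * \<phi> (Z x)) + 2 * (J x * \<phi>' (Z x))"
      unfolding 1 2 by (simp add: algebra_simps)
    finally show "3 * ?L 2 x + (- 4 * \<kappa>) * ?L 1 x + \<kappa>\<^sup>2 * ?L 0 x = \<dots>" .
  qed
  finally show ?thesis using i i' by simp
qed

section \<open>Exact moments and mean bounds for the remainders\<close>

lemma integrable_power_sum [simp]: "integrable law (power_sum m n)"
  by (intro integrable_law poly_bounded_intros) measurable

lemma integrable_power_sum_mult [simp]: "integrable law (\<lambda>x. power_sum m n x * power_sum m n' x)"
  by (intro integrable_law poly_bounded_intros) measurable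

lemma integrable_power_sum_power2 [simp]: "integrable law (\<lambda>x. (power_sum m n x)\<^sup>2)"
  by (intro integrable_law poly_bounded_intros) measurable

lemma integrable_stats:
  "integrable law Y" "integrable law Z" "integrable law H" "integrable law K" "integrable law J" "integrable law R"
  by (intro integrable_law poly_bounded_stats measurable_stats)+

lemma integral_loop_op: "(\<integral>x. loop_op n x \<partial>law) = 0"
  using loop_equation_quadratic[of "\<lambda>_. 1" "\<lambda>_. 0" 0 0 0 n] by (simp add: poly_bounded_const)

lemma integral_p1: "(\<integral>x. power_sum m 1 x \<partial>law) = 2 * s"
  using integral_loop_op[of 0] unfolding loop_op_0 by (simp add: law.prob_space del: One_nat_def)

lemma integral_p2: "(\<integral>x. power_sum m 2 x \<partial>law) = 2 * \<kappa> * s"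
  using integral_loop_op[of 1] unfolding loop_op_1 by (simp add: integral_p1 del: One_nat_def)

text \<open>The Euler field tested on p_1; it yields the variance 4 s of \<open>Y\<close>.\<close>

lemma integral_p1_squared: "(\<integral>x. (power_sum m 1 x)\<^sup>2 \<partial>law) = 4 * s\<^sup>2 + 4 * s"
proof -
  have "(\<integral>x. loop_op 0 x * power_sum m 1 x + power_sum m 1 x \<partial>law) = 0"
    using loop_equation_quadratic[of "\<lambda>t. t" "\<lambda>_. 1" 0 1 0 0]
    by (simp add: poly_bounded_intros del: One_nat_def)
  also have "(\<lambda>x. loop_op 0 x * power_sum m 1 x + power_sum m 1 x) =
      (\<lambda>x. (s + 1) * power_sum m 1 x - (power_sum m 1 x)\<^sup>2 / 2)"
    unfolding loop_op_0 by (simp add: fun_eq_iff algebra_simps power2_eq_square)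
  finally show ?thesis
    by (simp add: integral_p1 power2_eq_square[of s] algebra_simps del: One_nat_def)
qed

lemma integral_p1_p2: "(\<integral>x. power_sum m 1 x * power_sum m 2 x \<partial>law) = 4 * \<kappa> * s * (s + 2)"
proof -
  have "(\<integral>x. loop_op 0 x * power_sum m 2 x + 2 * power_sum m 2 x \<partial>law) = 0"
    using loop_equation_quadratic[of "\<lambda>t. t" "\<lambda>_. 1" 1 0 0 0]
    by (simp add: poly_bounded_intros numeral_2_eq_2 del: One_nat_def)
  also have "(\<lambda>x. loop_op 0 x * power_sum m 2 x + 2 * power_sum m 2 x) =
      (\<lambda>x. (s + 2) * power_sum m 2 x - (power_sum m 1 x * power_sum m 2 x) / 2)"
    unfolding loop_op_0 by (simp add: fun_eq_iff algebra_simps)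
  finally show ?thesis
    by (simp add: integral_p2 algebra_simps del: One_nat_def)
qed

lemma integral_Y: "(\<integral>x. Y x \<partial>law) = 0"
  unfolding Y_def by (simp add: integral_p1 law.prob_space del: One_nat_def)

lemma integral_Z: "(\<integral>x. Z x \<partial>law) = 0"
  unfolding Z_def by (simp add: integral_p1 integral_p2 law.prob_space del: One_nat_def)

lemma integral_Y_squared: "(\<integral>x. (Y x)\<^sup>2 \<partial>law) = 4 * s"
proof -
  have "(\<lambda>x. (Y x)\<^sup>2) = (\<lambda>x. (power_sum m 1 x)\<^sup>2 - 4 * s * power_sum m 1 x + 4 * s\<^sup>2)"
    by (simp add: Y_def fun_eq_iff power2_eq_square algebra_simps)
  then show ?thesis
    by (simp add: integral_p1 integral_p1_squared law.prob_space power2_eq_square[of s] del: One_nat_def)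
qed

text \<open>\<open>stein_H\<close> with a constant test function, for which the \<open>J\<close>
  term drops out.\<close>

lemma integral_H: "(\<integral>x. H x \<partial>law) = 4 * \<beta> * s\<^sup>2 + 4 * (1 - \<beta> / 2) * \<kappa> * s + 4 * \<beta> * s"
proof -
  have "(\<integral>x. R x \<partial>law) = 6 * (1 - \<beta> / 2) * \<kappa> * s + 6 * \<beta> * s"
    unfolding R_def using integrable_stats(2)
    by (simp add: integral_Z integral_p1_squared integral_p2 law.prob_space field_simps del: One_nat_def)
  with stein_H[of "\<lambda>_. 1" "\<lambda>_. 0"] show ?thesis
    by (simp add: poly_bounded_const law.prob_space)
qed

text \<open>The third and fourth moments separately produce terms of order \<kappa>^3 s, which may
  exceed the cube of the scale. They cancel in \<open>K\<close>, whose mean is \<kappa> times that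
  of \<open>H\<close> up to lower order.\<close>

lemma integral_K: "(\<integral>x. K x \<partial>law) = (\<kappa> + 4 - 2 * \<beta>) * (\<integral>x. H x \<partial>law) + 8 * \<beta> * \<kappa> * s"
proof -
  have H: "(\<integral>x. H x \<partial>law) = (\<integral>x. power_sum m 3 x \<partial>law) - 2 * \<kappa> * (2 * \<kappa> * s) + \<kappa>\<^sup>2 * (2 * s)"
    unfolding H_def by (simp add: integral_p1 integral_p2 del: One_nat_def)
  have L2: "(\<kappa> / 2 + 1 - \<beta> / 2) * (2 * \<kappa> * s) + \<beta> / 2 * (4 * s\<^sup>2 + 4 * s) - (\<integral>x. power_sum m 3 x \<partial>law) / 2 = 0"
    using integral_loop_op[of 2] unfolding loop_op_2
    by (simp add: integral_p1_squared integral_p2 del: One_nat_def)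
  have L3: "(\<kappa> / 2 + 2 - \<beta>) * (\<integral>x. power_sum m 3 x \<partial>law) + \<beta> * (4 * \<kappa> * s * (s + 2)) - (\<integral>x. power_sum m 4 x \<partial>law) / 2 = 0"
    using integral_loop_op[of 3] unfolding loop_op_3
    by (simp add: integral_p1_p2 del: One_nat_def)
  have K: "(\<integral>x. K x \<partial>law) = (\<integral>x. power_sum m 4 x \<partial>law) - 2 * \<kappa> * (\<integral>x. power_sum m 3 x \<partial>law) + \<kappa>\<^sup>2 * (2 * \<kappa> * s)"
    unfolding K_def by (simp add: integral_p2 del: One_nat_def)
  define P3 where "P3 = (\<integral>x. power_sum m 3 x \<partial>law)"
  define P4 where "P4 = (\<integral>x. power_sum m 4 x \<partial>law)"
  have P3: "P3 = 2 * ((\<kappa> / 2 + 1 - \<beta> / 2) * (2 * \<kappa> * s) + \<beta> / 2 * (4 * s\<^sup>2 + 4 * s))"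
    using L2 by (simp add: P3_def)
  have P4: "P4 = 2 * ((\<kappa> / 2 + 2 - \<beta>) * P3 + \<beta> * (4 * \<kappa> * s * (s + 2)))"
    using L3 by (simp add: P3_def P4_def)
  show ?thesis
    unfolding H K P3_def[symmetric] P4_def[symmetric] P4 P3
    by (simp add: field_simps power2_eq_square)
qed

text \<open>\<open>stein_Z\<close> with the identity as test function. It also shows that the mean
  of \<open>H\<close> is nonnegative.\<close>

lemma integral_Z_squared: "(\<integral>x. (Z x)\<^sup>2 \<partial>law) = 4 * (\<integral>x. H x \<partial>law)"
  using stein_Z[of "\<lambda>t. t" "\<lambda>_. 1"] by (simp add: poly_bounded_const poly_bounded_stats power2_eq_square)

lemma AE_law_nonneg: "AE x in law. \<forall>i\<in>{1..m}. 0 \<le> x i"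
proof -
  have "0 \<le> x i" if "0 < f x" "i \<in> {1..m}" for x i
    using that f_eq_0[of i x] by fastforce
  moreover have "(\<lambda>x. ennreal (f x)) \<in> borel_measurable (lborel_prod m)" by measurable
  ultimately show ?thesis
    unfolding law_def by (simp only: AE_density) auto
qed

lemma integrable_abs_stats:
  "integrable law (\<lambda>x. \<bar>Y x\<bar>)" "integrable law (\<lambda>x. \<bar>Z x\<bar>)" "integrable law (\<lambda>x. \<bar>J x\<bar>)" "integrable law (\<lambda>x. \<bar>R x\<bar>)"
  using integrable_stats by auto

lemma integrable_squared_stats: "integrable law (\<lambda>x. (Y x)\<^sup>2)" "integrable law (\<lambda>x. (Z x)\<^sup>2)"
  by (intro integrable_law poly_bounded_power poly_bounded_stats, measurable)+

lemma integral_abs_Y: "(\<integral>x. \<bar>Y x\<bar> \<partial>law) \<le> 2 * sqrt s"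
  using law.expectation_abs_le_sqrt[OF integrable_stats(1) integrable_squared_stats(1)]
  by (simp add: integral_Y_squared real_sqrt_mult)

lemma integral_abs_Z: "(\<integral>x. \<bar>Z x\<bar> \<partial>law) \<le> 2 * sqrt (\<integral>x. H x \<partial>law)"
  using law.expectation_abs_le_sqrt[OF integrable_stats(2) integrable_squared_stats(2)]
  by (simp add: integral_Z_squared real_sqrt_mult)

text \<open>Writing p_1^2 - 4 s^2 = Y^2 + 4 s Y reduces the interaction term to the fluctuation of
  p_1, of mean order s sqrt s. The remaining summands carry a factor \<kappa>.\<close>

lemma integral_abs_R:
  "(\<integral>x. \<bar>R x\<bar> \<partial>law) \<le> \<kappa> * sqrt (\<integral>x. H x \<partial>law) + 6 * \<bar>1 - \<beta> / 2\<bar> * \<kappa> * s + 6 * \<beta> * s + 12 * \<beta> * s * sqrt s"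
proof -
  have "(\<integral>x. \<bar>R x\<bar> \<partial>law) \<le> (\<integral>x. \<kappa> / 2 * \<bar>Z x\<bar> + 3 * \<bar>1 - \<beta> / 2\<bar> * power_sum m 2 x
      + (3 * \<beta> / 2 * (Y x)\<^sup>2 + 6 * \<beta> * s * \<bar>Y x\<bar>) \<partial>law)"
  proof (rule integral_mono)
    fix x
    have p2: "0 \<le> power_sum m 2 x" by (auto simp: power_sum_def intro: sum_nonneg)
    have "R x = \<kappa> / 2 * Z x + 3 * (1 - \<beta> / 2) * power_sum m 2 x + (3 * \<beta> / 2 * (Y x)\<^sup>2 + 6 * \<beta> * s * Y x)"
      unfolding R_def Y_def by (simp add: power2_eq_square field_simps)
    also have "\<bar>\<dots>\<bar> \<le> \<bar>\<kappa> / 2 * Z x\<bar> + \<bar>3 * (1 - \<beta> / 2) * power_sum m 2 x\<bar> + (\<bar>3 * \<beta> / 2 * (Y x)\<^sup>2\<bar> + \<bar>6 * \<beta> * s * Y x\<bar>)"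
      by linarith
    also have "\<dots> = \<kappa> / 2 * \<bar>Z x\<bar> + 3 * \<bar>1 - \<beta> / 2\<bar> * power_sum m 2 x
      + (3 * \<beta> / 2 * (Y x)\<^sup>2 + 6 * \<beta> * s * \<bar>Y x\<bar>)"
    proof -
      have "\<bar>3 * (1 - \<beta> / 2) * power_sum m 2 x\<bar> = 3 * \<bar>1 - \<beta> / 2\<bar> * power_sum m 2 x"
        by (simp only: abs_mult abs_of_nonneg[OF p2] abs_numeral)
      then show ?thesis
        using \<kappa>_pos \<beta>_pos s_pos by (simp add: abs_mult)
    qed
    finally show "\<bar>R x\<bar> \<le> \<dots>" .
  qed (use integrable_abs_stats integrable_squared_stats in simp_all)
  also have "\<dots> = \<kappa> / 2 * (\<integral>x. \<bar>Z x\<bar> \<partial>law) + 3 * \<bar>1 - \<beta> / 2\<bar> * (2 * \<kappa> * s)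
      + (3 * \<beta> / 2 * (4 * s) + 6 * \<beta> * s * (\<integral>x. \<bar>Y x\<bar> \<partial>law))"
    using integrable_abs_stats integrable_squared_stats
    by (simp add: integral_p2 integral_Y_squared)
  also have "\<dots> \<le> \<kappa> / 2 * (2 * sqrt (\<integral>x. H x \<partial>law)) + 3 * \<bar>1 - \<beta> / 2\<bar> * (2 * \<kappa> * s)
      + (3 * \<beta> / 2 * (4 * s) + 6 * \<beta> * s * (2 * sqrt s))"
    using \<kappa>_pos \<beta>_pos s_pos
    by (intro add_mono mult_left_mono order.refl integral_abs_Z integral_abs_Y) auto
  also have "\<dots> = \<kappa> * sqrt (\<integral>x. H x \<partial>law) + 6 * \<bar>1 - \<beta> / 2\<bar> * \<kappa> * s + 6 * \<beta> * s + 12 * \<beta> * s * sqrt s"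
    by simp
  finally show ?thesis .
qed

lemma H_nonneg_law: "0 \<le> (\<integral>x. H x \<partial>law)"
proof -
  have "0 \<le> (\<integral>x. (Z x)\<^sup>2 \<partial>law)" by simp
  then show ?thesis unfolding integral_Z_squared by simp
qed

text \<open>On the support |3 x - \<kappa>| \<le> 3 x + \<kappa>, so |J| \<le> 3 K + \<kappa> H,
  whose mean is known exactly. The stated constant discards -6 \<beta> times the nonnegative mean of
  \<open>H\<close>.\<close>

lemma integral_abs_J:
  "(\<integral>x. \<bar>J x\<bar> \<partial>law) \<le> (4 * \<kappa> + 12) * (\<integral>x. H x \<partial>law) + 24 * \<beta> * \<kappa> * s"
proof -
  have "(\<integral>x. \<bar>J x\<bar> \<partial>law) \<le> (\<integral>x. 3 * K x + \<kappa> * H x \<partial>law)"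
  proof (rule integral_mono_AE)
    show "AE x in law. \<bar>J x\<bar> \<le> 3 * K x + \<kappa> * H x"
      using AE_law_nonneg
    proof eventually_elim
      case (elim x)
      have J: "J x = (\<Sum>i = 1..m. x i * (x i - \<kappa>)\<^sup>2 * (3 * x i - \<kappa>))"
        unfolding J_def power_sum_def sum_distrib_left sum.distrib[symmetric] sum_subtractf[symmetric]
        by (intro sum.cong refl) (simp add: algebra_simps eval_nat_numeral)
      have KH: "3 * K x + \<kappa> * H x = (\<Sum>i = 1..m. x i * (x i - \<kappa>)\<^sup>2 * (3 * x i + \<kappa>))"
        unfolding K_def H_def power_sum_def distrib_left right_diff_distrib sum_distrib_left
          sum.distrib[symmetric] sum_subtractf[symmetric]
        by (intro sum.cong refl) (simp add: algebra_simps eval_nat_numeral)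
      have "\<bar>J x\<bar> \<le> (\<Sum>i = 1..m. \<bar>x i * (x i - \<kappa>)\<^sup>2 * (3 * x i - \<kappa>)\<bar>)"
        unfolding J by (rule sum_abs)
      also have "\<dots> \<le> 3 * K x + \<kappa> * H x"
        unfolding KH
      proof (rule sum_mono)
        fix i assume "i \<in> {1..m}"
        then have "0 \<le> x i" using elim by simp
        then show "\<bar>x i * (x i - \<kappa>)\<^sup>2 * (3 * x i - \<kappa>)\<bar> \<le> x i * (x i - \<kappa>)\<^sup>2 * (3 * x i + \<kappa>)"
          using \<kappa>_pos by (auto simp: abs_mult intro!: mult_left_mono)
      qed
      finally show ?case .
    qed
  qed (use integrable_abs_stats integrable_stats in simp_all)
  also have "\<dots> = 3 * (\<integral>x. K x \<partial>law) + \<kappa> * (\<integral>x. H x \<partial>law)"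
    using integrable_stats by simp
  also have "\<dots> \<le> (4 * \<kappa> + 12) * (\<integral>x. H x \<partial>law) + 24 * \<beta> * \<kappa> * s"
    unfolding integral_K using \<beta>_pos mult_nonneg_nonneg[OF less_imp_le[OF \<beta>_pos] H_nonneg_law]
    by (simp add: algebra_simps)
  finally show ?thesis .
qed

section \<open>The characteristic function of Z through a differential equation\<close>

text \<open>The phase \<open>\<delta>\<close> covers the real and the imaginary part of the characteristic function at once.\<close>

definition char_phase :: "real \<Rightarrow> real \<Rightarrow> real" where
  "char_phase \<delta> \<theta> = (\<integral>x. cos (\<theta> * Z x + \<delta>) \<partial>law)"

lemma poly_bounded_cos_sin: "poly_bounded m (\<lambda>x. cos (g x))" "poly_bounded m (\<lambda>x. sin (g x))"
  by (rule poly_bounded_bounded[of _ 1], simp)+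

text \<open>By the quadratic remainder of the cosine, the difference quotient is within |h| E[Z^2]
  of the claimed derivative.\<close>

lemma has_derivative_char_phase:
  "(char_phase \<delta> has_real_derivative - (\<integral>x. Z x * sin (\<theta> * Z x + \<delta>) \<partial>law)) (at \<theta>)"
proof -
  define D where "D = - (\<integral>x. Z x * sin (\<theta> * Z x + \<delta>) \<partial>law)"
  have ic: "integrable law (\<lambda>x. cos (t * Z x + \<delta>))" for t
    by (intro integrable_law poly_bounded_cos_sin) measurable
  have isin: "integrable law (\<lambda>x. Z x * sin (\<theta> * Z x + \<delta>))"
    by (intro integrable_law poly_bounded_mult poly_bounded_stats poly_bounded_cos_sin) measurable
  define V where "V = (\<integral>x. (Z x)\<^sup>2 \<partial>law)"
  have bound: "\<bar>char_phase \<delta> (\<theta> + h) - char_phase \<delta> \<theta> - h * D\<bar> \<le> h\<^sup>2 * V" for h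
  proof -
    have eq: "char_phase \<delta> (\<theta> + h) - char_phase \<delta> \<theta> - h * D =
        (\<integral>x. cos ((\<theta> + h) * Z x + \<delta>) - cos (\<theta> * Z x + \<delta>) + h * (Z x * sin (\<theta> * Z x + \<delta>)) \<partial>law)"
      using integral_linear_combination[OF ic[of "\<theta> + h"] ic[of \<theta>] isin, of 1 "-1" h]
      unfolding char_phase_def D_def by (simp only: mult_1 mult_minus1 mult_minus_right diff_minus_eq_add
        minus_minus add_uminus_conv_diff)
    have "\<bar>\<integral>x. cos ((\<theta> + h) * Z x + \<delta>) - cos (\<theta> * Z x + \<delta>) + h * (Z x * sin (\<theta> * Z x + \<delta>)) \<partial>law\<bar>
        \<le> (\<integral>x. h\<^sup>2 * (Z x)\<^sup>2 \<partial>law)"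
    proof (rule abs_integral_le)
      show "integrable law (\<lambda>x. cos ((\<theta> + h) * Z x + \<delta>) - cos (\<theta> * Z x + \<delta>) + h * (Z x * sin (\<theta> * Z x + \<delta>)))"
        by (rule Bochner_Integration.integrable_add[OF Bochner_Integration.integrable_diff[OF ic ic]
          integrable_mult_right[OF isin]])
      show "integrable law (\<lambda>x. h\<^sup>2 * (Z x)\<^sup>2)"
        by (rule integrable_mult_right[OF integrable_squared_stats(2)])
      fix x
      have "(\<theta> + h) * Z x + \<delta> = (\<theta> * Z x + \<delta>) + h * Z x"
        by (simp add: distrib_right)
      then show "\<bar>cos ((\<theta> + h) * Z x + \<delta>) - cos (\<theta> * Z x + \<delta>) + h * (Z x * sin (\<theta> * Z x + \<delta>))\<bar> \<le> h\<^sup>2 * (Z x)\<^sup>2"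
        using cos_shift_approx[of "\<theta> * Z x + \<delta>" "h * Z x"]
        by (simp only: power_mult_distrib mult.assoc)
    qed
    then show ?thesis unfolding eq V_def integral_mult_right_zero .
  qed
  have "((\<lambda>h. (char_phase \<delta> (\<theta> + h) - char_phase \<delta> \<theta>) / h - D) \<longlongrightarrow> 0) (at 0)"
  proof (rule Lim_null_comparison)
    show "\<forall>\<^sub>F h in at 0. norm ((char_phase \<delta> (\<theta> + h) - char_phase \<delta> \<theta>) / h - D) \<le> \<bar>h\<bar> * V"
      unfolding eventually_at
    proof (intro exI[of _ 1] conjI ballI impI)
      fix h :: real assume h: "h \<noteq> 0 \<and> dist h 0 < 1"
      then have "(char_phase \<delta> (\<theta> + h) - char_phase \<delta> \<theta>) / h - D =
          (char_phase \<delta> (\<theta> + h) - char_phase \<delta> \<theta> - h * D) / h"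
        by (simp add: diff_divide_distrib)
      also have "norm \<dots> \<le> h\<^sup>2 * V / \<bar>h\<bar>"
        using bound[of h] by (simp add: divide_right_mono)
      also have "\<dots> = \<bar>h\<bar> * V"
        by (subst power2_abs[symmetric]) (use h in \<open>simp add: power2_eq_square del: abs_mult_self_eq\<close>)
      finally show "norm ((char_phase \<delta> (\<theta> + h) - char_phase \<delta> \<theta>) / h - D) \<le> \<bar>h\<bar> * V" .
    qed simp
    have "((\<lambda>h. \<bar>h\<bar> * V) \<longlongrightarrow> \<bar>0\<bar> * V) (at 0)"
      by (intro tendsto_intros)
    then show "((\<lambda>h. \<bar>h\<bar> * V) \<longlongrightarrow> 0) (at 0)" by simp
  qed
  from LIM_zero_cancel[OF this] show ?thesis
    unfolding DERIV_def D_def .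
qed

text \<open>The Stein identities give the equation y' = - V t y - 4 t e with V = 16 \<beta> s^2 and
  y(0) = cos \<delta>. The integrating factor exp(V t^2 / 2) leaves a derivative consisting of error
  alone, to which the mean value bound applies.\<close>

lemma char_phase_bound:
  "\<bar>char_phase \<delta> \<theta> - cos \<delta> * exp (- 8 * \<beta> * s\<^sup>2 * \<theta>\<^sup>2)\<bar> \<le>
     4 * \<theta>\<^sup>2 * (2 / 3 * (\<integral>x. \<bar>R x\<bar> \<partial>law) + 4 / 3 * \<bar>\<theta>\<bar> * (\<integral>x. \<bar>J x\<bar> \<partial>law))"
proof -
  define V where "V = 16 * \<beta> * s\<^sup>2"
  have V: "V \<ge> 0" using \<beta>_pos by (simp add: V_def)
  define B where "B \<theta> = 2 / 3 * (\<integral>x. \<bar>R x\<bar> \<partial>law) + 4 / 3 * \<bar>\<theta>\<bar> * (\<integral>x. \<bar>J x\<bar> \<partial>law)" for \<theta>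
  define e where "e t = 2 / 3 * (\<integral>x. R x * cos (t * Z x + \<delta>) \<partial>law) - 4 / 3 * t * (\<integral>x. J x * sin (t * Z x + \<delta>) \<partial>law)" for t
  have B0: "0 \<le> B t" for t by (simp add: B_def)
  have Bmono: "B t \<le> B u" if "\<bar>t\<bar> \<le> \<bar>u\<bar>" for t u
    unfolding B_def using that by (intro add_mono mult_right_mono mult_left_mono) auto
  have e: "\<bar>e t\<bar> \<le> B t" for t
  proof -
    have "\<bar>\<integral>x. R x * cos (t * Z x + \<delta>) \<partial>law\<bar> \<le> (\<integral>x. \<bar>R x\<bar> \<partial>law)"
    proof (rule abs_integral_le)
      show "integrable law (\<lambda>x. R x * cos (t * Z x + \<delta>))"
        by (intro integrable_law poly_bounded_mult poly_bounded_stats poly_bounded_cos_sin) measurable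
      show "\<bar>R x * cos (t * Z x + \<delta>)\<bar> \<le> \<bar>R x\<bar>" for x
        unfolding abs_mult by (rule mult_left_le) auto
    qed (rule integrable_abs_stats)
    moreover have "\<bar>\<integral>x. J x * sin (t * Z x + \<delta>) \<partial>law\<bar> \<le> (\<integral>x. \<bar>J x\<bar> \<partial>law)"
    proof (rule abs_integral_le)
      show "integrable law (\<lambda>x. J x * sin (t * Z x + \<delta>))"
        by (intro integrable_law poly_bounded_mult poly_bounded_stats poly_bounded_cos_sin) measurable
      show "\<bar>J x * sin (t * Z x + \<delta>)\<bar> \<le> \<bar>J x\<bar>" for x
        unfolding abs_mult by (rule mult_left_le) auto
    qed (rule integrable_abs_stats)
    ultimately have "2 / 3 * \<bar>\<integral>x. R x * cos (t * Z x + \<delta>) \<partial>law\<bar> + 4 / 3 * \<bar>t\<bar> * \<bar>\<integral>x. J x * sin (t * Z x + \<delta>) \<partial>law\<bar> \<le> B t"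
      unfolding B_def by (intro add_mono mult_left_mono) auto
    moreover have "\<bar>e t\<bar> \<le> 2 / 3 * \<bar>\<integral>x. R x * cos (t * Z x + \<delta>) \<partial>law\<bar> + 4 / 3 * \<bar>t\<bar> * \<bar>\<integral>x. J x * sin (t * Z x + \<delta>) \<partial>law\<bar>"
      unfolding e_def by (rule abs_triangle_ineq4[THEN order.trans]) (simp add: abs_mult)
    ultimately show ?thesis by linarith
  qed
  have deriv: "(char_phase \<delta> has_real_derivative - V * t * char_phase \<delta> t - 4 * t * e t) (at t)" for t
  proof -
    \<comment> \<open>The equation closes: \<open>stein_Z\<close> turns Z times the sine into H
      times the cosine, and \<open>stein_H\<close> turns this back into the cosine itself.\<close>
    have "(\<integral>x. Z x * sin (t * Z x + \<delta>) \<partial>law) = 4 * (\<integral>x. H x * (t * cos (t * Z x + \<delta>)) \<partial>law)"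
      by (rule stein_Z) (auto intro!: derivative_eq_intros poly_bounded_mult poly_bounded_const poly_bounded_cos_sin)
    also have "(\<integral>x. H x * (t * cos (t * Z x + \<delta>)) \<partial>law) = t * (\<integral>x. H x * cos (t * Z x + \<delta>) \<partial>law)"
      by (subst integral_mult_right_zero[symmetric]) (simp add: mult_ac)
    also have "(\<integral>x. H x * cos (t * Z x + \<delta>) \<partial>law) = 4 * \<beta> * s\<^sup>2 * (\<integral>x. cos (t * Z x + \<delta>) \<partial>law) +
        2 / 3 * (\<integral>x. R x * cos (t * Z x + \<delta>) \<partial>law) + 4 / 3 * (\<integral>x. J x * (- t * sin (t * Z x + \<delta>)) \<partial>law)"
      by (rule stein_H) (auto intro!: derivative_eq_intros poly_bounded_mult poly_bounded_uminus poly_bounded_const poly_bounded_cos_sin)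
    also have "(\<integral>x. J x * (- t * sin (t * Z x + \<delta>)) \<partial>law) = - t * (\<integral>x. J x * sin (t * Z x + \<delta>) \<partial>law)"
      by (subst integral_mult_right_zero[symmetric]) (simp add: mult_ac)
    finally have "- (\<integral>x. Z x * sin (t * Z x + \<delta>) \<partial>law) = - V * t * char_phase \<delta> t - 4 * t * e t"
      by (simp add: V_def e_def char_phase_def algebra_simps)
    then show ?thesis
      using has_derivative_char_phase[of \<delta> t] by simp
  qed
  define F where "F t = char_phase \<delta> t * exp (V * t\<^sup>2 / 2)" for t
  have dF: "(F has_real_derivative - 4 * t * e t * exp (V * t\<^sup>2 / 2)) (at t)" for t
  proof -
    have "((\<lambda>t. exp (V * t\<^sup>2 / 2)) has_real_derivative V * t * exp (V * t\<^sup>2 / 2)) (at t)"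
      by (auto intro!: derivative_eq_intros)
    from DERIV_mult[OF deriv this] show ?thesis
      unfolding F_def by (simp add: algebra_simps)
  qed
  have *: "4 * \<bar>\<theta>\<bar> * B \<theta> * E * norm (\<theta> - 0) = 4 * \<theta>\<^sup>2 * B \<theta> * E" for E
  proof -
    have "4 * \<bar>\<theta>\<bar> * B \<theta> * E * norm (\<theta> - 0) = 4 * (\<bar>\<theta>\<bar> * \<bar>\<theta>\<bar>) * B \<theta> * E"
      by (simp only: diff_0_right real_norm_def mult_ac)
    also have "\<bar>\<theta>\<bar> * \<bar>\<theta>\<bar> = \<theta>\<^sup>2"
      by (simp add: power2_eq_square)
    finally show ?thesis .
  qed
  \<comment> \<open>On the interval between -|\<theta>| and |\<theta>| the integrating factor is
    largest at the ends, so the later division by its value at \<theta> cancels it exactly.\<close>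
  have "norm (F \<theta> - F 0) \<le> (4 * \<bar>\<theta>\<bar> * B \<theta> * exp (V * \<theta>\<^sup>2 / 2)) * norm (\<theta> - 0)"
  proof (rule field_differentiable_bound)
    show "convex {- \<bar>\<theta>\<bar>..\<bar>\<theta>\<bar>}" by simp
    show "(F has_field_derivative - 4 * t * e t * exp (V * t\<^sup>2 / 2)) (at t within {- \<bar>\<theta>\<bar>..\<bar>\<theta>\<bar>})" for t
      using dF by (rule has_field_derivative_at_within)
    fix t assume "t \<in> {- \<bar>\<theta>\<bar>..\<bar>\<theta>\<bar>}"
    then have t: "\<bar>t\<bar> \<le> \<bar>\<theta>\<bar>" by auto
    then have "t\<^sup>2 \<le> \<theta>\<^sup>2" by (simp add: abs_le_square_iff)
    have "norm (- 4 * t * e t * exp (V * t\<^sup>2 / 2)) = 4 * \<bar>t\<bar> * \<bar>e t\<bar> * exp (V * t\<^sup>2 / 2)"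
      by (simp add: abs_mult)
    also have "\<dots> \<le> 4 * \<bar>\<theta>\<bar> * B \<theta> * exp (V * \<theta>\<^sup>2 / 2)"
      using t e[of t] Bmono[OF t] B0 \<open>t\<^sup>2 \<le> \<theta>\<^sup>2\<close> V
      by (intro mult_mono) (auto intro: mult_left_mono)
    finally show "norm (- 4 * t * e t * exp (V * t\<^sup>2 / 2)) \<le> 4 * \<bar>\<theta>\<bar> * B \<theta> * exp (V * \<theta>\<^sup>2 / 2)" .
  qed auto
  moreover have "F 0 = cos \<delta>" by (simp add: F_def char_phase_def law.prob_space)
  ultimately have "\<bar>F \<theta> - cos \<delta>\<bar> \<le> 4 * \<theta>\<^sup>2 * B \<theta> * exp (V * \<theta>\<^sup>2 / 2)"
    by (simp only: *[unfolded real_norm_def] real_norm_def)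
  then have "\<bar>F \<theta> - cos \<delta>\<bar> * exp (- (V * \<theta>\<^sup>2 / 2)) \<le> 4 * \<theta>\<^sup>2 * B \<theta> * exp (V * \<theta>\<^sup>2 / 2) * exp (- (V * \<theta>\<^sup>2 / 2))"
    by (rule mult_right_mono) simp
  also have "\<dots> = 4 * \<theta>\<^sup>2 * B \<theta>" by (simp add: exp_minus)
  also have "\<bar>F \<theta> - cos \<delta>\<bar> * exp (- (V * \<theta>\<^sup>2 / 2)) = \<bar>(F \<theta> - cos \<delta>) * exp (- (V * \<theta>\<^sup>2 / 2))\<bar>"
    by (simp add: abs_mult)
  also have "(F \<theta> - cos \<delta>) * exp (- (V * \<theta>\<^sup>2 / 2)) = char_phase \<delta> \<theta> - cos \<delta> * exp (- 8 * \<beta> * s\<^sup>2 * \<theta>\<^sup>2)"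
    by (simp add: F_def V_def exp_minus field_simps)
  finally show ?thesis by (simp add: B_def)
qed

end

section \<open>The statistic U and its characteristic function\<close>

context laguerre_law
begin

definition coeff_Y :: "real \<Rightarrow> real" where "coeff_Y a2 = (laguerre_r \<beta> m)\<^sup>2 / (2 * a2\<^sup>2)"
definition coeff_Z :: "real \<Rightarrow> real" where "coeff_Z a2 = (a2 - laguerre_r \<beta> m) / (8 * a2\<^sup>2)"

text \<open>The sum of squares equals Z + 4 r Y + 4 r s. Its \<open>Y\<close> part enters with
  weight - (a2 - r) r / (2 a2^2), which the linear term of U cancels up to r^2 / (2 a2^2); its
  constant part is the centering.\<close>

lemma U_stat_eq:
  assumes "a2 \<noteq> 0"
  shows "U_stat \<beta> m a1 a2 x = coeff_Y a2 * Y x - coeff_Z a2 * Z x - U_centering \<beta> m a1 a2"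
proof -
  have 1: "(\<Sum>i = 1..m. (x i - 2 * a1)) = Y x"
    by (simp add: Y_def power_sum_def s_def sum_subtractf)
  have "(\<Sum>i = 1..m. (x i - 2 * a1)\<^sup>2) = (\<Sum>i = 1..m. x i ^ 2 - 4 * a1 * x i ^ 1 + 4 * a1\<^sup>2)"
    by (intro sum.cong refl) (simp add: power2_eq_square algebra_simps)
  also have "\<dots> = power_sum m 2 x - 4 * a1 * power_sum m 1 x + 4 * a1\<^sup>2 * real m"
    by (simp only: power_sum_def sum.distrib sum_subtractf sum_distrib_left) simp
  also have "\<dots> = Z x + 4 * laguerre_r \<beta> m * Y x + 4 * laguerre_r \<beta> m * s"
    by (simp add: Z_def Y_def \<kappa>_def s_def power2_eq_square algebra_simps)
  finally have 2: "(\<Sum>i = 1..m. (x i - 2 * a1)\<^sup>2) = \<dots>" .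
  show ?thesis
    unfolding U_stat_def U_centering_def coeff_Y_def coeff_Z_def 1 2 s_def
    using assms by (simp add: field_simps power2_eq_square)
qed

text \<open>\<open>Y\<close> and \<open>Z\<close> have mean 0, so the decomposition displays the
  mean of U exactly.\<close>

lemma
  assumes "a2 \<noteq> 0"
  shows integrable_U_stat: "integrable law (U_stat \<beta> m a1 a2)"
    and integral_U_stat: "(\<integral>x. U_stat \<beta> m a1 a2 x \<partial>law) = - U_centering \<beta> m a1 a2"
proof -
  have eq: "U_stat \<beta> m a1 a2 = (\<lambda>x. coeff_Y a2 * Y x - coeff_Z a2 * Z x - U_centering \<beta> m a1 a2)"
    using U_stat_eq[OF assms] by blast
  show "integrable law (U_stat \<beta> m a1 a2)"
    "(\<integral>x. U_stat \<beta> m a1 a2 x \<partial>law) = - U_centering \<beta> m a1 a2"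
    unfolding eq using integrable_stats
    by (simp_all add: integral_Y integral_Z law.prob_space)
qed

lemma U_stat_measurable [measurable]: "U_stat \<beta> m a1 a2 \<in> borel_measurable (lborel_prod m)"
  unfolding U_stat_def[abs_def]
  by (intro borel_measurable_diff borel_measurable_times borel_measurable_sum borel_measurable_power
    borel_measurable_const component_measurable)

definition mean_H :: real where
  "mean_H = 4 * \<beta> * s\<^sup>2 + 4 * (1 - \<beta> / 2) * \<kappa> * s + 4 * \<beta> * s"
definition bound_R :: real where
  "bound_R = \<kappa> * sqrt mean_H + 6 * \<bar>1 - \<beta> / 2\<bar> * \<kappa> * s + 6 * \<beta> * s + 12 * \<beta> * s * sqrt s"
definition bound_J :: real where
  "bound_J = (4 * \<kappa> + 12) * mean_H + 24 * \<beta> * \<kappa> * s"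

lemma integrable_iexp:
  assumes "g \<in> borel_measurable (lborel_prod m)"
  shows "integrable law (\<lambda>x. iexp (g x))"
  using assms by (intro law.integrable_const_bound[where B = 1]) (auto simp: measurable_law_iff)

text \<open>Discarding \<open>Y\<close> costs |t| \<open>coeff_Y a2\<close> E|Y|, since v \<mapsto>
  exp(iv) is 1-Lipschitz. The bound on \<open>char_phase\<close> is used for the real and for the
  imaginary part, which doubles its constant 4 to 8.\<close>

lemma char_U_stat_bound:
  assumes "a2 \<noteq> 0"
  defines "b \<equiv> coeff_Z a2"
  shows "cmod (char (distr law borel (\<lambda>x. U_stat \<beta> m a1 a2 x + U_centering \<beta> m a1 a2)) t
      - of_real (exp (- 8 * \<beta> * s\<^sup>2 * (t * b)\<^sup>2)))
    \<le> \<bar>t\<bar> * coeff_Y a2 * (2 * sqrt s) + 8 * (t * b)\<^sup>2 * (2 / 3 * bound_R + 4 / 3 * \<bar>t * b\<bar> * bound_J)"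
proof -
  \<comment> \<open>\<open>Z\<close> enters U with the negative coefficient -b.\<close>
  define \<theta> where "\<theta> = - t * b"
  define W where "W x = coeff_Y a2 * Y x - b * Z x" for x
  have [measurable]: "W \<in> borel_measurable (lborel_prod m)" unfolding W_def by measurable
  have W: "(\<lambda>x. U_stat \<beta> m a1 a2 x + U_centering \<beta> m a1 a2) = W"
    using U_stat_eq[OF assms(1)] by (simp add: W_def b_def fun_eq_iff)
  have Wlaw: "W \<in> law \<rightarrow>\<^sub>M borel" unfolding measurable_law_iff by measurable
  have char_W: "char (distr law borel W) t = (CLINT x|law. iexp (t * W x))"
    unfolding char_def using Wlaw by (subst integral_distr) auto
  have c0: "0 \<le> coeff_Y a2" by (simp add: coeff_Y_def)
  have int: "integrable law (\<lambda>x. iexp (t * W x))" "integrable law (\<lambda>x. iexp (\<theta> * Z x))"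
    by (rule integrable_iexp, measurable)+
  have "cmod ((CLINT x|law. iexp (t * W x)) - (CLINT x|law. iexp (\<theta> * Z x)))
      = cmod (CLINT x|law. iexp (t * W x) - iexp (\<theta> * Z x))"
    using int by simp
  also have "\<dots> \<le> (\<integral>x. \<bar>t\<bar> * coeff_Y a2 * \<bar>Y x\<bar> \<partial>law)"
  proof (rule norm_integral_le)
    fix x
    have "iexp (t * W x) - iexp (\<theta> * Z x) = iexp (\<theta> * Z x) * (iexp (t * coeff_Y a2 * Y x) - 1)"
      by (simp add: W_def \<theta>_def algebra_simps flip: exp_add)
    then have "cmod (iexp (t * W x) - iexp (\<theta> * Z x)) = cmod (iexp (t * coeff_Y a2 * Y x) - 1)"
      by (simp add: norm_mult)
    also have "\<dots> \<le> \<bar>t * coeff_Y a2 * Y x\<bar>"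
      using iexp_approx1[of "t * coeff_Y a2 * Y x" 0] by simp
    finally show "cmod (iexp (t * W x) - iexp (\<theta> * Z x)) \<le> \<bar>t\<bar> * coeff_Y a2 * \<bar>Y x\<bar>"
      using c0 by (simp add: abs_mult)
  qed (use int integrable_abs_stats in auto)
  also have "\<dots> = \<bar>t\<bar> * coeff_Y a2 * (\<integral>x. \<bar>Y x\<bar> \<partial>law)" by simp
  also have "\<dots> \<le> \<bar>t\<bar> * coeff_Y a2 * (2 * sqrt s)"
    using c0 by (intro mult_left_mono integral_abs_Y) auto
  finally have part1: "cmod ((CLINT x|law. iexp (t * W x)) - (CLINT x|law. iexp (\<theta> * Z x))) \<le>
      \<bar>t\<bar> * coeff_Y a2 * (2 * sqrt s)" .
  define E where "E = 4 * \<theta>\<^sup>2 * (2 / 3 * bound_R + 4 / 3 * \<bar>\<theta>\<bar> * bound_J)"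
  have cp: "\<bar>char_phase \<delta> \<theta> - cos \<delta> * exp (- 8 * \<beta> * s\<^sup>2 * \<theta>\<^sup>2)\<bar> \<le> E" for \<delta>
    unfolding E_def
    by (rule order.trans[OF char_phase_bound], intro mult_left_mono add_mono)
       (use integral_abs_R integral_abs_J in \<open>simp_all add: bound_R_def bound_J_def mean_H_def integral_H\<close>)
  define I where "I = (CLINT x|law. iexp (\<theta> * Z x))"
  have Re: "Re I = char_phase 0 \<theta>"
    using int(2) by (simp add: I_def char_phase_def Re_exp flip: integral_Re)
  \<comment> \<open>The shift by - \<pi>/2 turns the cosine into the sine, and cos (- \<pi>/2) = 0
    matches the vanishing imaginary part of the Gaussian.\<close>
  have Im: "Im I = char_phase (- (pi / 2)) \<theta>"
    using int(2) by (simp add: I_def char_phase_def Im_exp cos_diff flip: integral_Im)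
  have "cmod (I - of_real (exp (- 8 * \<beta> * s\<^sup>2 * \<theta>\<^sup>2)))
      \<le> \<bar>Re (I - of_real (exp (- 8 * \<beta> * s\<^sup>2 * \<theta>\<^sup>2)))\<bar> +
        \<bar>Im (I - of_real (exp (- 8 * \<beta> * s\<^sup>2 * \<theta>\<^sup>2)))\<bar>"
    by (rule cmod_le)
  also have "\<dots> \<le> E + E"
    using cp[of 0] cp[of "- (pi / 2)"] by (intro add_mono) (simp_all add: Re Im)
  finally have "cmod (I - of_real (exp (- 8 * \<beta> * s\<^sup>2 * \<theta>\<^sup>2))) \<le> E + E" .
  with part1[folded I_def] have "cmod ((CLINT x|law. iexp (t * W x)) - of_real (exp (- 8 * \<beta> * s\<^sup>2 * \<theta>\<^sup>2)))
      \<le> \<bar>t\<bar> * coeff_Y a2 * (2 * sqrt s) + (E + E)"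
    by (rule norm_diff_triangle_le)
  moreover have "\<theta>\<^sup>2 = (t * b)\<^sup>2" "\<bar>\<theta>\<bar> = \<bar>t * b\<bar>"
    by (simp_all add: \<theta>_def power2_eq_square)
  ultimately show ?thesis
    unfolding W char_W E_def by (simp add: algebra_simps)
qed

end

section \<open>Transfer to the given ensembles and passage to the limit\<close>

lemma laguerre_law_ensemble:
  assumes "\<beta> > 0" "m \<ge> 1" "a1 > \<beta> / 2 * (real m - 1)" "laguerre_ensemble \<beta> m a1 M \<mu>"
  shows "laguerre_law \<beta> m a1"
    and "laguerre_law.law \<beta> m a1 = distr M (lborel_prod m) \<mu>"
    and "\<mu> \<in> M \<rightarrow>\<^sub>M lborel_prod m"
proof -
  have M: "prob_space M" "distributed M (lborel_prod m) \<mu> (\<lambda>x. ennreal (laguerre_density \<beta> m a1 x))"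
    using assms(4) by (auto simp: laguerre_ensemble_def)
  have eq: "distr M (lborel_prod m) \<mu> = density (lborel_prod m) (\<lambda>x. ennreal (laguerre_density \<beta> m a1 x))"
    by (rule distributed_distr_eq_density[OF M(2)])
  show meas: "\<mu> \<in> M \<rightarrow>\<^sub>M lborel_prod m"
    by (rule distributed_measurable[OF M(2)])
  have "prob_space (distr M (lborel_prod m) \<mu>)"
    by (rule prob_space.prob_space_distr[OF M(1) meas])
  then show law: "laguerre_law \<beta> m a1"
    using assms unfolding eq by (intro laguerre_law.intro)
  show "laguerre_law.law \<beta> m a1 = distr M (lborel_prod m) \<mu>"
    unfolding laguerre_law.law_def[OF law] eq ..
qed

lemma real_distribution_normal:
  "v > 0 \<Longrightarrow> real_distribution (normal_distribution 0 v)"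
  unfolding normal_distribution_def
  by (intro real_distribution.intro prob_space_normal_density real_distribution_axioms.intro) auto

lemma char_normal_distribution:
  assumes v: "v > 0"
  shows "char (normal_distribution 0 v) t = of_real (exp (- (v * t\<^sup>2) / 2))"
proof -
  interpret std: real_distribution std_normal_distribution
    by (rule real_dist_normal_dist)
  have "distributed std_normal_distribution lborel (\<lambda>x. x) (normal_density 0 1)"
    unfolding distributed_def by (auto simp: distr_id2)
  from std.normal_density_affine[OF this, of "sqrt v" 0]
  have "distributed std_normal_distribution lborel (\<lambda>x. sqrt v * x) (normal_density 0 (sqrt v))"
    using v by simp
  from distributed_distr_eq_density[OF this]
  have eq: "normal_distribution 0 v = distr std_normal_distribution lborel (\<lambda>x. sqrt v * x)"
    by (simp add: normal_distribution_def)
  have "char (normal_distribution 0 v) t = (CLINT x|std_normal_distribution. iexp (t * (sqrt v * x)))"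
    unfolding char_def eq by (subst integral_distr) auto
  also have "\<dots> = char std_normal_distribution (t * sqrt v)"
    by (simp add: char_def mult.assoc)
  also have "\<dots> = of_real (exp (- (v * t\<^sup>2) / 2))"
    using v by (simp add: char_std_normal_distribution power_mult_distrib mult.commute)
  finally show ?thesis .
qed

text \<open>Levy's theorem concerns sequences, so the real parameter is tested along every sequence
  tending to infinity.\<close>

lemma weak_conv_along_at_top:
  assumes distr: "\<And>u. u > c \<Longrightarrow> real_distribution (P u)"
    and Q: "real_distribution Q"
    and char: "\<And>t. ((\<lambda>u. char (P u) t) \<longlongrightarrow> char Q t) at_top"
  shows "weak_conv_along P Q (at_top :: real filter)"
  unfolding weak_conv_along_def
proof (intro allI impI tendsto_at_topI_sequentially)
  fix x and X :: "nat \<Rightarrow> real"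
  assume cont: "isCont (cdf Q) x" and X: "filterlim X at_top sequentially"
  \<comment> \<open>\<open>P\<close> is known to be a probability law only beyond \<open>c\<close>;
    the sequence is shifted by \<open>N\<close> before Levy's theorem and shifted back at the
    end.\<close>
  then obtain N where N: "\<And>n. n \<ge> N \<Longrightarrow> X n > c"
    by (auto simp: filterlim_at_top_dense eventually_sequentially)
  have "weak_conv_m (\<lambda>n. P (X (n + N))) Q"
  proof (rule levy_continuity)
    show "real_distribution (P (X (n + N)))" for n
      by (intro distr N) simp
    show "(\<lambda>n. char (P (X (n + N))) t) \<longlonglongrightarrow> char Q t" for t
      using filterlim_compose[OF char X] by (rule LIMSEQ_ignore_initial_segment)
  qed (rule Q)
  then have "(\<lambda>n. cdf (P (X (n + N))) x) \<longlonglongrightarrow> cdf Q x"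
    using cont by (simp add: weak_conv_m_def weak_conv_def)
  then show "(\<lambda>n. cdf (P (X n)) x) \<longlonglongrightarrow> cdf Q x"
    by (rule LIMSEQ_offset)
qed

text \<open>Both regimes reduce to \<open>m \<rightarrow> \<infinity>\<close>, \<open>m a\<^sub>1 / a\<^sub>2 \<rightarrow> \<sigma>\<close> and a finite limit of \<open>m / a\<^sub>1\<close>.\<close>

lemma regime_limits:
  fixes m a1 :: "real \<Rightarrow> real" and \<beta> \<sigma> \<rho> :: real
  assumes m: "filterlim m at_top at_top"
    and ratio: "((\<lambda>u. m u / a1 u) \<longlongrightarrow> \<rho>) at_top"
    and prod: "((\<lambda>u. m u * a1 u / u) \<longlongrightarrow> \<sigma>) at_top"
    and pos: "\<forall>\<^sub>F u in at_top. a1 u > 0"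
  defines "r \<equiv> \<lambda>u. 1 + \<beta> / 2 * (m u - 1)"
  shows "((\<lambda>u. r u / u) \<longlongrightarrow> 0) at_top"
    and "((\<lambda>u. (r u)\<^sup>2 / u) \<longlongrightarrow> \<beta>\<^sup>2 / 4 * (\<rho> * \<sigma>)) at_top"
    and "((\<lambda>u. 2 * (a1 u + r u) / u) \<longlongrightarrow> 0) at_top"
proof -
  have m_pos: "\<forall>\<^sub>F u in at_top. m u > 0"
    using m by (simp add: filterlim_at_top_dense)
  have u_pos: "\<forall>\<^sub>F u :: real in at_top. u > 0"
    by (rule eventually_gt_at_top)
  have inv_m: "((\<lambda>u. inverse (m u)) \<longlongrightarrow> 0) at_top"
    by (rule tendsto_inverse_0_at_top[OF m])
  have inv_u: "((\<lambda>u::real. inverse u) \<longlongrightarrow> 0) at_top"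
    by (rule tendsto_inverse_0_at_top) (rule filterlim_ident)
  \<comment> \<open>Since m a1 / u stays bounded, the growth of m forces a1 = o(u); the finite limit
    of m / a1 then gives m = o(u) as well.\<close>
  have a1_u: "((\<lambda>u. a1 u / u) \<longlongrightarrow> 0) at_top"
  proof (rule Lim_transform_eventually)
    show "((\<lambda>u. m u * a1 u / u * inverse (m u)) \<longlongrightarrow> 0) at_top"
      using tendsto_mult[OF prod inv_m] by simp
    show "\<forall>\<^sub>F u in at_top. m u * a1 u / u * inverse (m u) = a1 u / u"
      using m_pos by eventually_elim (simp add: field_simps)
  qed
  have m_u: "((\<lambda>u. m u / u) \<longlongrightarrow> 0) at_top"
  proof (rule Lim_transform_eventually)
    show "((\<lambda>u. m u / a1 u * (a1 u / u)) \<longlongrightarrow> 0) at_top"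
      using tendsto_mult[OF ratio a1_u] by simp
    show "\<forall>\<^sub>F u in at_top. m u / a1 u * (a1 u / u) = m u / u"
      using pos by eventually_elim (simp add: field_simps)
  qed
  show r_u: "((\<lambda>u. r u / u) \<longlongrightarrow> 0) at_top"
  proof (rule Lim_transform_eventually)
    have "((\<lambda>u. inverse u * (1 - \<beta> / 2) + \<beta> / 2 * (m u / u)) \<longlongrightarrow> 0 * (1 - \<beta> / 2) + \<beta> / 2 * 0) at_top"
      by (intro tendsto_intros inv_u m_u)
    then show "((\<lambda>u. inverse u * (1 - \<beta> / 2) + \<beta> / 2 * (m u / u)) \<longlongrightarrow> 0) at_top" by simp
    show "\<forall>\<^sub>F u in at_top. inverse u * (1 - \<beta> / 2) + \<beta> / 2 * (m u / u) = r u / u"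
      using u_pos by eventually_elim (simp add: r_def field_simps)
  qed
  show "((\<lambda>u. (r u)\<^sup>2 / u) \<longlongrightarrow> \<beta>\<^sup>2 / 4 * (\<rho> * \<sigma>)) at_top"
  proof (rule Lim_transform_eventually)
    have "((\<lambda>u. (inverse (m u) * (1 - \<beta> / 2) + \<beta> / 2)\<^sup>2 * (m u / a1 u * (m u * a1 u / u)))
        \<longlongrightarrow> (0 * (1 - \<beta> / 2) + \<beta> / 2)\<^sup>2 * (\<rho> * \<sigma>)) at_top"
      by (intro tendsto_intros inv_m ratio prod)
    then show "((\<lambda>u. (inverse (m u) * (1 - \<beta> / 2) + \<beta> / 2)\<^sup>2 * (m u / a1 u * (m u * a1 u / u)))
        \<longlongrightarrow> \<beta>\<^sup>2 / 4 * (\<rho> * \<sigma>)) at_top" by (simp add: power_divide)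
    show "\<forall>\<^sub>F u in at_top. (inverse (m u) * (1 - \<beta> / 2) + \<beta> / 2)\<^sup>2 * (m u / a1 u * (m u * a1 u / u)) = (r u)\<^sup>2 / u"
      using u_pos m_pos pos
    proof eventually_elim
      case (elim u)
      have "r u = (inverse (m u) * (1 - \<beta> / 2) + \<beta> / 2) * m u"
        using elim by (simp add: r_def field_simps)
      moreover have "m u / a1 u * (m u * a1 u / u) = (m u)\<^sup>2 / u"
        using elim by (simp add: power2_eq_square)
      ultimately show ?case by (simp only: power_mult_distrib times_divide_eq_right)
    qed
  qed
  show "((\<lambda>u. 2 * (a1 u + r u) / u) \<longlongrightarrow> 0) at_top"
    using tendsto_mult[OF tendsto_const[of 2] tendsto_add[OF a1_u r_u]]
    by (simp add: add_divide_distrib)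
qed

text \<open>Rescaling by u makes everything a continuous function of convergent quantities: p = s /
  u, k = \<kappa> / u, q = u b, g = h / u^2 and i = 1 / u. The first limit is that of the variance;
  each summand of the other three keeps a factor k, i or sqrt i, and so vanishes.\<close>

lemma error_limits:
  fixes s \<kappa> r :: "real \<Rightarrow> real" and \<beta> \<sigma> l :: real
  assumes s: "((\<lambda>u. s u / u) \<longlongrightarrow> \<sigma>) at_top"
    and \<kappa>: "((\<lambda>u. \<kappa> u / u) \<longlongrightarrow> 0) at_top"
    and r: "((\<lambda>u. r u / u) \<longlongrightarrow> 0) at_top"
    and r2: "((\<lambda>u. (r u)\<^sup>2 / u) \<longlongrightarrow> l) at_top"
  defines "b \<equiv> \<lambda>u. (u - r u) / (8 * u\<^sup>2)"
    and "h \<equiv> \<lambda>u. 4 * \<beta> * (s u)\<^sup>2 + 4 * (1 - \<beta> / 2) * \<kappa> u * s u + 4 * \<beta> * s u"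
  shows "((\<lambda>u. (s u)\<^sup>2 * (b u)\<^sup>2) \<longlongrightarrow> \<sigma>\<^sup>2 / 64) at_top" (is ?th1)
    and "((\<lambda>u. (r u)\<^sup>2 / (2 * u\<^sup>2) * sqrt (s u)) \<longlongrightarrow> 0) at_top" (is ?th2)
    and "((\<lambda>u. (b u)\<^sup>2 * (\<kappa> u * sqrt (h u) + 6 * \<bar>1 - \<beta> / 2\<bar> * \<kappa> u * s u + 6 * \<beta> * s u
           + 12 * \<beta> * s u * sqrt (s u))) \<longlongrightarrow> 0) at_top" (is ?th3)
    and "((\<lambda>u. \<bar>b u\<bar> ^ 3 * ((4 * \<kappa> u + 12) * h u + 24 * \<beta> * \<kappa> u * s u)) \<longlongrightarrow> 0) at_top" (is ?th4)
proof -
  define i where "i u = 1 / u" for u :: real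
  define p where "p u = s u / u" for u
  define k where "k u = \<kappa> u / u" for u
  define q where "q u = (1 - r u / u) / 8" for u
  define g where "g u = 4 * \<beta> * (p u)\<^sup>2 + 4 * (1 - \<beta> / 2) * k u * p u + 4 * \<beta> * p u * i u" for u
  have i: "(i \<longlongrightarrow> 0) at_top"
    unfolding i_def by real_asymp
  have p: "(p \<longlongrightarrow> \<sigma>) at_top" using s by (simp add: p_def[abs_def])
  have k: "(k \<longlongrightarrow> 0) at_top" using \<kappa> by (simp add: k_def[abs_def])
  have "(q \<longlongrightarrow> (1 - 0) / 8) at_top" unfolding q_def[abs_def] by (intro tendsto_intros r) simp
  then have q: "(q \<longlongrightarrow> 1 / 8) at_top" by simp
  have "(g \<longlongrightarrow> 4 * \<beta> * \<sigma>\<^sup>2 + 4 * (1 - \<beta> / 2) * 0 * \<sigma> + 4 * \<beta> * \<sigma> * 0) at_top"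
    unfolding g_def[abs_def] by (intro tendsto_intros i p k)
  then have g: "(g \<longlongrightarrow> 4 * \<beta> * \<sigma>\<^sup>2) at_top" by simp
  have u_pos: "\<forall>\<^sub>F u :: real in at_top. u > 0"
    by (rule eventually_gt_at_top)
  have b: "b u = q u * i u" and su: "s u = p u * u" and \<kappa>u: "\<kappa> u = k u * u" and iu: "i u * u = 1" if "u > 0" for u
    using that by (simp_all add: b_def q_def i_def p_def k_def field_simps power2_eq_square)
  have h: "h u = g u * u\<^sup>2" if "u > 0" for u
    unfolding h_def g_def su[OF that] \<kappa>u[OF that] using that
    by (simp add: i_def algebra_simps power2_eq_square)
  have sqrt_s: "sqrt (s u) = sqrt (p u) * sqrt u" and sqrt_h: "sqrt (h u) = sqrt (g u) * u"
    and sqrt_u: "sqrt u * sqrt (i u) = 1" and sqrt_i: "sqrt u * i u = sqrt (i u)" if "u > 0" for u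
    using that by (simp_all add: su h real_sqrt_mult i_def real_sqrt_divide real_div_sqrt divide_simps)
  have "((\<lambda>u. (p u)\<^sup>2 * (q u)\<^sup>2) \<longlongrightarrow> \<sigma>\<^sup>2 * (1 / 8)\<^sup>2) at_top"
    by (intro tendsto_intros p q)
  then have "((\<lambda>u. (p u)\<^sup>2 * (q u)\<^sup>2) \<longlongrightarrow> \<sigma>\<^sup>2 / 64) at_top"
    by (simp add: power_divide)
  then show ?th1
  proof (rule Lim_transform_eventually)
    show "\<forall>\<^sub>F u in at_top. (p u)\<^sup>2 * (q u)\<^sup>2 = (s u)\<^sup>2 * (b u)\<^sup>2"
      using u_pos by eventually_elim (simp add: b su i_def power_mult_distrib power_divide)
  qed
  have "((\<lambda>u. (r u)\<^sup>2 / u / 2 * (sqrt (p u) * sqrt (i u))) \<longlongrightarrow> l / 2 * (sqrt \<sigma> * sqrt 0)) at_top"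
    by (intro tendsto_intros r2 p i) simp
  then have "((\<lambda>u. (r u)\<^sup>2 / u / 2 * (sqrt (p u) * sqrt (i u))) \<longlongrightarrow> 0) at_top" by simp
  then show ?th2
  proof (rule Lim_transform_eventually)
    show "\<forall>\<^sub>F u in at_top. (r u)\<^sup>2 / u / 2 * (sqrt (p u) * sqrt (i u)) = (r u)\<^sup>2 / (2 * u\<^sup>2) * sqrt (s u)"
      using u_pos
    proof eventually_elim
      case (elim u)
      have "(r u)\<^sup>2 / (2 * u\<^sup>2) * sqrt (s u) = (r u)\<^sup>2 / u / 2 * (sqrt (p u) * (sqrt u * i u))"
        using elim by (simp add: sqrt_s i_def power2_eq_square)
      then show ?case by (simp only: sqrt_i[OF elim])
    qed
  qed
  have "((\<lambda>u. (q u)\<^sup>2 * (k u * sqrt (g u) + 6 * \<bar>1 - \<beta> / 2\<bar> * k u * p u + 6 * \<beta> * p u * i u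
           + 12 * \<beta> * p u * (sqrt (p u) * sqrt (i u)))) \<longlongrightarrow>
        (1 / 8)\<^sup>2 * (0 * sqrt (4 * \<beta> * \<sigma>\<^sup>2) + 6 * \<bar>1 - \<beta> / 2\<bar> * 0 * \<sigma> + 6 * \<beta> * \<sigma> * 0
           + 12 * \<beta> * \<sigma> * (sqrt \<sigma> * sqrt 0))) at_top"
    by (intro tendsto_intros p q i k g)
  then have "((\<lambda>u. (q u)\<^sup>2 * (k u * sqrt (g u) + 6 * \<bar>1 - \<beta> / 2\<bar> * k u * p u + 6 * \<beta> * p u * i u
           + 12 * \<beta> * p u * (sqrt (p u) * sqrt (i u)))) \<longlongrightarrow> 0) at_top" by simp
  then show ?th3
  proof (rule Lim_transform_eventually)
    show "\<forall>\<^sub>F u in at_top. (q u)\<^sup>2 * (k u * sqrt (g u) + 6 * \<bar>1 - \<beta> / 2\<bar> * k u * p u + 6 * \<beta> * p u * i u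
           + 12 * \<beta> * p u * (sqrt (p u) * sqrt (i u))) =
        (b u)\<^sup>2 * (\<kappa> u * sqrt (h u) + 6 * \<bar>1 - \<beta> / 2\<bar> * \<kappa> u * s u + 6 * \<beta> * s u
           + 12 * \<beta> * s u * sqrt (s u))"
      using u_pos
    proof eventually_elim
      case (elim u)
      \<comment> \<open>The products i u * u = 1 and sqrt u * i u = sqrt (i u) are kept as explicit
        factors and rewritten last, which keeps the algebra polynomial.\<close>
      have "(b u)\<^sup>2 * (\<kappa> u * sqrt (h u) + 6 * \<bar>1 - \<beta> / 2\<bar> * \<kappa> u * s u + 6 * \<beta> * s u
           + 12 * \<beta> * s u * sqrt (s u)) =
        (q u)\<^sup>2 * ((i u * u) * (i u * u) * (k u * sqrt (g u)) + 6 * \<bar>1 - \<beta> / 2\<bar> * k u * p u * ((i u * u) * (i u * u))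
          + 6 * \<beta> * p u * i u * (i u * u) + 12 * \<beta> * p u * (sqrt (p u) * (sqrt u * i u)) * (i u * u))"
        unfolding sqrt_h[OF elim] sqrt_s[OF elim] unfolding b[OF elim] su[OF elim] \<kappa>u[OF elim]
        by (simp add: algebra_simps power2_eq_square)
      then show ?case by (simp only: sqrt_i[OF elim] iu[OF elim] mult_1 mult_1_right)
    qed
  qed
  have "((\<lambda>u. \<bar>q u\<bar> ^ 3 * ((4 * k u + 12 * i u) * g u + 24 * \<beta> * k u * p u * i u)) \<longlongrightarrow>
      \<bar>1 / 8\<bar> ^ 3 * ((4 * 0 + 12 * 0) * (4 * \<beta> * \<sigma>\<^sup>2) + 24 * \<beta> * 0 * \<sigma> * 0)) at_top"
    by (intro tendsto_intros p q i k g)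
  then have "((\<lambda>u. \<bar>q u\<bar> ^ 3 * ((4 * k u + 12 * i u) * g u + 24 * \<beta> * k u * p u * i u)) \<longlongrightarrow> 0) at_top" by simp
  then show ?th4
  proof (rule Lim_transform_eventually)
    show "\<forall>\<^sub>F u in at_top. \<bar>q u\<bar> ^ 3 * ((4 * k u + 12 * i u) * g u + 24 * \<beta> * k u * p u * i u) =
        \<bar>b u\<bar> ^ 3 * ((4 * \<kappa> u + 12) * h u + 24 * \<beta> * \<kappa> u * s u)"
      using u_pos
    proof eventually_elim
      case (elim u)
      have bu: "\<bar>b u\<bar> = \<bar>q u\<bar> * i u"
        using elim by (simp add: b abs_mult i_def)
      have "\<bar>b u\<bar> ^ 3 * ((4 * \<kappa> u + 12) * h u + 24 * \<beta> * \<kappa> u * s u) =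
        \<bar>q u\<bar> ^ 3 * ((4 * k u * (i u * u) + 12 * i u) * g u * ((i u * u) * (i u * u))
          + 24 * \<beta> * k u * p u * i u * ((i u * u) * (i u * u)))"
        unfolding bu h[OF elim] su[OF elim] \<kappa>u[OF elim]
        by (simp only: power_mult_distrib power2_eq_square power3_eq_cube) (simp add: algebra_simps)
      then show ?case by (simp only: iu[OF elim] mult_1 mult_1_right)
    qed
  qed
qed

text \<open>The locale varies with a2 through m and a1. Here its constants become explicit functions
  of the parameters and the law is pulled back to the given probability space, ready for the
  limit.\<close>

lemma laguerre_char_bound:
  assumes "\<beta> > 0" "m \<ge> 1" "a1 > \<beta> / 2 * (real m - 1)" "laguerre_ensemble \<beta> m a1 M \<mu>" "a2 \<noteq> 0"
  defines "r \<equiv> laguerre_r \<beta> m" and "s \<equiv> real m * a1"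
  defines "\<kappa> \<equiv> 2 * (a1 + r)" and "b \<equiv> (a2 - r) / (8 * a2\<^sup>2)"
  defines "h \<equiv> 4 * \<beta> * s\<^sup>2 + 4 * (1 - \<beta> / 2) * \<kappa> * s + 4 * \<beta> * s"
  shows "cmod (char (distr M borel (\<lambda>\<omega>. U_stat \<beta> m a1 a2 (\<mu> \<omega>) + U_centering \<beta> m a1 a2)) t
      - of_real (exp (- 8 * \<beta> * t\<^sup>2 * (s\<^sup>2 * b\<^sup>2))))
    \<le> 2 * \<bar>t\<bar> * (r\<^sup>2 / (2 * a2\<^sup>2) * sqrt s)
      + 16 / 3 * t\<^sup>2 * (b\<^sup>2 * (\<kappa> * sqrt h + 6 * \<bar>1 - \<beta> / 2\<bar> * \<kappa> * s + 6 * \<beta> * s + 12 * \<beta> * s * sqrt s))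
      + 32 / 3 * \<bar>t\<bar> ^ 3 * (\<bar>b\<bar> ^ 3 * ((4 * \<kappa> + 12) * h + 24 * \<beta> * \<kappa> * s))"
proof -
  note ensemble = laguerre_law_ensemble[OF assms(1-4)]
  interpret L: laguerre_law \<beta> m a1 by (rule ensemble(1))
  have "(\<lambda>x. U_stat \<beta> m a1 a2 x + U_centering \<beta> m a1 a2) \<in> borel_measurable (lborel_prod m)"
    by measurable
  from distr_distr[OF this ensemble(3)]
  have "distr M borel (\<lambda>\<omega>. U_stat \<beta> m a1 a2 (\<mu> \<omega>) + U_centering \<beta> m a1 a2) =
      distr L.law borel (\<lambda>x. U_stat \<beta> m a1 a2 x + U_centering \<beta> m a1 a2)"
    unfolding ensemble(2) by (simp add: comp_def)
  then show ?thesis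
  proof (elim ssubst)
    have parameters: "L.coeff_Y a2 = r\<^sup>2 / (2 * a2\<^sup>2)" "L.coeff_Z a2 = b" "L.s = s" "L.\<kappa> = \<kappa>" "L.mean_H = h"
      by (simp_all add: L.coeff_Y_def L.coeff_Z_def L.s_def L.\<kappa>_def L.mean_H_def r_def b_def s_def \<kappa>_def h_def)
    define RB where "RB = \<kappa> * sqrt h + 6 * \<bar>1 - \<beta> / 2\<bar> * \<kappa> * s + 6 * \<beta> * s + 12 * \<beta> * s * sqrt s"
    define JB where "JB = (4 * \<kappa> + 12) * h + 24 * \<beta> * \<kappa> * s"
    have "cmod (char (distr L.law borel (\<lambda>x. U_stat \<beta> m a1 a2 x + U_centering \<beta> m a1 a2)) t
        - of_real (exp (- 8 * \<beta> * s\<^sup>2 * (t * b)\<^sup>2)))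
      \<le> \<bar>t\<bar> * (r\<^sup>2 / (2 * a2\<^sup>2)) * (2 * sqrt s) + 8 * (t * b)\<^sup>2 * (2 / 3 * RB + 4 / 3 * \<bar>t * b\<bar> * JB)"
      using L.char_U_stat_bound[OF assms(5), of t]
      unfolding L.bound_R_def L.bound_J_def parameters RB_def JB_def .
    also have "(t * b)\<^sup>2 = \<bar>t\<bar>\<^sup>2 * \<bar>b\<bar>\<^sup>2"
      by (simp add: power_mult_distrib)
    also have "- 8 * \<beta> * s\<^sup>2 * (\<bar>t\<bar>\<^sup>2 * \<bar>b\<bar>\<^sup>2) = - 8 * \<beta> * t\<^sup>2 * (s\<^sup>2 * b\<^sup>2)"
      by simp
    also have "\<bar>t\<bar> * (r\<^sup>2 / (2 * a2\<^sup>2)) * (2 * sqrt s) + 8 * (\<bar>t\<bar>\<^sup>2 * \<bar>b\<bar>\<^sup>2) * (2 / 3 * RB + 4 / 3 * \<bar>t * b\<bar> * JB)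
      = 2 * \<bar>t\<bar> * (r\<^sup>2 / (2 * a2\<^sup>2) * sqrt s) + 16 / 3 * t\<^sup>2 * (b\<^sup>2 * RB)
      + 32 / 3 * \<bar>t\<bar> ^ 3 * (\<bar>b\<bar> ^ 3 * JB)"
      by (simp add: abs_mult algebra_simps power2_eq_square power3_eq_cube)
    finally show "cmod (char (distr L.law borel (\<lambda>x. U_stat \<beta> m a1 a2 x + U_centering \<beta> m a1 a2)) t
        - of_real (exp (- 8 * \<beta> * t\<^sup>2 * (s\<^sup>2 * b\<^sup>2))))
      \<le> 2 * \<bar>t\<bar> * (r\<^sup>2 / (2 * a2\<^sup>2) * sqrt s) + 16 / 3 * t\<^sup>2 * (b\<^sup>2 *
          (\<kappa> * sqrt h + 6 * \<bar>1 - \<beta> / 2\<bar> * \<kappa> * s + 6 * \<beta> * s + 12 * \<beta> * s * sqrt s))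
      + 32 / 3 * \<bar>t\<bar> ^ 3 * (\<bar>b\<bar> ^ 3 * ((4 * \<kappa> + 12) * h + 24 * \<beta> * \<kappa> * s))"
      unfolding RB_def JB_def .
  qed
qed

lemma laguerre_U_stat_moment:
  assumes "\<beta> > 0" "m \<ge> 1" "a1 > \<beta> / 2 * (real m - 1)" "laguerre_ensemble \<beta> m a1 M \<mu>" "a2 \<noteq> 0"
  shows "integrable M (\<lambda>\<omega>. U_stat \<beta> m a1 a2 (\<mu> \<omega>))"
    and "U_centering \<beta> m a1 a2 = - (\<integral>\<omega>. U_stat \<beta> m a1 a2 (\<mu> \<omega>) \<partial>M)"
    and "(\<lambda>\<omega>. U_stat \<beta> m a1 a2 (\<mu> \<omega>)) \<in> borel_measurable M"
proof -
  note ensemble = laguerre_law_ensemble[OF assms(1-4)]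
  interpret L: laguerre_law \<beta> m a1 by (rule ensemble(1))
  show "(\<lambda>\<omega>. U_stat \<beta> m a1 a2 (\<mu> \<omega>)) \<in> borel_measurable M"
    by (rule measurable_compose[OF ensemble(3) L.U_stat_measurable])
  show "integrable M (\<lambda>\<omega>. U_stat \<beta> m a1 a2 (\<mu> \<omega>))"
    using L.integrable_U_stat[OF assms(5)] unfolding ensemble(2)
    by (subst (asm) integrable_distr_eq[OF ensemble(3) L.U_stat_measurable])
  show "U_centering \<beta> m a1 a2 = - (\<integral>\<omega>. U_stat \<beta> m a1 a2 (\<mu> \<omega>) \<partial>M)"
    using L.integral_U_stat[OF assms(5)] unfolding ensemble(2)
    by (subst (asm) integral_distr[OF ensemble(3) L.U_stat_measurable]) simp
qed

theorem proposition1: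
  fixes \<beta> \<sigma> c :: real
    and m :: "real \<Rightarrow> nat" and a1 :: "real \<Rightarrow> real"
    and M :: "real \<Rightarrow> 'w measure" and \<mu> :: "real \<Rightarrow> 'w \<Rightarrow> nat \<Rightarrow> real"
  assumes "\<beta> > 0"
    and "\<And>a2. a2 > c \<Longrightarrow> m a2 \<ge> 1"
    and "\<And>a2. a2 > c \<Longrightarrow> a1 a2 > \<beta> / 2 * (real (m a2) - 1)"
    and "\<And>a2. a2 > c \<Longrightarrow> a2 > \<beta> / 2 * (real (m a2) - 1)"
    and "\<And>a2. a2 > c \<Longrightarrow> laguerre_ensemble \<beta> (m a2) (a1 a2) (M a2) (\<mu> a2)"
    and "(filterlim m at_top at_top
            \<and> ((\<lambda>a2. real (m a2) / a1 a2) \<longlongrightarrow> 0) at_top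
            \<and> ((\<lambda>a2. real (m a2) * a1 a2 / a2) \<longlongrightarrow> \<sigma>) at_top \<and> \<sigma> > 0)
       \<or> (\<exists>x > 0. \<exists>y > 0. filterlim m at_top at_top
            \<and> ((\<lambda>a2. a1 a2 / sqrt a2) \<longlongrightarrow> x) at_top
            \<and> ((\<lambda>a2. real (m a2) / sqrt a2) \<longlongrightarrow> y) at_top
            \<and> \<sigma> = x * y)"
  shows "weak_conv_along
           (\<lambda>a2. distr (M a2) borel
              (\<lambda>\<omega>. U_stat \<beta> (m a2) (a1 a2) a2 (\<mu> a2 \<omega>) + U_centering \<beta> (m a2) (a1 a2) a2))
           (normal_distribution 0 (\<beta> * \<sigma>\<^sup>2 / 4)) at_top
       \<and> (\<forall>a2 > c. integrable (M a2) (\<lambda>\<omega>. U_stat \<beta> (m a2) (a1 a2) a2 (\<mu> a2 \<omega>))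
            \<and> U_centering \<beta> (m a2) (a1 a2) a2
                = - (\<integral>\<omega>. U_stat \<beta> (m a2) (a1 a2) a2 (\<mu> a2 \<omega>) \<partial>M a2))"
proof -
  have nonneg: "0 \<le> \<beta> / 2 * (real (m u) - 1)" if "u > c" for u
    using assms(1) assms(2)[OF that] by (intro mult_nonneg_nonneg) auto
  have a1_pos: "a1 u > 0" and u_pos: "u > 0" if "u > c" for u
    using nonneg[OF that] assms(3)[OF that] assms(4)[OF that] by linarith+
  \<comment> \<open>Under (A2) \<rho> = 0, under (A3) \<rho> = y / x; its finiteness keeps r^2 / a2
    bounded.\<close>
  obtain \<rho> where m_lim: "filterlim m at_top at_top"
    and ratio: "((\<lambda>u. real (m u) / a1 u) \<longlongrightarrow> \<rho>) at_top"
    and prod: "((\<lambda>u. real (m u) * a1 u / u) \<longlongrightarrow> \<sigma>) at_top" and \<sigma>: "\<sigma> > 0"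
    using assms(6)
  proof (elim disjE exE conjE)
    fix x y
    assume x: "x > 0" "((\<lambda>u. a1 u / sqrt u) \<longlongrightarrow> x) at_top"
      and y: "y > 0" "((\<lambda>u. real (m u) / sqrt u) \<longlongrightarrow> y) at_top" "\<sigma> = x * y"
      and m: "filterlim m at_top at_top"
    have "((\<lambda>u. real (m u) / a1 u) \<longlongrightarrow> y / x) at_top"
    proof (rule Lim_transform_eventually)
      show "((\<lambda>u. real (m u) / sqrt u / (a1 u / sqrt u)) \<longlongrightarrow> y / x) at_top"
        using x y by (intro tendsto_intros) auto
      show "\<forall>\<^sub>F u in at_top. real (m u) / sqrt u / (a1 u / sqrt u) = real (m u) / a1 u"
        using eventually_gt_at_top[of 0] by eventually_elim simp
    qed
    moreover have "((\<lambda>u. real (m u) * a1 u / u) \<longlongrightarrow> \<sigma>) at_top"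
    proof (rule Lim_transform_eventually)
      show "((\<lambda>u. a1 u / sqrt u * (real (m u) / sqrt u)) \<longlongrightarrow> \<sigma>) at_top"
        unfolding y(3) using x y by (intro tendsto_intros)
      show "\<forall>\<^sub>F u in at_top. a1 u / sqrt u * (real (m u) / sqrt u) = real (m u) * a1 u / u"
        using eventually_gt_at_top[of 0] by eventually_elim simp
    qed
    ultimately show thesis
      using m x y by (intro that) auto
  qed (use that in blast)
  define v where "v = \<beta> * \<sigma>\<^sup>2 / 4"
  have v: "v > 0" using assms(1) \<sigma> by (simp add: v_def)
  define P where "P u = distr (M u) borel
    (\<lambda>\<omega>. U_stat \<beta> (m u) (a1 u) u (\<mu> u \<omega>) + U_centering \<beta> (m u) (a1 u) u)" for u
  have moment: "integrable (M u) (\<lambda>\<omega>. U_stat \<beta> (m u) (a1 u) u (\<mu> u \<omega>))"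
    "U_centering \<beta> (m u) (a1 u) u = - (\<integral>\<omega>. U_stat \<beta> (m u) (a1 u) u (\<mu> u \<omega>) \<partial>M u)"
    "(\<lambda>\<omega>. U_stat \<beta> (m u) (a1 u) u (\<mu> u \<omega>)) \<in> borel_measurable (M u)" if "u > c" for u
    using laguerre_U_stat_moment[OF assms(1) assms(2,3,5)[OF that], of u] u_pos[OF that] by auto
  have "weak_conv_along P (normal_distribution 0 v) at_top"
  proof (rule weak_conv_along_at_top)
    fix u assume u: "u > c"
    interpret M: prob_space "M u"
      using assms(5)[OF u] by (simp add: laguerre_ensemble_def)
    show "real_distribution (P u)"
      unfolding P_def using moment(3)[OF u] by (intro M.real_distribution_distr) simp
  next
    show "real_distribution (normal_distribution 0 v)"
      by (rule real_distribution_normal[OF v])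
  next
    fix t
    define r where "r u = laguerre_r \<beta> (m u)" for u
    define s where "s u = real (m u) * a1 u" for u
    define \<kappa> where "\<kappa> u = 2 * (a1 u + r u)" for u
    define b where "b u = (u - r u) / (8 * u\<^sup>2)" for u
    define h where "h u = 4 * \<beta> * (s u)\<^sup>2 + 4 * (1 - \<beta> / 2) * \<kappa> u * s u + 4 * \<beta> * s u" for u
    define E1 where "E1 u = (r u)\<^sup>2 / (2 * u\<^sup>2) * sqrt (s u)" for u
    define E2 where "E2 u = (b u)\<^sup>2 * (\<kappa> u * sqrt (h u) + 6 * \<bar>1 - \<beta> / 2\<bar> * \<kappa> u * s u + 6 * \<beta> * s u
      + 12 * \<beta> * s u * sqrt (s u))" for u
    define E3 where "E3 u = \<bar>b u\<bar> ^ 3 * ((4 * \<kappa> u + 12) * h u + 24 * \<beta> * \<kappa> u * s u)" for u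
    have "filterlim (\<lambda>u. real (m u)) at_top at_top"
      by (rule filterlim_compose[OF filterlim_real_sequentially m_lim])
    moreover have "\<forall>\<^sub>F u in at_top. a1 u > 0"
      using eventually_gt_at_top[of c] by eventually_elim (rule a1_pos)
    ultimately have regime: "((\<lambda>u. r u / u) \<longlongrightarrow> 0) at_top"
      "((\<lambda>u. (r u)\<^sup>2 / u) \<longlongrightarrow> \<beta>\<^sup>2 / 4 * (\<rho> * \<sigma>)) at_top" "((\<lambda>u. \<kappa> u / u) \<longlongrightarrow> 0) at_top"
      using regime_limits[OF _ ratio prod, of \<beta>]
      unfolding r_def \<kappa>_def laguerre_r_def by blast+
    have "((\<lambda>u. s u / u) \<longlongrightarrow> \<sigma>) at_top"
      using prod by (simp add: s_def)
    note limits = error_limits[OF this regime(3,1,2)]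
    have V: "((\<lambda>u. (s u)\<^sup>2 * (b u)\<^sup>2) \<longlongrightarrow> \<sigma>\<^sup>2 / 64) at_top"
      using limits(1) unfolding b_def .
    have E: "(E1 \<longlongrightarrow> 0) at_top" "(E2 \<longlongrightarrow> 0) at_top" "(E3 \<longlongrightarrow> 0) at_top"
      using limits(2) limits(3,4)[of \<beta>] unfolding E1_def[abs_def] E2_def[abs_def] E3_def[abs_def] b_def h_def .
    have "((\<lambda>u. 2 * \<bar>t\<bar> * E1 u + 16 / 3 * t\<^sup>2 * E2 u + 32 / 3 * \<bar>t\<bar> ^ 3 * E3 u) \<longlongrightarrow>
        2 * \<bar>t\<bar> * 0 + 16 / 3 * t\<^sup>2 * 0 + 32 / 3 * \<bar>t\<bar> ^ 3 * 0) at_top"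
      by (intro tendsto_intros E)
    then have lim0: "((\<lambda>u. 2 * \<bar>t\<bar> * E1 u + 16 / 3 * t\<^sup>2 * E2 u + 32 / 3 * \<bar>t\<bar> ^ 3 * E3 u) \<longlongrightarrow> 0) at_top"
      by simp
    have "((\<lambda>u. char (P u) t - of_real (exp (- 8 * \<beta> * t\<^sup>2 * ((s u)\<^sup>2 * (b u)\<^sup>2)))) \<longlongrightarrow> 0) at_top"
    proof (rule Lim_null_comparison[OF _ lim0])
      show "\<forall>\<^sub>F u in at_top. norm (char (P u) t - of_real (exp (- 8 * \<beta> * t\<^sup>2 * ((s u)\<^sup>2 * (b u)\<^sup>2))))
          \<le> 2 * \<bar>t\<bar> * E1 u + 16 / 3 * t\<^sup>2 * E2 u + 32 / 3 * \<bar>t\<bar> ^ 3 * E3 u"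
        using eventually_gt_at_top[of c]
      proof eventually_elim
        case (elim u)
        then have "u \<noteq> 0" using u_pos[OF elim] by simp
        from laguerre_char_bound[OF assms(1) assms(2,3,5)[OF elim] this, of t]
        show ?case
          unfolding P_def E1_def E2_def E3_def h_def b_def \<kappa>_def s_def r_def .
      qed
    qed
    moreover have "((\<lambda>u. of_real (exp (- 8 * \<beta> * t\<^sup>2 * ((s u)\<^sup>2 * (b u)\<^sup>2)))) \<longlongrightarrow>
        complex_of_real (exp (- 8 * \<beta> * t\<^sup>2 * (\<sigma>\<^sup>2 / 64)))) at_top"
      by (intro tendsto_intros V)
    ultimately have "((\<lambda>u. char (P u) t) \<longlongrightarrow> of_real (exp (- 8 * \<beta> * t\<^sup>2 * (\<sigma>\<^sup>2 / 64)))) at_top"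
      by (rule Lim_transform[rotated])
    \<comment> \<open>With b close to 1 / (8 a2), the variance 16 \<beta> s^2 b^2 tends to \<beta>
      \<sigma>^2 / 4.\<close>
    also have "- 8 * \<beta> * t\<^sup>2 * (\<sigma>\<^sup>2 / 64) = - (v * t\<^sup>2) / 2"
      by (simp add: v_def)
    finally show "((\<lambda>u. char (P u) t) \<longlongrightarrow> char (normal_distribution 0 v) t) at_top"
      by (simp only: char_normal_distribution[OF v])
  qed
  with moment show ?thesis
    unfolding P_def v_def by blast
qed

end
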